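(* Let $X_n=\frac{1}{\sqrt n}(a_n(p,q))_{p,q=1,\dots,n}$ be an ensemble of random hermitian matrices as described in the context, associated with equivalence relations $\sim_n$ on $[n]^2$, with $\mathbb{E}(|a_n(p,q)|^2)=s^2$ for all $p\neq q$, where $s>0$ is fixed. Assume (C1) $\alpha_2(n)=O(n^\epsilon)$ for all $\epsilon>0$, and (C2) $\widehat\alpha_0(n)=O(n^{2-\delta})$ for some $\delta>0$. Then for all $m,l\ge1$, as $n\to\infty$, $$C_2\big(\operatorname{Tr}\,T_m(X_n,s),\operatorname{Tr}\,T_l(X_n,s)\big)=\delta_{m,l}\,V_n(m)+o(1),$$ with $$V_n(m)=\begin{cases}\displaystyle\frac1n\sum_{\substack{p,q\\(p,p)\sim_n(q,q)}}\mathbb{E}(a_n(p,p)a_n(q,q)) & m=1,\\[3mm] \displaystyle\frac1{n^2}\sum_{\substack{p,q,p',q'\\ p\ne q,\ p'\ne q'\\(p,q)\sim_n(p',q')}}C_2\big(|a_n(p,q)|^2,|a_n(p',q')|^2\big) & m=2,\\[3mm] \displaystyle\frac1{n^m}\sum_{g\in D_{2m}}\ \sum_{\mathbf P\in S_n^{\mathrm{OD}}(\hat\pi_g)}\ \prod_{k=1}^m\mathbb{E}\big(a_n(P_{1,k})\,a_n(P_{2,g(k)})\big) & m\ge3.\end{cases}$$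
   Context: Ensemble: $[n]=\{1,\dots,n\}$. For each $n\in\mathbb{N}$, $\sim_n$ is an equivalence relation on $[n]^2$ with $(p,q)\sim_n(q,p)$ for all $p,q$. The entries $a_n(p,q)=\overline{a_n(q,p)}$ are complex random variables such that $a_n(p_1,q_1),\dots,a_n(p_j,q_j)$ are independent whenever $(p_1,q_1),\dots,(p_j,q_j)$ belong to $j$ distinct equivalence classes of $\sim_n$. For equivalent pairs $(p,q)\sim_n(p',q')$ the relation between $a_n(p,q)$ and $a_n(p',q')$ is not specified; these variables may be identical or correlated. The entries are centered and satisfy $\sup_n\max_{p,q}\mathbb{E}(|a_n(p,q)|^k)<\infty$ for all $k\in\mathbb{N}$. Statistics of $\sim_n$: $\alpha_2(n)=\max_{(p,q)\in[n]^2}\#\{(p',q')\in[n]^2:(p,q)\sim_n(p',q')\}$ and $\widehat\alpha_0(n)=\#\{(p,q,p')\in[n]^3:(p,q)\sim_n(q,p'),\ p\ne p'\}$. Covariance: $C_2(Y,Z)=\mathbb{E}(YZ)-\mathbb{E}(Y)\mathbb{E}(Z)$. Rescaled Chebyshev polynomials: for $m\ge1$, $T_m$ is the monic polynomial with $T_m(2\cos\theta)=2\cos(m\theta)$, and $T_m(x,s)=s^mT_m(x/s)$. Dihedral group and multi-indices ($m\ge3$): $D_{2m}$ is the group of the $2m$ bijections $g:[m]\to[m]$ sending cyclically neighboring points to cyclically neighboring points. For $g\in D_{2m}$, $\hat\pi_g$ is the pair partition of $\{(i,\ell): i=1,2,\ \ell\in[m]\}$ with blocks $\{(1,\ell),(2,g(\ell))\}$,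 $\ell=1,\dots,m$. A consistent multi-index is $\mathbf P=(P_{i,\ell})_{i=1,2;\,\ell=1,\dots,m}$ with $P_{i,\ell}=(p_{i,\ell},q_{i,\ell})\in[n]^2$ and $q_{i,\ell}=p_{i,\ell+1}$ for $\ell<m$, $q_{i,m}=p_{i,1}$. It is $\hat\pi_g$-compatible if $P_{i,\ell}\sim_nP_{i',\ell'}$ holds exactly when $(i,\ell)$ and $(i',\ell')$ lie in the same block of $\hat\pi_g$. $S_n^{\mathrm{OD}}(\hat\pi_g)$ is the set of consistent $\hat\pi_g$-compatible multi-indices with $p_{i,\ell}\ne q_{i,\ell}$ for all $i,\ell$.
   Formalization: Independence is required of the whole families of entries in distinct equivalence classes, not only of entries chosen one from each class; with the latter alone the claim fails (multiplying some entries of each class by one common random sign gives a counterexample for m = l = 4). *)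

theory Defs
  imports
    "HOL-Probability.Probability"
    "HOL-Computational_Algebra.Polynomial"
    "HOL-Combinatorics.Permutations"
    "HOL-Library.Landau_Symbols"
    "Jordan_Normal_Form.Matrix"
begin

abbreviation pairs :: "nat \<Rightarrow> (nat \<times> nat) set" where
  "pairs n \<equiv> {1..n} \<times> {1..n}"

definition alpha2 :: "nat \<Rightarrow> ((nat \<times> nat) \<times> (nat \<times> nat)) set \<Rightarrow> nat" where
  "alpha2 n r = Max ((\<lambda>P. card {Q \<in> pairs n. (P, Q) \<in> r}) ` pairs n)"

definition alpha0_hat :: "nat \<Rightarrow> ((nat \<times> nat) \<times> (nat \<times> nat)) set \<Rightarrow> nat" where
  "alpha0_hat n r =
     card {(p, q, p'). p \<in> {1..n} \<and> q \<in> {1..n} \<and> p' \<in> {1..n} \<and>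
                       ((p, q), (q, p')) \<in> r \<and> p \<noteq> p'}"

text \<open>
  The families of entries belonging to different equivalence classes are independent, each family
  being viewed as one random vector. Requiring only that one entry from each class be
  independent would not suffice for the theorem: multiplying one entry of every class by a common
  random sign preserves that weaker condition, but correlates products of entries from
  different classes.
\<close>

definition indep_classes ::
  "nat \<Rightarrow> 'w measure \<Rightarrow> ((nat \<times> nat) \<times> (nat \<times> nat)) set \<Rightarrow> (nat \<times> nat \<Rightarrow> 'w \<Rightarrow> complex) \<Rightarrow> bool"
where
  "indep_classes n M r a \<longleftrightarrow>
     prob_space.indep_vars M (\<lambda>C. Pi\<^sub>M C (\<lambda>_. borel)) (\<lambda>C \<omega>. \<lambda>P\<in>C. a P \<omega>) (pairs n // r)"

definition cov2 ::
  "'w measure \<Rightarrow> ('w \<Rightarrow> 'b) \<Rightarrow> ('w \<Rightarrow> 'b) \<Rightarrow> 'b::{banach, second_countable_topology, real_normed_algebra}"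
where
  "cov2 M Y Z = (\<integral>\<omega>. Y \<omega> * Z \<omega> \<partial>M) - (\<integral>\<omega>. Y \<omega> \<partial>M) * (\<integral>\<omega>. Z \<omega> \<partial>M)"

definition cheb :: "nat \<Rightarrow> real poly" where
  "cheb m = (THE T. lead_coeff T = 1 \<and> (\<forall>\<theta>. poly T (2 * cos \<theta>) = 2 * cos (real m * \<theta>)))"

lemma cheb_ex1:
  assumes "m \<ge> 1"
  shows "\<exists>!T :: real poly. lead_coeff T = 1 \<and> (\<forall>\<theta>. poly T (2 * cos \<theta>) = 2 * cos (real m * \<theta>))"
proof -
  define R where "R m T \<longleftrightarrow> lead_coeff T = 1 \<and> degree T = m \<and>
     (\<forall>\<theta>. poly T (2 * cos \<theta>) = 2 * cos (real m * \<theta>))" for m and T :: "real poly"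
  have step: "R (m + 2) (pCons 0 T' - T)"
    if "R (m + 1) T'" and T: "degree T \<le> m"
      "\<forall>\<theta>. poly T (2 * cos \<theta>) = 2 * cos (real m * \<theta>)" for m T T'
  proof -
    have T': "lead_coeff T' = 1" "degree T' = m + 1"
      "\<And>\<theta>. poly T' (2 * cos \<theta>) = 2 * cos (real (m + 1) * \<theta>)"
      using that(1) by (auto simp: R_def)
    have "T' \<noteq> 0" using T'(2) by auto
    then have d: "degree (pCons 0 T') = m + 2" using T'(2) by simp
    have deg: "degree (pCons 0 T' - T) = m + 2"
      using d T(1) degree_add_eq_left[of "- T" "pCons 0 T'"] by simp
    have "coeff (pCons 0 T' - T) (m + 2) = 1"
      using T'(1,2) T(1) by (simp add: coeff_eq_0)
    moreover have "poly (pCons 0 T' - T) (2 * cos \<theta>) = 2 * cos (real (m + 2) * \<theta>)" for \<theta>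
    proof -
      have "cos (real (m + 2) * \<theta>) + cos (real m * \<theta>) = 2 * cos (real (m + 1) * \<theta>) * cos \<theta>"
        using cos_add[of "real (m + 1) * \<theta>" \<theta>] cos_diff[of "real (m + 1) * \<theta>" \<theta>]
        by (simp add: algebra_simps)
      then show ?thesis using T'(3)[of \<theta>] T(2) by (simp add: algebra_simps)
    qed
    ultimately show ?thesis using deg by (simp add: R_def)
  qed
  have R1: "R 1 [:0, 1:]" by (simp add: R_def)
  have R2: "R 2 (pCons 0 [:0, 1:] - [:2:])" using step[of 0 "[:0, 1:]" "[:2:]"] R1
    by (simp add: numeral_2_eq_2)
  have "(\<exists>T. R (Suc k) T) \<and> (\<exists>T. R (Suc (Suc k)) T)" for k
  proof (induction k)
    case 0
    then show ?case using R1 R2 by (auto simp: numeral_2_eq_2)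
  next
    case (Suc k)
    then obtain T T' where "R (Suc k) T" "R (Suc (Suc k)) T'" by blast
    then have "R (Suc k + 2) (pCons 0 T' - T)"
      by (intro step) (auto simp: R_def)
    then show ?case using Suc by auto
  qed
  then obtain T where "R m T" using assms by (cases m) auto
  then have T: "lead_coeff T = 1" "\<forall>\<theta>. poly T (2 * cos \<theta>) = 2 * cos (real m * \<theta>)"
    by (auto simp: R_def)
  show ?thesis
  proof (rule ex1I[of _ T])
    show "lead_coeff T = 1 \<and> (\<forall>\<theta>. poly T (2 * cos \<theta>) = 2 * cos (real m * \<theta>))"
      using T by blast
    fix U :: "real poly"
    assume U: "lead_coeff U = 1 \<and> (\<forall>\<theta>. poly U (2 * cos \<theta>) = 2 * cos (real m * \<theta>))"
    have "{-1..1} \<subseteq> (\<lambda>x. x / 2) ` {x. poly (U - T) x = 0}"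
    proof
      fix y :: real assume "y \<in> {-1..1}"
      then have "poly (U - T) (2 * y) = 0"
        using U T(2) cos_arccos[of y] by (metis atLeastAtMost_iff diff_self poly_diff)
      then show "y \<in> (\<lambda>x. x / 2) ` {x. poly (U - T) x = 0}"
        by (intro image_eqI[of _ _ "2 * y"]) auto
    qed
    moreover have "infinite {-1..1::real}" by (simp add: infinite_Icc)
    ultimately have "infinite {x. poly (U - T) x = 0}"
      using finite_subset by blast
    then show "U = T" using poly_roots_finite[of "U - T"] by auto
  qed
qed

definition cheb_scaled :: "nat \<Rightarrow> real \<Rightarrow> real poly" where
  "cheb_scaled m s = Polynomial.smult (s ^ m) (pcompose (cheb m) [:0, 1 / s:])"

definition poly_mat :: "'a::comm_ring_1 poly \<Rightarrow> 'a mat \<Rightarrow> 'a mat" where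
  "poly_mat T A =
     mat (dim_row A) (dim_row A) (\<lambda>ij. \<Sum>k\<le>degree T. coeff T k * (A ^\<^sub>m k) $$ ij)"

definition trace_mat :: "'a::comm_monoid_add mat \<Rightarrow> 'a" where
  "trace_mat A = (\<Sum>i<dim_row A. A $$ (i, i))"

text \<open>Matrix positions are counted from 0, the entries \<open>a (p, q)\<close> from 1.\<close>

definition ensemble_mat :: "nat \<Rightarrow> (nat \<times> nat \<Rightarrow> 'w \<Rightarrow> complex) \<Rightarrow> 'w \<Rightarrow> complex mat" where
  "ensemble_mat n a \<omega> =
     mat n n (\<lambda>(i, j). complex_of_real (1 / sqrt (real n)) * a (i + 1, j + 1) \<omega>)"

definition trace_cheb ::
  "nat \<Rightarrow> (nat \<times> nat \<Rightarrow> 'w \<Rightarrow> complex) \<Rightarrow> real \<Rightarrow> nat \<Rightarrow> 'w \<Rightarrow> complex"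
where
  "trace_cheb n a s m \<omega> =
     trace_mat (poly_mat (map_poly complex_of_real (cheb_scaled m s)) (ensemble_mat n a \<omega>))"

definition cyc_next :: "nat \<Rightarrow> nat \<Rightarrow> nat" where
  "cyc_next m k = (if k = m then 1 else k + 1)"

definition cyc_neighbors :: "nat \<Rightarrow> nat \<Rightarrow> nat \<Rightarrow> bool" where
  "cyc_neighbors m k l \<longleftrightarrow> l = cyc_next m k \<or> k = cyc_next m l"

definition dihedral :: "nat \<Rightarrow> (nat \<Rightarrow> nat) set" where
  "dihedral m = {g. g permutes {1..m} \<and>
     (\<forall>k\<in>{1..m}. \<forall>l\<in>{1..m}. cyc_neighbors m k l \<longrightarrow> cyc_neighbors m (g k) (g l))}"

definition pi_hat :: "nat \<Rightarrow> (nat \<Rightarrow> nat) \<Rightarrow> (nat \<times> nat) set set" where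
  "pi_hat m g = (\<lambda>l. {(1, l), (2, g l)}) ` {1..m}"

text \<open>A multi-index maps \<open>(i, l)\<close> to \<open>(p\<^sub>i\<^sub>l, q\<^sub>i\<^sub>l)\<close>;
  extensionality makes multi-indices correspond to functions on the finite index set.\<close>

definition consistent_indices :: "nat \<Rightarrow> nat \<Rightarrow> (nat \<times> nat \<Rightarrow> nat \<times> nat) set" where
  "consistent_indices n m = {P \<in> ({1, 2} \<times> {1..m}) \<rightarrow>\<^sub>E pairs n.
     \<forall>i\<in>{1, 2}. \<forall>l\<in>{1..m}. snd (P (i, l)) = fst (P (i, cyc_next m l))}"

definition compatible ::
  "nat \<Rightarrow> ((nat \<times> nat) \<times> (nat \<times> nat)) set \<Rightarrow> (nat \<times> nat) set set \<Rightarrow> (nat \<times> nat \<Rightarrow> nat \<times> nat) \<Rightarrow> bool"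
where
  "compatible m r \<pi> P \<longleftrightarrow>
     (\<forall>u\<in>{1, 2} \<times> {1..m}. \<forall>v\<in>{1, 2} \<times> {1..m}.
        (P u, P v) \<in> r \<longleftrightarrow> (\<exists>B\<in>\<pi>. u \<in> B \<and> v \<in> B))"

definition S_OD ::
  "nat \<Rightarrow> nat \<Rightarrow> ((nat \<times> nat) \<times> (nat \<times> nat)) set \<Rightarrow> (nat \<times> nat) set set \<Rightarrow> (nat \<times> nat \<Rightarrow> nat \<times> nat) set"
where
  "S_OD n m r \<pi> = {P \<in> consistent_indices n m. compatible m r \<pi> P \<and>
     (\<forall>u\<in>{1, 2} \<times> {1..m}. fst (P u) \<noteq> snd (P u))}"

definition V ::
  "nat \<Rightarrow> 'w measure \<Rightarrow> ((nat \<times> nat) \<times> (nat \<times> nat)) set \<Rightarrow> (nat \<times> nat \<Rightarrow> 'w \<Rightarrow> complex) \<Rightarrow> nat \<Rightarrow> complex"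
where
  "V n M r a m =
     (if m = 1 then
        1 / of_nat n *
          (\<Sum>(p, q) \<in> {(p, q) \<in> pairs n. ((p, p), (q, q)) \<in> r}.
             \<integral>\<omega>. a (p, p) \<omega> * a (q, q) \<omega> \<partial>M)
      else if m = 2 then
        1 / of_nat n ^ 2 *
          (\<Sum>(P, Q) \<in> {(P, Q) \<in> pairs n \<times> pairs n. fst P \<noteq> snd P \<and> fst Q \<noteq> snd Q \<and> (P, Q) \<in> r}.
             complex_of_real (cov2 M (\<lambda>\<omega>. (cmod (a P \<omega>))\<^sup>2) (\<lambda>\<omega>. (cmod (a Q \<omega>))\<^sup>2)))
      else
        1 / of_nat n ^ m *
          (\<Sum>g\<in>dihedral m. \<Sum>P\<in>S_OD n m r (pi_hat m g).
             \<Prod>k\<in>{1..m}. \<integral>\<omega>. a (P (1, k)) \<omega> * a (P (2, g k)) \<omega> \<partial>M))"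

end

theory Submission
  imports Defs
begin

text \<open>
  The three-term recursion of the Chebyshev polynomials is the recursion of the matching polynomials
  of paths. Hence \<open>Tr T\<^sub>m(X, s)\<close> is a sum over closed walks \<open>x\<close> of length \<open>m\<close> and over sets \<open>S\<close> of
  disjoint pairs of consecutive edges, each pair \<open>(i, i + 1)\<close> in \<open>S\<close> contributing \<open>-s\<^sup>2\<close> if
  \<open>x\<^sub>i = x\<^sub>i\<^sub>+\<^sub>2\<close> and \<open>0\<close> otherwise, and the remaining edges contributing entries of \<open>X\<close>.
  The covariance becomes a sum over pairs of closed walks. If two consecutive edges of a pair of walks
  form a class and traverse a non-loop back and forth, then its contributions cancel,
  because \<open>E(|a|\<^sup>2) = s\<^sup>2\<close>. Otherwise a pair of walks contributes only if every class of edges has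
  at least two elements and some class meets both walks. Revealing the vertices one after
  another, with \<open>n\<close> choices for an edge of a new class and at most \<open>\<alpha>\<^sub>2(n)\<close> choices for an edge of an old
  one, there are at most about \<open>n\<close> to the number of classes plus one such pairs of walks. One gains
  a factor \<open>n\<close> whenever a walk closes up at an edge the class of which does not occur elsewhere on the
  walk, and a power of \<open>n\<close> by (C2) when adjacent edges are equivalent. With (C1), all but
  \<open>O(n\<^bsup>(m + l) / 2 - \<delta> / 2\<^esup>)\<close> pairs of walks are then matched edge by edge by a dihedral
  bijection, and these add up to \<open>V\<^sub>n(m)\<close>.
\<close>

section \<open>Counting by successive revelation\<close>

text \<open>The normalisation allows the exponent (m + l) / 2. With K classes of at least two edges
  one has K \<le> (m + l) / 2, but K + 1 free choices, one of them for the starting vertex. This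
  excess of one is the obstacle: if all classes are pairs, more than a full factor n has to be
  saved, and a single observation about the walks does not suffice. Hence the defect, which adds up
  savings made at different moments of one revelation, and hence the care for the order of
  revelation: an edge saves a factor n if its label is new and the step that completes it is charged
  to another edge. Exponents are multiples of one half apart from \<delta>, so any missing half pays
  for \<delta> \<le> 1/2. After the saving at an edge whose class does not recur on its circle, only
  two tight patterns are left: all classes are pairs, or one class has four edges, two on each
  circle, and the others are pairs. In both, walks kept out of the main term by a loop alone need an
  argument of their own, because the position of the loop varies with the walk.\<close>

lemma card_le_fibers:
  assumes "finite A" "\<And>y. y \<in> f ` A \<Longrightarrow> card {a \<in> A. f a = y} \<le> k"
  shows "card A \<le> k * card (f ` A)"
proof -
  have "card A = (\<Sum>y\<in>f ` A. card {a \<in> A. f a = y})"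
    using sum.image_gen[OF assms(1), of "\<lambda>_. 1::nat" f] by simp
  also have "\<dots> \<le> (\<Sum>y\<in>f ` A. k)" by (intro sum_mono assms)
  finally show ?thesis by (simp add: mult.commute)
qed

lemma finite_alpha2: "finite ((\<lambda>P. card {Q \<in> pairs n. (P, Q) \<in> r}) ` pairs n)"
  by auto

lemma card_class_le_alpha2:
  assumes "P \<in> pairs n"
  shows "card {Q \<in> pairs n. (P, Q) \<in> r} \<le> alpha2 n r"
  unfolding alpha2_def using assms by (intro Max_ge finite_alpha2) auto

lemma alpha2_ge_1:
  assumes "equiv (pairs n) r" "n \<ge> 1"
  shows "alpha2 n r \<ge> 1"
proof -
  have P: "(1, 1) \<in> pairs n" using assms by auto
  have "((1, 1), (1, 1)) \<in> r" using assms(1) P by (auto simp: equiv_def refl_on_def)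
  then have "{Q \<in> pairs n. ((1, 1), Q) \<in> r} \<noteq> {}" using P by auto
  then have "card {Q \<in> pairs n. ((1, 1), Q) \<in> r} > 0" by (subst card_gt_0_iff) auto
  then show ?thesis using card_class_le_alpha2[OF P, of r] by linarith
qed

text \<open>
  The elements of \<open>E\<close> are vertices, and \<open>e\<close> also stands for the edge from \<open>e\<close> to \<open>nx e\<close>.
  The maps in \<open>\<Omega>\<close> place the vertices in \<open>{1..n}\<close>, and \<open>\<beta>\<close> labels the edges.
\<close>

locale reveal =
  fixes E :: "'e set" and nx :: "'e \<Rightarrow> 'e" and n :: nat
    and r :: "((nat \<times> nat) \<times> (nat \<times> nat)) set" and \<beta> :: "'e \<Rightarrow> 'b"
    and \<Omega> :: "('e \<Rightarrow> nat) set" and C :: real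
  assumes finite_E: "finite E" and nx_E: "e \<in> E \<Longrightarrow> nx e \<in> E" and n_pos: "n \<ge> 1"
    and C_ge_1: "C \<ge> 1" and equiv_r: "equiv (pairs n) r"
    and Omega_sub: "\<Omega> \<subseteq> E \<rightarrow>\<^sub>E {1..n}"
    and label_related: "x \<in> \<Omega> \<Longrightarrow> e \<in> E \<Longrightarrow> f \<in> E \<Longrightarrow> \<beta> e = \<beta> f \<Longrightarrow>
       ((x e, x (nx e)), (x f, x (nx f))) \<in> r"
begin

text \<open>
  The defect \<open>d\<close> in \<open>D U d\<close> compares the number \<open>N U\<close> of placements of \<open>U\<close> with one free choice for each
  label in \<open>\<kappa> U\<close>; it never increases when an edge with an end in \<open>U\<close> or with a label in \<open>\<kappa> U\<close> is added.
\<close>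

definition N :: "'e set \<Rightarrow> nat" where
  "N U = card ((\<lambda>x. restrict x U) ` \<Omega>)"

definition \<kappa> :: "'e set \<Rightarrow> 'b set" where
  "\<kappa> U = \<beta> ` {e \<in> E. e \<in> U \<and> nx e \<in> U}"

definition D :: "'e set \<Rightarrow> real \<Rightarrow> bool" where
  "D U d \<longleftrightarrow> U \<subseteq> E \<and>
     real (N U) \<le> C * real n powr (real (card (\<kappa> U)) + d) * real (alpha2 n r) ^ card U"

lemma finite_Omega: "finite \<Omega>"
  using finite_PiE[OF finite_E, of "\<lambda>_. {1..n}"] Omega_sub finite_subset by blast

lemma Omega_range: "x \<in> \<Omega> \<Longrightarrow> e \<in> E \<Longrightarrow> x e \<in> {1..n}"
  using Omega_sub by blast

lemma finite_kappa: "finite (\<kappa> U)"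
  using finite_E by (simp add: \<kappa>_def)

lemma kappa_I: "e \<in> E \<Longrightarrow> e \<in> U \<Longrightarrow> nx e \<in> U \<Longrightarrow> \<beta> e \<in> \<kappa> U"
  by (auto simp: \<kappa>_def)

lemma kappa_mono: "U \<subseteq> U' \<Longrightarrow> \<kappa> U \<subseteq> \<kappa> U'"
  by (auto simp: \<kappa>_def)

lemma alpha_ge_1: "real (alpha2 n r) \<ge> 1"
  using alpha2_ge_1[OF equiv_r n_pos] by simp

lemma N_fibers:
  assumes sub: "U \<subseteq> U'" and k: "\<And>x0. x0 \<in> \<Omega> \<Longrightarrow>
     card ((\<lambda>x. restrict x U') ` {x \<in> \<Omega>. restrict x U = restrict x0 U}) \<le> k"
  shows "N U' \<le> k * N U"
proof -
  let ?A = "(\<lambda>x. restrict x U') ` \<Omega>"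
  have r: "restrict (restrict x U') U = restrict x U" for x :: "'e \<Rightarrow> nat"
    using sub by (simp add: Int_absorb1 restrict_restrict)
  have "(\<lambda>y. restrict y U) ` ?A = (\<lambda>x. restrict x U) ` \<Omega>"
    by (simp only: image_image r)
  moreover have "card ?A \<le> k * card ((\<lambda>y. restrict y U) ` ?A)"
  proof (rule card_le_fibers)
    fix y assume "y \<in> (\<lambda>y. restrict y U) ` ?A"
    then obtain x0 where x0: "x0 \<in> \<Omega>" "y = restrict x0 U" by (auto simp: Int_absorb1[OF sub])
    have "{a \<in> ?A. restrict a U = y} = (\<lambda>x. restrict x U') ` {x \<in> \<Omega>. restrict x U = restrict x0 U}"
      using x0(2) by (auto simp: Int_absorb1[OF sub])
    then show "card {a \<in> ?A. restrict a U = y} \<le> k" using k[OF x0(1)] by simp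
  qed (use finite_Omega in simp)
  ultimately show ?thesis by (simp add: N_def)
qed

lemma N_insert:
  assumes "v \<in> E" shows "N (insert v U) \<le> n * N U"
proof (rule N_fibers)
  fix x0 assume "x0 \<in> \<Omega>"
  let ?B = "(\<lambda>x. restrict x (insert v U)) ` {x \<in> \<Omega>. restrict x U = restrict x0 U}"
  have "inj_on (\<lambda>z. z v) ?B"
  proof (rule inj_onI, clarify)
    fix x y assume xy: "restrict x U = restrict x0 U" "restrict y U = restrict x0 U"
      "restrict x (insert v U) v = restrict y (insert v U) v"
    have "x u = y u" if "u \<in> U" for u
      using xy(1,2) that by (metis restrict_apply')
    then show "restrict x (insert v U) = restrict y (insert v U)"
      using xy(3) by (auto simp: restrict_def fun_eq_iff)
  qed
  moreover have "(\<lambda>z. z v) ` ?B \<subseteq> {1..n}" using Omega_range[OF _ assms] by auto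
  ultimately have "card ?B \<le> card {1..n}" using card_inj_on_le finite_atLeastAtMost by blast
  then show "card ?B \<le> n" by simp
qed auto

text \<open>The edge \<open>f\<close> must land in the class of the placed edge \<open>e\<close>,
  which has at most \<open>alpha2 n r\<close> elements, and this fixes both ends of \<open>f\<close>
  at once. Neither end has to be adjacent to \<open>U\<close>, so the revelation can jump to another
  place or to the other circle.\<close>

lemma N_jump:
  assumes e: "e \<in> E" "e \<in> U" "nx e \<in> U" and f: "f \<in> E" "\<beta> e = \<beta> f"
  shows "N (U \<union> {f, nx f}) \<le> alpha2 n r * N U"
proof (rule N_fibers)
  fix x0 assume x0: "x0 \<in> \<Omega>"
  let ?U = "U \<union> {f, nx f}"
  let ?B = "(\<lambda>x. restrict x ?U) ` {x \<in> \<Omega>. restrict x U = restrict x0 U}"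
  let ?P = "(x0 e, x0 (nx e))"
  have eq: "x u = x0 u" if "restrict x U = restrict x0 U" "u \<in> U" for x u
    using that by (metis restrict_apply')
  have "inj_on (\<lambda>z. (z f, z (nx f))) ?B"
  proof (rule inj_onI, clarify)
    fix x y assume xy: "restrict x U = restrict x0 U" "restrict y U = restrict x0 U"
      "restrict x ?U f = restrict y ?U f" "restrict x ?U (nx f) = restrict y ?U (nx f)"
    show "restrict x ?U = restrict y ?U"
      using xy(3,4) eq[OF xy(1)] eq[OF xy(2)] by (auto simp: restrict_def fun_eq_iff)
  qed
  moreover have "(\<lambda>z. (z f, z (nx f))) ` ?B \<subseteq> {Q \<in> pairs n. (?P, Q) \<in> r}"
  proof clarsimp
    fix x assume x: "x \<in> \<Omega>" "restrict x U = restrict x0 U"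
    show "Suc 0 \<le> x f \<and> x f \<le> n \<and> Suc 0 \<le> x (nx f) \<and> x (nx f) \<le> n \<and>
      ((x0 e, x0 (nx e)), x f, x (nx f)) \<in> r"
      using Omega_range[OF x(1) f(1)] Omega_range[OF x(1) nx_E[OF f(1)]]
        label_related[OF x(1) e(1) f] eq[OF x(2) e(2)] eq[OF x(2) e(3)] by auto
  qed
  ultimately have "card ?B \<le> card {Q \<in> pairs n. (?P, Q) \<in> r}"
    by (rule card_inj_on_le) auto
  also have "\<dots> \<le> alpha2 n r"
    using Omega_range[OF x0 e(1)] Omega_range[OF x0 nx_E[OF e(1)]]
    by (intro card_class_le_alpha2) auto
  finally show "card ?B \<le> alpha2 n r" .
qed auto

text \<open>If the label of \<open>f\<close> is known, the step costs at most one factor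
  \<open>alpha2 n r\<close>, absorbed by the growth of \<open>card U\<close>. Otherwise one end of
  \<open>f\<close> is already in \<open>U\<close>, so at most one vertex costs a factor
  \<open>n\<close>, and the new label of \<open>f\<close> pays for it. The edges in \<open>Q\<close>
  are completed by the same step without a choice of their own, so each of their new labels lowers
  the defect by one.\<close>

lemma D_step:
  assumes D: "D U d" and f: "f \<in> E" and cond: "f \<in> U \<or> nx f \<in> U \<or> \<beta> f \<in> \<kappa> U"
    and Q: "Q \<subseteq> E" "\<And>g. g \<in> Q \<Longrightarrow> g \<in> U \<union> {f, nx f} \<and> nx g \<in> U \<union> {f, nx f}"
      "inj_on \<beta> Q" "\<beta> ` Q \<inter> \<kappa> U = {}" "\<beta> f \<notin> \<beta> ` Q"
  shows "D (U \<union> {f, nx f}) (d - real (card Q))"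
proof -
  let ?U = "U \<union> {f, nx f}" let ?a = "real (alpha2 n r)"
  have U: "U \<subseteq> E" and finU: "finite U" using D finite_E finite_subset by (auto simp: D_def)
  have U': "?U \<subseteq> E" "finite ?U" using U finU f nx_E by auto
  have finQ: "finite Q" using Q(1) finite_E finite_subset by blast
  have cQ: "card (\<beta> ` Q) = card Q" using Q(3) by (simp add: card_image)
  have QU: "\<beta> ` Q \<subseteq> \<kappa> ?U" using Q(1,2) by (auto intro!: kappa_I)
  have fU: "\<beta> f \<in> \<kappa> ?U" using f by (auto intro!: kappa_I)
  have DU: "real (N U) \<le> C * real n powr (real (card (\<kappa> U)) + d) * ?a ^ card U"
    using D by (simp add: D_def)
  have n1: "real n \<ge> 1" using n_pos by simp
  show ?thesis
  proof (cases "\<beta> f \<in> \<kappa> U")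
    case True
    then obtain e where e: "e \<in> E" "e \<in> U" "nx e \<in> U" "\<beta> e = \<beta> f" by (auto simp: \<kappa>_def)
    have c: "card (\<kappa> U) + card Q \<le> card (\<kappa> ?U)"
    proof -
      have "card (\<kappa> U) + card Q = card (\<kappa> U \<union> \<beta> ` Q)"
        using Q(4) finQ by (subst card_Un_disjoint) (auto simp: finite_kappa cQ)
      also have "\<dots> \<le> card (\<kappa> ?U)" using QU kappa_mono[of U ?U]
        by (intro card_mono finite_kappa) auto
      finally show ?thesis .
    qed
    \<comment> \<open>If \<open>U\<close> does not grow, no factor \<open>alpha2 n r\<close> becomes
      available, but none is spent either.\<close>
    have NU: "real (N ?U) \<le> real (N U) * ?a ^ (card ?U - card U)"
    proof (cases "?U = U")
      case False
      then have "U \<subset> ?U" by blast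
      then have "card U < card ?U" by (rule psubset_card_mono[OF U'(2)])
      then have "?a ^ 1 \<le> ?a ^ (card ?U - card U)"
        using alpha_ge_1 by (intro power_increasing) auto
      moreover have "real (N ?U) \<le> ?a * real (N U)"
        using N_jump[OF e(1-3) f e(4)] by (metis of_nat_le_iff of_nat_mult)
      ultimately show ?thesis
        by (smt (verit) mult.commute mult_right_mono of_nat_0_le_iff power_one_right)
    qed simp
    have le: "card U \<le> card ?U" using U'(2) by (intro card_mono) auto
    have "real (N ?U) \<le> (C * real n powr (real (card (\<kappa> U)) + d) * ?a ^ card U) * ?a ^ (card ?U - card U)"
      using NU DU by (smt (verit) alpha_ge_1 mult_right_mono zero_le_power)
    also have "\<dots> = C * real n powr (real (card (\<kappa> U)) + d) * ?a ^ card ?U"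
      using le by (simp add: power_add[symmetric] mult.assoc)
    also have "\<dots> \<le> C * real n powr (real (card (\<kappa> ?U)) + (d - real (card Q))) * ?a ^ card ?U"
      using c C_ge_1 n1 by (intro mult_right_mono mult_left_mono powr_mono) auto
    finally show ?thesis using U' by (simp add: D_def)
  next
    case False
    have c: "card (\<kappa> U) + 1 + card Q \<le> card (\<kappa> ?U)"
    proof -
      have "card (\<kappa> U) + 1 + card Q = card (insert (\<beta> f) (\<kappa> U \<union> \<beta> ` Q))"
        using Q(4,5) finQ False
        by (subst card_insert_disjoint, simp add: finite_kappa, simp, subst card_Un_disjoint)
           (auto simp: finite_kappa cQ)
      also have "\<dots> \<le> card (\<kappa> ?U)" using QU kappa_mono[of U ?U] fU
        by (intro card_mono finite_kappa) auto
      finally show ?thesis .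
    qed
    have "N ?U \<le> n * N U"
    proof -
      have "?U = insert (nx f) U \<or> ?U = insert f U" using cond False by auto
      then show ?thesis using N_insert[OF f] N_insert[OF nx_E[OF f]] by metis
    qed
    then have "real (N ?U) \<le> real n * real (N U)" by (metis of_nat_le_iff of_nat_mult)
    also have "\<dots> \<le> real n * (C * real n powr (real (card (\<kappa> U)) + d) * ?a ^ card U)"
      using DU by (intro mult_left_mono) auto
    also have "\<dots> = C * real n powr (real (card (\<kappa> U)) + d + 1) * ?a ^ card U"
      using n_pos by (simp add: powr_add)
    also have "\<dots> \<le> C * real n powr (real (card (\<kappa> ?U)) + (d - real (card Q))) * ?a ^ card ?U"
      using c C_ge_1 n1 alpha_ge_1 U'(2)
      by (intro mult_mono mult_left_mono powr_mono power_increasing card_mono) auto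
    finally show ?thesis using U' by (simp add: D_def)
  qed
qed

lemma D_step0:
  assumes "D U d" "f \<in> E" "f \<in> U \<or> nx f \<in> U \<or> \<beta> f \<in> \<kappa> U"
  shows "D (U \<union> {f, nx f}) d"
  using D_step[OF assms, of "{}"] by simp

lemma D_step1:
  assumes "D U d" "f \<in> E" "f \<in> U \<or> nx f \<in> U \<or> \<beta> f \<in> \<kappa> U"
    "g \<in> E" "g \<in> U \<union> {f, nx f}" "nx g \<in> U \<union> {f, nx f}" "\<beta> g \<notin> \<kappa> U" "\<beta> g \<noteq> \<beta> f"
  shows "D (U \<union> {f, nx f}) (d - 1)"
  using D_step[OF assms(1-3), of "{g}"] assms(4-) by auto

lemma funpow_nx_E: "e \<in> E \<Longrightarrow> (nx ^^ t) e \<in> E"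
  by (induction t) (auto intro: nx_E)

lemma D_path:
  assumes "D U d" "e \<in> E" "e \<in> U"
  shows "D (U \<union> (\<lambda>j. (nx ^^ j) e) ` {..t}) d"
proof (induction t)
  case 0
  then show ?case using assms by (simp add: insert_absorb)
next
  case (Suc t)
  have "D (U \<union> (\<lambda>j. (nx ^^ j) e) ` {..t} \<union> {(nx ^^ t) e, nx ((nx ^^ t) e)}) d"
    using Suc assms(2) by (intro D_step0 funpow_nx_E) auto
  moreover have "U \<union> (\<lambda>j. (nx ^^ j) e) ` {..t} \<union> {(nx ^^ t) e, nx ((nx ^^ t) e)}
      = U \<union> (\<lambda>j. (nx ^^ j) e) ` {..Suc t}" by (auto simp: atMost_Suc)
  ultimately show ?case by simp
qed

text \<open>Revelation against the orientation of the walk, from \<open>(nx ^^ t) e\<close> back to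
  \<open>e\<close>. It serves when the vertex to be placed last is prescribed and has to be
  approached from both sides.\<close>

lemma D_path_back:
  assumes "D U d" "e \<in> E" "(nx ^^ t) e \<in> U"
  shows "D (U \<union> (\<lambda>j. (nx ^^ j) e) ` {..t}) d"
  using assms
proof (induction t arbitrary: U)
  case 0
  then show ?case by (simp add: insert_absorb)
next
  case (Suc t)
  let ?V = "U \<union> {(nx ^^ t) e, nx ((nx ^^ t) e)}"
  have "D ?V d" using Suc.prems by (intro D_step0 funpow_nx_E) auto
  then have "D (?V \<union> (\<lambda>j. (nx ^^ j) e) ` {..t}) d" by (intro Suc.IH Suc.prems) auto
  moreover have "?V \<union> (\<lambda>j. (nx ^^ j) e) ` {..t} = U \<union> (\<lambda>j. (nx ^^ j) e) ` {..Suc t}"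
    by (auto simp: atMost_Suc)
  ultimately show ?case by simp
qed

text \<open>A single vertex has \<open>n\<close> placements and in general no completed edge to
  account for them. This is the excess of one that all savings have to compensate.\<close>

lemma D_start:
  assumes "v \<in> E" shows "D {v} 1"
proof -
  have "N {} \<le> 1"
    unfolding N_def by (rule order_trans[OF card_mono[of "{\<lambda>_. undefined}"]]) (auto simp: restrict_def)
  then have "N {v} \<le> n" using N_insert[OF assms, of "{}"]
    by (metis le_trans mult.right_neutral mult_le_mono2)
  then have "real (N {v}) \<le> 1 * real n powr 1 * 1" using n_pos by simp
  also have "\<dots> \<le> C * real n powr (real (card (\<kappa> {v})) + 1) * real (alpha2 n r) ^ card {v}"
    using C_ge_1 n_pos alpha_ge_1 by (intro mult_mono powr_mono) auto
  finally show ?thesis using assms by (simp add: D_def)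
qed

text \<open>Entry point for starting sets that are counted by other means, such as loops and the
  triples in (C2). The constant in their counts is why \<open>D\<close> carries the factor
  \<open>C\<close>.\<close>

lemma D_initial:
  assumes "U \<subseteq> E" "real (N U) \<le> C * real n powr (real (card (\<kappa> U)) + d)"
  shows "D U d"
proof -
  have "C * real n powr (real (card (\<kappa> U)) + d) * 1 \<le>
    C * real n powr (real (card (\<kappa> U)) + d) * real (alpha2 n r) ^ card U"
    using C_ge_1 alpha_ge_1 by (intro mult_left_mono one_le_power) auto
  then show ?thesis using assms by (simp add: D_def)
qed

lemma card_Omega:
  assumes "D E d"
  shows "real (card \<Omega>) \<le> C * real n powr (real (card (\<beta> ` E)) + d) * real (alpha2 n r) ^ card E"
proof -
  have "restrict x E = x" if "x \<in> \<Omega>" for x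
    using that Omega_sub by (metis PiE_restrict subsetD)
  then have "(\<lambda>x. restrict x E) ` \<Omega> = \<Omega>" by force
  moreover have "\<kappa> E = \<beta> ` E" using nx_E by (auto simp: \<kappa>_def)
  ultimately show ?thesis using assms by (simp add: D_def N_def)
qed

section \<open>Savings on a single cycle\<close>

definition cycle :: "'e set \<Rightarrow> nat \<Rightarrow> bool" where
  "cycle A L \<longleftrightarrow> A \<subseteq> E \<and> L \<ge> 1 \<and> (\<forall>e\<in>A. inj_on (\<lambda>t. (nx ^^ t) e) {..<L} \<and>
     (\<lambda>t. (nx ^^ t) e) ` {..<L} = A \<and> (nx ^^ L) e = e)"

lemma cycleD:
  assumes "cycle A L"
  shows "A \<subseteq> E" "L \<ge> 1"
    "e \<in> A \<Longrightarrow> t < L \<Longrightarrow> t' < L \<Longrightarrow> (nx ^^ t) e = (nx ^^ t') e \<longleftrightarrow> t = t'"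
    "e \<in> A \<Longrightarrow> f \<in> A \<longleftrightarrow> (\<exists>t<L. f = (nx ^^ t) e)"
    "e \<in> A \<Longrightarrow> (nx ^^ L) e = e"
    "e \<in> A \<Longrightarrow> (\<lambda>t. (nx ^^ t) e) ` {..<L} = A"
  using assms unfolding cycle_def
  by (blast, blast, metis inj_on_eq_iff lessThan_iff, blast, blast, blast)

lemma cycle_nx: "cycle A L \<Longrightarrow> e \<in> A \<Longrightarrow> nx e \<in> A"
proof -
  assume c: "cycle A L" and e: "e \<in> A"
  show ?thesis
  proof (cases "L = 1")
    case True
    then show ?thesis using cycleD(5)[OF c e] e by simp
  next
    case False
    then have "nx e = (nx ^^ 1) e \<and> 1 < L" using cycleD(2)[OF c] by simp
    then show ?thesis using cycleD(4)[OF c e, of "nx e"] by blast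
  qed
qed

lemma cycle_last: "cycle A L \<Longrightarrow> k \<in> A \<Longrightarrow> (nx ^^ (L - 1)) (nx k) = k"
  using cycleD(2,5)[of A L] by (metis Suc_diff_1 comp_apply funpow_Suc_right less_eq_Suc_le One_nat_def)

lemma D_cycle:
  assumes c: "cycle A L" and "D U d" "e \<in> U" "e \<in> A"
  shows "D (U \<union> A) d"
proof -
  have "D (U \<union> (\<lambda>j. (nx ^^ j) e) ` {..L - 1}) d"
    using assms cycleD(1)[OF c] by (intro D_path) auto
  moreover have "{..L - 1} = {..<L}" using cycleD(2)[OF c] by auto
  ultimately show ?thesis using cycleD(6)[OF c assms(4)] by simp
qed

lemma D_cycle_eq:
  assumes "cycle A L" "D U d" "e \<in> U" "e \<in> A" "U \<subseteq> A"
  shows "D A d"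
  using D_cycle[OF assms(1-4)] assms(5) by (simp add: Un_absorb1)

lemma D_segment:
  assumes "e \<in> E" shows "D ((\<lambda>j. (nx ^^ j) e) ` {..t}) 1"
proof -
  have "e \<in> (\<lambda>j. (nx ^^ j) e) ` {..t}" by (rule image_eqI[of _ _ 0]) auto
  then show ?thesis using D_path[OF D_start[OF assms] assms, of t] by (simp add: insert_absorb)
qed

text \<open>Because of \<open>t + 1 < L\<close> the segment does not close up, so the edge leaving
  its last vertex is incomplete and only labels of earlier edges occur.\<close>

lemma kappa_segment:
  assumes c: "cycle A L" and e: "e \<in> A" and t: "t + 1 < L"
    and b: "b \<in> \<kappa> ((\<lambda>j. (nx ^^ j) e) ` {..t})"
  shows "\<exists>a<t. b = \<beta> ((nx ^^ a) e)"
proof -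
  obtain a where a: "a \<le> t" "b = \<beta> ((nx ^^ a) e)" "nx ((nx ^^ a) e) \<in> (\<lambda>j. (nx ^^ j) e) ` {..t}"
    using b unfolding \<kappa>_def by blast
  then obtain a' where "a' \<le> t" "(nx ^^ Suc a) e = (nx ^^ a') e" by auto
  then have "Suc a = a'" using cycleD(3)[OF c e, of "Suc a" a'] a(1) t by auto
  then have "a < t" using \<open>a' \<le> t\<close> by simp
  then show ?thesis using a(2) by blast
qed

text \<open>The walk is revealed from \<open>nx k\<close> onwards, so the vertex \<open>k\<close>
  comes last. Its placement is charged to the edge that ends in \<open>k\<close> and completes the
  edge \<open>k\<close> as well. The label of \<open>k\<close> occurs nowhere else on the cycle, so
  it is new and a factor \<open>n\<close> is saved.\<close>

lemma D_close:
  assumes c: "cycle A L" and k: "k \<in> A" "\<And>f. f \<in> A \<Longrightarrow> f \<noteq> k \<Longrightarrow> \<beta> f \<noteq> \<beta> k"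
    and L: "L \<ge> 2" and D: "D ((\<lambda>j. (nx ^^ j) (nx k)) ` {..L - 2}) d"
  shows "D A (d - 1)"
proof -
  let ?e = "nx k" let ?s = "\<lambda>t. (nx ^^ t) (nx k)"
  let ?U = "?s ` {..L - 2}"
  have e: "?e \<in> A" using cycle_nx[OF c k(1)] .
  have last: "?s (L - 1) = k" using cycle_last[OF c k(1)] .
  have l1: "L - 2 + 1 < L" and l2: "L - 2 < L - 1" using L by linarith+
  have sA: "?s t \<in> A" if "t < L" for t using cycleD(4)[OF c e] that by blast
  have nk: "\<beta> (?s a) \<noteq> \<beta> k" if "a < L - 1" for a
  proof (rule k(2))
    show "?s a \<in> A" using sA that by simp
    have "?s a \<noteq> ?s (L - 1)" using cycleD(3)[OF c e, of a "L - 1"] that L by auto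
    then show "?s a \<noteq> k" using last by simp
  qed
  have nxf: "nx (?s (L - 2)) = k"
  proof -
    have "Suc (L - 2) = L - 1" using L by simp
    then show ?thesis using last by (metis comp_apply funpow.simps(2))
  qed
  have "D (?U \<union> {?s (L - 2), nx (?s (L - 2))}) (d - 1)"
  proof (rule D_step1[OF D])
    show "?s (L - 2) \<in> E" "k \<in> E" using sA[of "L - 2"] L cycleD(1)[OF c] k(1) by auto
    show "?s (L - 2) \<in> ?U \<or> nx (?s (L - 2)) \<in> ?U \<or> \<beta> (?s (L - 2)) \<in> \<kappa> ?U" by auto
    show "k \<in> ?U \<union> {?s (L - 2), nx (?s (L - 2))}" using nxf by simp
    have "?s 0 \<in> ?U" by (rule imageI) simp
    then show "nx k \<in> ?U \<union> {?s (L - 2), nx (?s (L - 2))}" by simp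
    show "\<beta> k \<notin> \<kappa> ?U"
    proof
      assume "\<beta> k \<in> \<kappa> ?U"
      then obtain a where "a < L - 2" "\<beta> k = \<beta> (?s a)"
        using kappa_segment[OF c e l1] by blast
      moreover have "a < L - 1" using \<open>a < L - 2\<close> by linarith
      ultimately show False using nk[of a] by simp
    qed
    show "\<beta> k \<noteq> \<beta> (?s (L - 2))" using nk[OF l2] by simp
  qed
  then show ?thesis
    by (rule D_cycle_eq[OF c, of _ _ k]) (use nxf k sA L in auto)
qed

lemma D_unique:
  assumes c: "cycle A L" and k: "k \<in> A" "\<And>f. f \<in> A \<Longrightarrow> f \<noteq> k \<Longrightarrow> \<beta> f \<noteq> \<beta> k"
  shows "D A 0"
proof (cases "L = 1")
  \<comment> \<open>On a cycle of length one, placing the vertex already completes the loop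
    \<open>k\<close>, whose label pays for the \<open>n\<close> choices.\<close>
  case True
  then have A: "A = {k}" using cycleD(6)[OF c k(1)] by auto
  have nx: "nx k = k" using True cycleD(5)[OF c k(1)] by simp
  have kE: "k \<in> E" using k(1) cycleD(1)[OF c] by auto
  have "N {} \<le> 1"
    unfolding N_def by (rule order_trans[OF card_mono[of "{\<lambda>_. undefined}"]]) (auto simp: restrict_def)
  then have "N {k} \<le> n" using N_insert[OF kE, of "{}"]
    by (metis le_trans mult.right_neutral mult_le_mono2)
  moreover have "\<kappa> {k} = {\<beta> k}" using nx kE by (auto simp: \<kappa>_def)
  moreover have "1 * real n \<le> C * real n" using C_ge_1 by (intro mult_right_mono) auto
  then have "real (N {k}) \<le> C * real n" using \<open>N {k} \<le> n\<close> by linarith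
  ultimately have "real (N {k}) \<le> C * real n powr (real (card (\<kappa> {k})) + 0)"
    using n_pos by simp
  then show ?thesis unfolding A using kE by (intro D_initial) auto
next
  case False
  then have L: "L \<ge> 2" using cycleD(2)[OF c] by simp
  have "nx k \<in> E" using cycle_nx[OF c k(1)] cycleD(1)[OF c] by auto
  then show ?thesis using D_close[OF c k L D_segment] by simp
qed

text \<open>Here \<open>j\<close> is the first position whose label has occurred before, say at
  \<open>i\<close>. Neighbouring labels differ, so \<open>i\<close> is not \<open>j - 1\<close> and
  both ends of the edge \<open>i\<close> precede the vertex \<open>j\<close>: the label of the edge
  \<open>j\<close> is known before its vertices are placed.\<close>

lemma first_repeat:
  assumes c: "cycle A L" and e: "e \<in> A"
    and nadj: "\<And>t. Suc t < L \<Longrightarrow> \<beta> ((nx ^^ t) e) \<noteq> \<beta> ((nx ^^ Suc t) e)"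
    and rep: "f \<in> A" "g \<in> A" "f \<noteq> g" "\<beta> f = \<beta> g"
  obtains j where "j < L" "j \<ge> 2" "\<exists>i. Suc i < j \<and> \<beta> ((nx ^^ i) e) = \<beta> ((nx ^^ j) e)"
    "\<And>a b. a < b \<Longrightarrow> b < j \<Longrightarrow> \<beta> ((nx ^^ a) e) \<noteq> \<beta> ((nx ^^ b) e)"
proof -
  let ?s = "\<lambda>t. (nx ^^ t) e"
  let ?P = "\<lambda>j. j < L \<and> (\<exists>i<j. \<beta> (?s i) = \<beta> (?s j))"
  obtain a b where ab: "a < L" "f = ?s a" "b < L" "g = ?s b"
    using cycleD(4)[OF c e] rep(1,2) by metis
  then have "a \<noteq> b" using rep(3) by auto
  then have "?P a \<or> ?P b" using ab rep(4) by (metis linorder_less_linear)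
  then obtain d where "?P d" by blast
  then have P: "?P (LEAST j. ?P j)" by (rule LeastI)
  define j where "j = (LEAST j. ?P j)"
  obtain i where i: "j < L" "i < j" "\<beta> (?s i) = \<beta> (?s j)" using P unfolding j_def[symmetric] by blast
  have min: "\<beta> (?s a) \<noteq> \<beta> (?s b)" if "a < b" "b < j" for a b
    using not_less_Least[of b ?P] that i(1) unfolding j_def[symmetric] by (metis less_trans)
  have "Suc i \<noteq> j" using nadj[of i] i by metis
  then have "Suc i < j" using i(2) by simp
  then show ?thesis using that[of j] i min by auto
qed

text \<open>With the vertices up to \<open>j - 1\<close> placed, the label of the edge
  \<open>j\<close> is known, so the next two vertices are reached by a jump to the edge
  \<open>j\<close> instead of a free choice for the edge \<open>j - 1\<close>. The latter is then
  completed without a choice, and its label is new as \<open>j\<close> is the first repetition; this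
  cancels the defect one of the start. \<open>Q\<close> collects further edges completed by the same
  jump.\<close>

lemma D_repeat_step:
  assumes c: "cycle A L" and e: "e \<in> A"
    and nadj: "\<And>t. Suc t < L \<Longrightarrow> \<beta> ((nx ^^ t) e) \<noteq> \<beta> ((nx ^^ Suc t) e)"
    and j: "j < L" "j \<ge> 2" "\<exists>i. Suc i < j \<and> \<beta> ((nx ^^ i) e) = \<beta> ((nx ^^ j) e)"
      "\<And>a b. a < b \<Longrightarrow> b < j \<Longrightarrow> \<beta> ((nx ^^ a) e) \<noteq> \<beta> ((nx ^^ b) e)"
    and Q: "Q \<subseteq> E" "\<And>g. g \<in> Q \<Longrightarrow> g \<in> (\<lambda>j. (nx ^^ j) e) ` {..Suc j} \<and> nx g \<in> (\<lambda>j. (nx ^^ j) e) ` {..Suc j}"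
      "inj_on \<beta> (insert ((nx ^^ (j - 1)) e) Q)" "\<And>g a. g \<in> Q \<Longrightarrow> a \<le> j \<Longrightarrow> \<beta> g \<noteq> \<beta> ((nx ^^ a) e)"
  shows "D ((\<lambda>j. (nx ^^ j) e) ` {..Suc j}) (- real (card Q))"
proof -
  let ?s = "\<lambda>t. (nx ^^ t) e" let ?U = "?s ` {..j - 1}"
  have eE: "e \<in> E" using e cycleD(1)[OF c] by auto
  have finQ: "finite Q" using Q(1) finite_E finite_subset by blast
  have eq: "?U \<union> {?s j, nx (?s j)} = ?s ` {..Suc j}"
  proof -
    have "{..Suc j} = insert (Suc j) (insert j {..j - 1})" using j(2) by auto
    then show ?thesis by auto
  qed
  have "j - 1 + 1 < L" using j by simp
  note kap = kappa_segment[OF c e this]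
  have "D (?U \<union> {?s j, nx (?s j)}) (1 - real (card (insert (?s (j - 1)) Q)))"
  proof (rule D_step[OF D_segment[OF eE]])
    show "?s j \<in> E" using funpow_nx_E[OF eE] .
    obtain i where i: "Suc i < j" "\<beta> (?s i) = \<beta> (?s j)" using j(3) by blast
    have "\<beta> (?s i) \<in> \<kappa> ?U"
    proof (rule kappa_I)
      show "?s i \<in> ?U" using i by auto
      have "?s (Suc i) \<in> ?U" using i by (intro imageI) auto
      then show "nx (?s i) \<in> ?U" by simp
    qed (rule funpow_nx_E[OF eE])
    then show "?s j \<in> ?U \<or> nx (?s j) \<in> ?U \<or> \<beta> (?s j) \<in> \<kappa> ?U" using i by simp
    show "insert (?s (j - 1)) Q \<subseteq> E" using Q(1) funpow_nx_E[OF eE] by auto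
    fix g assume "g \<in> insert (?s (j - 1)) Q"
    moreover have "nx (?s (j - 1)) = ?s j" using j(2) by (metis Suc_diff_1 comp_apply funpow.simps(2) less_le_trans pos2)
    ultimately show "g \<in> ?U \<union> {?s j, nx (?s j)} \<and> nx g \<in> ?U \<union> {?s j, nx (?s j)}"
      using Q(2)[of g] unfolding eq by (auto intro!: imageI)
  next
    show "inj_on \<beta> (insert (?s (j - 1)) Q)" by (rule Q(3))
    show "\<beta> ` insert (?s (j - 1)) Q \<inter> \<kappa> ?U = {}"
    proof -
      have "\<beta> g \<notin> \<kappa> ?U" if "g \<in> insert (?s (j - 1)) Q" for g
      proof
        assume "\<beta> g \<in> \<kappa> ?U"
        then obtain a where a: "a < j - 1" "\<beta> g = \<beta> (?s a)" using kap by blast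
        moreover have "a \<le> j" "j - 1 < j" using a(1) j(2) by linarith+
        ultimately show False using that Q(4)[of g a] j(4)[of a "j - 1"] by auto
      qed
      then show ?thesis by auto
    qed
    have "Suc (j - 1) = j" using j(2) by simp
    then have "\<beta> (?s (j - 1)) \<noteq> \<beta> (?s j)" using nadj[of "j - 1"] j(1) by metis
    then show "\<beta> (?s j) \<notin> \<beta> ` insert (?s (j - 1)) Q" using Q(4)[of _ j] by force
  qed
  moreover have "?s (j - 1) \<notin> Q" using Q(4)[of "?s (j - 1)" "j - 1"] by auto
  ultimately show ?thesis unfolding eq using finQ by simp
qed

lemma D_repeat:
  assumes c: "cycle A L" and e: "e \<in> A"
    and nadj: "\<And>t. Suc t < L \<Longrightarrow> \<beta> ((nx ^^ t) e) \<noteq> \<beta> ((nx ^^ Suc t) e)"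
    and rep: "f \<in> A" "g \<in> A" "f \<noteq> g" "\<beta> f = \<beta> g"
  shows "D A 0"
proof -
  obtain j where j: "j < L" "j \<ge> 2" "\<exists>i. Suc i < j \<and> \<beta> ((nx ^^ i) e) = \<beta> ((nx ^^ j) e)"
    "\<And>a b. a < b \<Longrightarrow> b < j \<Longrightarrow> \<beta> ((nx ^^ a) e) \<noteq> \<beta> ((nx ^^ b) e)"
    using first_repeat[OF c e nadj rep] by metis
  have "D ((\<lambda>j. (nx ^^ j) e) ` {..Suc j}) (- real (card ({} :: 'e set)))"
    by (rule D_repeat_step[OF c e nadj j]) auto
  then have D: "D ((\<lambda>j. (nx ^^ j) e) ` {..Suc j}) 0" by simp
  have s: "(nx ^^ t) e \<in> A" for t using e by (induction t) (auto intro: cycle_nx[OF c])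
  show ?thesis
    by (rule D_cycle_eq[OF c D _ e]) (use s in \<open>auto intro: image_eqI[of _ _ 0]\<close>)
qed

text \<open>Two savings are combined, one at the first repetition and one at the closing edge
  \<open>k\<close>. Starting at \<open>nx k\<close> puts \<open>k\<close> at the last position, so
  that the repetition is met before it.\<close>

lemma D_repeat_unique:
  assumes c: "cycle A L" and k: "k \<in> A" "\<And>f. f \<in> A \<Longrightarrow> f \<noteq> k \<Longrightarrow> \<beta> f \<noteq> \<beta> k"
    and nadj: "\<And>f. f \<in> A \<Longrightarrow> \<beta> f \<noteq> \<beta> (nx f)"
    and rep: "f \<in> A" "g \<in> A" "f \<noteq> g" "\<beta> f = \<beta> g"
  shows "D A (- 1)"
proof -
  let ?e = "nx k" let ?s = "\<lambda>t. (nx ^^ t) (nx k)"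
  have e: "?e \<in> A" using cycle_nx[OF c k(1)] .
  have s: "?s t \<in> A" for t using e by (induction t) (auto intro: cycle_nx[OF c])
  have last: "?s (L - 1) = k" using cycle_last[OF c k(1)] .
  have nadj': "\<And>t. Suc t < L \<Longrightarrow> \<beta> (?s t) \<noteq> \<beta> (?s (Suc t))" using nadj[OF s] by simp
  obtain j where j: "j < L" "j \<ge> 2" "\<exists>i. Suc i < j \<and> \<beta> (?s i) = \<beta> (?s j)"
    "\<And>a b. a < b \<Longrightarrow> b < j \<Longrightarrow> \<beta> (?s a) \<noteq> \<beta> (?s b)"
    using first_repeat[OF c e nadj' rep] by metis
  have nk: "\<beta> k \<noteq> \<beta> (?s a)" if "a < L - 1" for a
  proof -
    have "?s a \<noteq> ?s (L - 1)" using cycleD(3)[OF c e, of a "L - 1"] that by auto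
    then show ?thesis using k(2)[OF s[of a]] last by metis
  qed
  have jL: "j \<noteq> L - 1"
  proof
    assume "j = L - 1"
    then obtain i where "i < L - 1" "\<beta> (?s i) = \<beta> k" using j(3) last by (metis Suc_lessD)
    then show False using nk by metis
  qed
  show ?thesis
  \<comment> \<open>If the jump reaches the vertex \<open>k\<close>, it also closes the cycle and
    both savings fall into one step, with \<open>Q = {k}\<close>. Otherwise they are made one after
    the other.\<close>
  proof (cases "Suc j = L - 1")
    case True
    have jm: "j - 1 < L - 1" using True by linarith
    have "D (?s ` {..Suc j}) (- real (card {k}))"
    proof (rule D_repeat_step[OF c e nadj' j])
      show "{k} \<subseteq> E" using k(1) cycleD(1)[OF c] by auto
      have "?s 0 \<in> ?s ` {..Suc j}" "?s (Suc j) \<in> ?s ` {..Suc j}" by (rule imageI, simp)+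
      moreover have "?s (Suc j) = k" using last True by metis
      ultimately show "g \<in> ?s ` {..Suc j} \<and> nx g \<in> ?s ` {..Suc j}" if "g \<in> {k}" for g
        using that by (metis funpow_0 singletonD)
      show "\<beta> g \<noteq> \<beta> (?s a)" if "g \<in> {k}" "a \<le> j" for g a using nk[of a] that True by auto
      show "inj_on \<beta> (insert (?s (j - 1)) {k})" using nk[of "j - 1"] jm by (auto simp: inj_on_def)
    qed
    then have D: "D (?s ` {..Suc j}) (- 1)" by simp
    show ?thesis
      by (rule D_cycle_eq[OF c D _ e]) (use s in \<open>auto intro: image_eqI[of _ _ 0]\<close>)
  next
    case False
    then have jl: "Suc j \<le> L - 2" using jL j by simp
    have "D (?s ` {..Suc j}) (- real (card ({} :: 'e set)))"
      by (rule D_repeat_step[OF c e nadj' j]) auto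
    then have "D (?s ` {..Suc j}) 0" by simp
    then have "D (?s ` {..Suc j} \<union> ?s ` {..L - 2}) 0"
      using e cycleD(1)[OF c] by (intro D_path) (auto intro: image_eqI[of _ _ 0])
    moreover have "?s ` {..Suc j} \<union> ?s ` {..L - 2} = ?s ` {..L - 2}" using jl by auto
    ultimately have "D (?s ` {..L - 2}) 0" by simp
    from D_close[OF c k _ this] j jl show ?thesis by simp
  qed
qed

text \<open>The hypothesis \<open>N\<close> is met when \<open>e\<close> is a loop. The label of
  \<open>e\<close> already accounts for the \<open>n\<close> placements of its ends, so the start
  has defect zero, and closing the cycle at the edge before \<open>e\<close> lowers it to
  \<open>-1\<close>.\<close>

lemma D_start_pair_unique:
  assumes c: "cycle A L" and L: "L \<ge> 3" and e: "e \<in> A"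
    and N: "real (N {e, nx e}) \<le> C * real n" and inj: "inj_on \<beta> A"
  shows "D A (- 1)"
proof -
  define k where "k = (nx ^^ (L - 1)) e"
  have s: "(nx ^^ t) e \<in> A" for t using e by (induction t) (auto intro: cycle_nx[OF c])
  have kA: "k \<in> A" using s by (simp add: k_def)
  have nk: "nx k = e" unfolding k_def using cycleD(2,5)[OF c] e
    by (metis Suc_diff_1 comp_apply funpow.simps(2) less_eq_Suc_le One_nat_def)
  have "\<beta> e \<in> \<kappa> {e, nx e}" using e cycleD(1)[OF c] by (intro kappa_I) auto
  then have "card {\<beta> e} \<le> card (\<kappa> {e, nx e})" by (intro card_mono finite_kappa) auto
  then have "real n powr 1 \<le> real n powr (real (card (\<kappa> {e, nx e})) + 0)"
    using n_pos by (intro powr_mono) auto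
  then have "real n \<le> real n powr (real (card (\<kappa> {e, nx e})) + 0)" using n_pos by simp
  then have "C * real n \<le> C * real n powr (real (card (\<kappa> {e, nx e})) + 0)"
    using C_ge_1 by (intro mult_left_mono) auto
  then have "D {e, nx e} 0"
    using N e cycleD(1)[OF c] cycle_nx[OF c e] by (intro D_initial) auto
  then have "D ({e, nx e} \<union> (\<lambda>j. (nx ^^ j) e) ` {..L - 2}) 0"
    using e cycleD(1)[OF c] by (intro D_path) auto
  moreover have "{e, nx e} \<union> (\<lambda>j. (nx ^^ j) e) ` {..L - 2} = (\<lambda>j. (nx ^^ j) e) ` {..L - 2}"
    using L by (auto intro: image_eqI[of _ _ 0] image_eqI[of _ _ 1])
  ultimately have "D ((\<lambda>j. (nx ^^ j) (nx k)) ` {..L - 2}) 0" by (simp add: nk)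
  from D_close[OF c kA _ _ this] show ?thesis using inj kA L by (auto simp: inj_on_def)
qed

text \<open>The three vertices are counted by (C2), and the common label of the two edges accounts
  for one factor \<open>n\<close>. The start has defect \<open>(2 - \<delta>) - 1\<close>, a gain of
  \<delta> over starting at a vertex.\<close>

lemma D_start_triple:
  assumes c: "cycle A L" and L: "L \<ge> 3" and e: "e \<in> A" and adj: "\<beta> e = \<beta> (nx e)"
    and N: "real (N {e, nx e, nx (nx e)}) \<le> C * real n powr (2 - \<delta>)"
  shows "D {e, nx e, nx (nx e)} (1 - \<delta>)" "D A (1 - \<delta>)"
proof -
  let ?T = "{e, nx e, nx (nx e)}"
  have sub: "?T \<subseteq> A" using e cycle_nx[OF c] by auto
  have "\<beta> e \<in> \<kappa> ?T" using e cycleD(1)[OF c] by (intro kappa_I) auto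
  then have "card {\<beta> e} \<le> card (\<kappa> ?T)" by (intro card_mono finite_kappa) auto
  then have "C * real n powr (2 - \<delta>) \<le> C * real n powr (real (card (\<kappa> ?T)) + (1 - \<delta>))"
    using n_pos C_ge_1 by (intro powr_mono mult_left_mono) auto
  then show D: "D ?T (1 - \<delta>)"
    using N sub cycleD(1)[OF c] by (intro D_initial) auto
  show "D A (1 - \<delta>)" by (rule D_cycle_eq[OF c D _ e]) (use sub in auto)
qed

text \<open>The gain from (C2) forces the revelation to start at \<open>e\<close>, whereas the edge
  \<open>k\<close> may lie at any other place on the cycle. Both gains can be kept, as the order of
  revelation can be arranged such that \<open>k\<close> is completed without a choice of its
  own.\<close>

lemma D_start_triple_unique:
  assumes c: "cycle A L" and L: "L \<ge> 3" and e: "e \<in> A" and adj: "\<beta> e = \<beta> (nx e)"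
    and N: "real (N {e, nx e, nx (nx e)}) \<le> C * real n powr (2 - \<delta>)"
    and k: "k \<in> A" "\<And>f. f \<in> A \<Longrightarrow> f \<noteq> k \<Longrightarrow> \<beta> f \<noteq> \<beta> k"
  shows "D A (- \<delta>)"
proof -
  let ?s = "\<lambda>t. (nx ^^ t) e"
  let ?T = "{e, nx e, nx (nx e)}"
  have s: "?s t \<in> A" for t using e by (induction t) (auto intro: cycle_nx[OF c])
  have s2: "nx (nx e) = ?s 2" "nx e = ?s 1" by (simp_all add: numeral_2_eq_2)
  have sT: "?T = ?s ` {..2}" by (auto simp: numeral_2_eq_2 atMost_Suc)
  have ne: "e \<noteq> nx e" using cycleD(3)[OF c e, of 0 1] L by simp
  have kne: "k \<noteq> e" "k \<noteq> nx e"
    using k(2)[OF e] k(2)[OF cycle_nx[OF c e]] adj ne by metis+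
  obtain t where t: "t < L" "k = ?s t" using cycleD(4)[OF c e] k(1) by blast
  have t2: "t \<ge> 2"
  proof -
    have "t \<noteq> 0" using kne(1) t(2) by (metis funpow_0)
    moreover have "t \<noteq> 1" using kne(2) t(2) s2(2) by metis
    ultimately show ?thesis by simp
  qed
  have eE: "e \<in> E" using e cycleD(1)[OF c] by auto
  have D0: "D ?T (1 - \<delta>)" by (rule D_start_triple[OF c L e adj N])
  show ?thesis
  proof (cases "L = 3")
    \<comment> \<open>On a cycle of length three the triple contains all vertices and completes
      \<open>k\<close> too. Its two labels leave the defect
      \<open>(2 - \<delta>) - 2\<close>.\<close>
    case True
    have AT: "A = ?T" unfolding sT cycleD(6)[OF c e, symmetric] using True by auto
    have t: "t = 2" using t2 t(1) True by simp
    have n3: "nx (?s 2) = e" using cycleD(5)[OF c e] True by (simp add: numeral_3_eq_3 numeral_2_eq_2)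
    have "\<beta> e \<in> \<kappa> ?T" using eE by (intro kappa_I) auto
    moreover have "\<beta> k \<in> \<kappa> ?T" using t n3 \<open>k = ?s t\<close> k(1) cycleD(1)[OF c] s2(1) by (intro kappa_I) auto
    moreover have "\<beta> e \<noteq> \<beta> k" using k(2)[OF e] kne by metis
    ultimately have "card {\<beta> e, \<beta> k} \<le> card (\<kappa> ?T)" by (intro card_mono finite_kappa) auto
    then have "2 \<le> card (\<kappa> ?T)" using \<open>\<beta> e \<noteq> \<beta> k\<close> by simp
    then have "C * real n powr (2 - \<delta>) \<le> C * real n powr (real (card (\<kappa> ?T)) + (- \<delta>))"
      using n_pos C_ge_1 by (intro powr_mono mult_left_mono) auto
    then have "D ?T (- \<delta>)" using N AT cycleD(1)[OF c] by (intro D_initial) auto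
    then show ?thesis using AT by simp
  next
    case False
    then have L4: "L \<ge> 4" using L by simp
    have D1: "D (?T \<union> ?s ` {..t}) (1 - \<delta>)" if "t < L" for t
      using D0 eE by (intro D_path) auto
    show ?thesis
    proof (cases "t = L - 1")
      case True
      have nk: "nx k = e" using t True cycleD(5)[OF c e] L4
        by (metis Suc_diff_1 comp_apply funpow.simps(2) gr_zeroI not_less_zero)
      have "?T \<union> ?s ` {..L - 2} = ?s ` {..L - 2}" unfolding sT using L4 by auto
      then have "D ((\<lambda>j. (nx ^^ j) (nx k)) ` {..L - 2}) (1 - \<delta>)" using D1[of "L - 2"] L4 nk by simp
      from D_close[OF c k _ this] show ?thesis using L by simp
    next
      case False
      \<comment> \<open>The vertex \<open>k\<close> may belong to the triple, so here the last vertex revealed is \<open>nx k\<close>.\<close>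
      then have tL: "t + 2 \<le> L" using t(1) by simp
      let ?f = "?s (t + 2)"
      have nxk: "nx k = ?s (t + 1)" using t by simp
      have f': "(nx ^^ j) ?f = ?s (j + (t + 2))" for j by (simp only: funpow_add o_apply)
      have "(nx ^^ (L - t - 2)) ?f = ?s L" unfolding f' using tL by (intro arg_cong[of _ _ ?s]) simp
      then have fe: "(nx ^^ (L - t - 2)) ?f = e" using cycleD(5)[OF c e] by simp
      let ?V = "?T \<union> ?s ` {..t} \<union> (\<lambda>j. (nx ^^ j) ?f) ` {..L - t - 2}"
      have DV: "D ?V (1 - \<delta>)"
        by (rule D_path_back[OF D1[OF t(1)] funpow_nx_E[OF eE]]) (unfold fe, blast)
      have VA: "?V \<subseteq> A" unfolding f' sT using s by blast
      have kV: "k \<in> ?V" using t by blast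
      have nxf: "nx (nx k) \<in> ?V"
      proof -
        have "nx (nx k) = (nx ^^ 0) ?f" unfolding nxk by simp
        then show ?thesis by blast
      qed
      have nV: "nx k \<notin> ?V"
      proof
        assume "nx k \<in> ?V"
        then obtain a where a: "a \<le> t \<or> t + 2 \<le> a \<and> a \<le> L" "?s (t + 1) = ?s a"
        proof -
          from \<open>nx k \<in> ?V\<close> consider "nx k \<in> ?s ` {..2}" | "nx k \<in> ?s ` {..t}"
            | "nx k \<in> (\<lambda>j. ?s (j + (t + 2))) ` {..L - t - 2}"
            unfolding f' sT by blast
          then show ?thesis
          proof cases
            case 1
            then obtain a where a: "a \<le> 2" "nx k = ?s a" by blast
            show ?thesis
            proof (rule that)
              show "a \<le> t \<or> t + 2 \<le> a \<and> a \<le> L" using a(1) t2 by linarith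
              show "?s (t + 1) = ?s a" using a(2) nxk by (rule trans[OF sym, rotated])
            qed
          next
            case 2
            then obtain a where a: "a \<le> t" "nx k = ?s a" by blast
            show ?thesis
            proof (rule that)
              show "a \<le> t \<or> t + 2 \<le> a \<and> a \<le> L" using a(1) by linarith
              show "?s (t + 1) = ?s a" using a(2) nxk by (rule trans[OF sym, rotated])
            qed
          next
            case 3
            then obtain j where j: "j \<le> L - t - 2" "nx k = ?s (j + (t + 2))" by blast
            show ?thesis
            proof (rule that)
              show "j + (t + 2) \<le> t \<or> t + 2 \<le> j + (t + 2) \<and> j + (t + 2) \<le> L"
                using j(1) tL by linarith
              show "?s (t + 1) = ?s (j + (t + 2))" using j(2) nxk by (rule trans[OF sym, rotated])
            qed
          qed
        qed
        show False
        proof (cases "a = L")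
          case True
          then show False using a(2) cycleD(3)[OF c e, of "t + 1" 0] cycleD(5)[OF c e] tL by simp
        next
          case False
          then show False using a cycleD(3)[OF c e, of "t + 1" a] tL by auto
        qed
      qed
      have "D (?V \<union> {nx k, nx (nx k)}) (1 - \<delta> - 1)"
      proof (rule D_step1[OF DV])
        show "nx k \<in> E" "k \<in> E" using k(1) cycle_nx[OF c] cycleD(1)[OF c] by auto
        show "nx k \<in> ?V \<or> nx (nx k) \<in> ?V \<or> \<beta> (nx k) \<in> \<kappa> ?V" using nxf by blast
        show "k \<in> ?V \<union> {nx k, nx (nx k)}" "nx k \<in> ?V \<union> {nx k, nx (nx k)}" using kV by blast+
        show "\<beta> k \<notin> \<kappa> ?V"
        proof
          assume "\<beta> k \<in> \<kappa> ?V"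
          then obtain h where "h \<in> ?V" "nx h \<in> ?V" "\<beta> h = \<beta> k" unfolding \<kappa>_def by force
          then show False using k(2)[of h] VA nV by blast
        qed
        show "\<beta> k \<noteq> \<beta> (nx k)" using k(2)[OF cycle_nx[OF c k(1)]] kV nV by metis
      qed
      moreover have "1 - \<delta> - 1 = - \<delta>" by simp
      ultimately have "D (?V \<union> {nx k, nx (nx k)}) (- \<delta>)" by (simp only:)
      moreover have "e \<in> ?V \<union> {nx k, nx (nx k)}" by blast
      moreover have "?V \<union> {nx k, nx (nx k)} \<subseteq> A"
        using VA cycle_nx[OF c] cycle_nx[OF c k(1)] by blast
      ultimately show ?thesis by (rule D_cycle_eq[OF c _ _ e])
    qed
  qed
qed

end

section \<open>Pairs of closed walks\<close>

locale two_circles =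
  fixes m l :: nat
  assumes m_pos: "m \<ge> 1" and l_pos: "l \<ge> 1"
begin

definition len :: "nat \<Rightarrow> nat" where
  "len c = (if c = 1 then m else l)"

definition circ :: "nat \<Rightarrow> (nat \<times> nat) set" where
  "circ c = {c} \<times> {..<len c}"

definition E :: "(nat \<times> nat) set" where
  "E = circ 1 \<union> circ 2"

definition nx :: "nat \<times> nat \<Rightarrow> nat \<times> nat" where
  "nx e = (fst e, Suc (snd e) mod len (fst e))"

definition ed :: "(nat \<times> nat \<Rightarrow> nat) \<Rightarrow> nat \<times> nat \<Rightarrow> nat \<times> nat" where
  "ed x e = (x e, x (nx e))"

definition cls :: "((nat \<times> nat) \<times> (nat \<times> nat)) set \<Rightarrow> (nat \<times> nat \<Rightarrow> nat) \<Rightarrow> nat \<times> nat \<Rightarrow> (nat \<times> nat) set" where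
  "cls r x e = {f \<in> E. (ed x e, ed x f) \<in> r}"

text \<open>On a circle of length two, \<open>x e = x (nx (nx e))\<close> holds trivially and the
  two edges are the whole walk; hence \<open>len (fst e) \<ge> 3\<close>. Loops are excluded because
  the variance is prescribed off the diagonal only.\<close>

definition cancelling :: "((nat \<times> nat) \<times> (nat \<times> nat)) set \<Rightarrow> (nat \<times> nat \<Rightarrow> nat) \<Rightarrow> nat \<times> nat \<Rightarrow> bool" where
  "cancelling r x e \<longleftrightarrow> e \<in> E \<and> len (fst e) \<ge> 3 \<and> cls r x e = {e, nx e} \<and>
     x e = x (nx (nx e)) \<and> x e \<noteq> x (nx e)"

text \<open>Necessary for a nonzero contribution: an edge alone in its class has mean zero, and
  without a class that meets both circles the two traces decouple.\<close>

definition contributing :: "((nat \<times> nat) \<times> (nat \<times> nat)) set \<Rightarrow> (nat \<times> nat \<Rightarrow> nat) \<Rightarrow> bool" where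
  "contributing r x \<longleftrightarrow> (\<forall>e\<in>E. card (cls r x e) \<ge> 2) \<and> (\<exists>e\<in>circ 1. \<exists>f\<in>circ 2. (ed x e, ed x f) \<in> r)"

definition dihedral_config :: "((nat \<times> nat) \<times> (nat \<times> nat)) set \<Rightarrow> (nat \<times> nat \<Rightarrow> nat) \<Rightarrow> bool" where
  "dihedral_config r x \<longleftrightarrow> (\<forall>e\<in>E. cls r x e \<inter> circ (fst e) = {e}) \<and>
     (\<forall>e\<in>circ 1. \<forall>f\<in>circ 2. \<forall>f'\<in>circ 2.
        (ed x e, ed x f) \<in> r \<longrightarrow> (ed x (nx e), ed x f') \<in> r \<longrightarrow> nx f = f' \<or> nx f' = f)"

text \<open>In a walk of length two the edges \<open>(p, q)\<close> and \<open>(q, p)\<close> are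
  equivalent by transposition, so the first condition in \<open>dihedral_config\<close> would fail;
  this is why \<open>m = 2\<close> is set apart.\<close>

definition main_config :: "((nat \<times> nat) \<times> (nat \<times> nat)) set \<Rightarrow> (nat \<times> nat \<Rightarrow> nat) \<Rightarrow> bool" where
  "main_config r x \<longleftrightarrow> m = l \<and>
     (m = 1 \<or> (\<forall>e\<in>E. x e \<noteq> x (nx e)) \<and> (m = 2 \<or> dihedral_config r x))"

lemma len_pos: "len c \<ge> 1"
  using m_pos l_pos by (simp add: len_def)

lemma E_iff: "e \<in> E \<longleftrightarrow> (fst e = 1 \<or> fst e = 2) \<and> snd e < len (fst e)"
  by (cases e) (auto simp: E_def circ_def)

lemma circ_iff: "e \<in> circ c \<longleftrightarrow> fst e = c \<and> snd e < len c"
  by (cases e) (auto simp: circ_def)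

lemma finite_E [simp]: "finite E"
  by (simp add: E_def circ_def)

lemma card_circ [simp]: "card (circ c) = len c"
  by (simp add: circ_def card_cartesian_product_singleton)

lemma finite_circ [simp]: "finite (circ c)"
  by (simp add: circ_def)

lemma circ_disjoint: "c \<noteq> c' \<Longrightarrow> circ c \<inter> circ c' = {}"
  by (auto simp: circ_def)

lemma card_E: "card E = m + l"
proof -
  have "card E = card (circ 1) + card (circ 2)"
    unfolding E_def by (rule card_Un_disjoint) (auto simp: circ_disjoint)
  then show ?thesis by (simp add: len_def)
qed

lemma nx_circ: "e \<in> circ c \<Longrightarrow> nx e \<in> circ c"
  using len_pos[of c] by (auto simp: circ_iff nx_def)

lemma nx_in_E: "e \<in> E \<Longrightarrow> nx e \<in> E"
  using nx_circ[of e 1] nx_circ[of e 2] by (auto simp: E_def)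

lemma fst_nx [simp]: "fst (nx e) = fst e"
  by (simp add: nx_def)

lemma nx_funpow: "snd e < len (fst e) \<Longrightarrow> (nx ^^ t) e = (fst e, (snd e + t) mod len (fst e))"
proof (induction t)
  case (Suc t)
  then show ?case by (simp add: nx_def mod_Suc_eq)
qed simp

lemma circle_cycle:
  assumes "e \<in> circ c"
  shows "inj_on (\<lambda>t. (nx ^^ t) e) {..<len c}" "(\<lambda>t. (nx ^^ t) e) ` {..<len c} = circ c"
    "(nx ^^ len c) e = e"
proof -
  have e: "fst e = c" "snd e < len c" using assms by (auto simp: circ_iff)
  have s: "(nx ^^ t) e = (c, (snd e + t) mod len c)" for t
    using nx_funpow[of e t] e by simp
  show inj: "inj_on (\<lambda>t. (nx ^^ t) e) {..<len c}"
  proof (rule inj_onI)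
    fix a b assume ab: "a \<in> {..<len c}" "b \<in> {..<len c}" "(nx ^^ a) e = (nx ^^ b) e"
    then have "(snd e + a) mod len c = (snd e + b) mod len c" by (simp add: s)
    moreover have "(snd e + t) mod len c = (if snd e + t < len c then snd e + t else snd e + t - len c)"
      if "t < len c" for t
      using that e(2) by (simp add: le_mod_geq)
    ultimately show "a = b" using ab(1,2) e(2) by (auto split: if_splits)
  qed
  have "(\<lambda>t. (nx ^^ t) e) ` {..<len c} \<subseteq> circ c"
    using len_pos[of c] by (auto simp: s circ_iff)
  moreover have "card ((\<lambda>t. (nx ^^ t) e) ` {..<len c}) = card (circ c)"
    using card_image[OF inj] by simp
  ultimately show "(\<lambda>t. (nx ^^ t) e) ` {..<len c} = circ c"
    by (intro card_subset_eq) auto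
  show "(nx ^^ len c) e = e" using e by (simp add: s prod_eq_iff)
qed

lemma nx_ne: "e \<in> circ c \<Longrightarrow> len c \<ge> 2 \<Longrightarrow> nx e \<noteq> e"
  using circle_cycle(1)[of e c] by (auto dest!: inj_onD[of _ _ 0 1])

lemma nx_nx_2: "e \<in> circ c \<Longrightarrow> len c = 2 \<Longrightarrow> nx (nx e) = e"
  using circle_cycle(3)[of e c] by (simp add: numeral_2_eq_2)

end

section \<open>Counting the exceptional configurations with a given pattern of classes\<close>

definition bad_triples :: "nat \<Rightarrow> ((nat \<times> nat) \<times> (nat \<times> nat)) set \<Rightarrow> (nat \<times> nat \<times> nat) set" where
  "bad_triples n r = {(p, q, p'). p \<in> {1..n} \<and> q \<in> {1..n} \<and> p' \<in> {1..n} \<and>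
     ((p, q), (q, p')) \<in> r \<and> (p \<noteq> p' \<or> p = q)}"

text \<open>All \<open>x\<close> in \<Omega> share one equivalence pattern. The label of an edge is
  the set of edges equivalent to it, so the sizes of the classes can be read off from
  \<beta>.\<close>

locale labelled_configs = two_circles m l + reveal "two_circles.E m l" "two_circles.nx m l" n r \<beta> \<Omega> C
  for m l n r and \<beta> :: "nat \<times> nat \<Rightarrow> (nat \<times> nat) set" and \<Omega> C +
  assumes label: "\<And>x e. x \<in> \<Omega> \<Longrightarrow> e \<in> E \<Longrightarrow> \<beta> e = cls r x e"
    and Omega_nonempty: "\<Omega> \<noteq> {}"
    and two_le_card: "\<And>e. e \<in> E \<Longrightarrow> card (\<beta> e) \<ge> 2"
    and bridge: "\<exists>e\<in>circ 1. \<exists>f\<in>circ 2. \<beta> e = \<beta> f"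
    and r_transpose: "\<And>p q. (p, q) \<in> pairs n \<Longrightarrow> ((p, q), (q, p)) \<in> r"
begin

lemma circ_cycle: "c \<in> {1, 2} \<Longrightarrow> cycle (circ c) (len c)"
  unfolding cycle_def using circle_cycle[of _ c] len_pos[of c] by (auto simp: E_def)

lemma circ_E: "c \<in> {1, 2} \<Longrightarrow> circ c \<subseteq> E"
  by (auto simp: E_def)

lemma ed_pairs: "x \<in> \<Omega> \<Longrightarrow> e \<in> E \<Longrightarrow> ed x e \<in> pairs n"
  using Omega_range[of x e] Omega_range[of x "nx e"] nx_in_E[of e] by (simp add: ed_def)

lemma label_iff: "x \<in> \<Omega> \<Longrightarrow> e \<in> E \<Longrightarrow> f \<in> E \<Longrightarrow> \<beta> e = \<beta> f \<longleftrightarrow> (ed x e, ed x f) \<in> r"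
proof -
  assume a: "x \<in> \<Omega>" "e \<in> E" "f \<in> E"
  have "\<beta> e = \<beta> f \<Longrightarrow> (ed x e, ed x f) \<in> r" using label_related[OF a] by (simp add: ed_def)
  moreover have "\<beta> e = \<beta> f" if "(ed x e, ed x f) \<in> r"
  proof -
    have "(ed x f, ed x e) \<in> r" using equiv_r that by (auto simp: equiv_def dest: symD)
    then have "cls r x e = cls r x f" using that equiv_r
      unfolding cls_def equiv_def by (auto dest: transD)
    then show ?thesis using a label by simp
  qed
  ultimately show ?thesis by blast
qed

lemma label_mem: "e \<in> E \<Longrightarrow> f \<in> \<beta> e \<longleftrightarrow> f \<in> E \<and> \<beta> f = \<beta> e"
proof -
  assume e: "e \<in> E"
  obtain x where x: "x \<in> \<Omega>" using Omega_nonempty by blast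
  show ?thesis using label[OF x e] label_iff[OF x e, of f] by (auto simp: cls_def)
qed

lemma label_self: "e \<in> E \<Longrightarrow> e \<in> \<beta> e"
  by (simp add: label_mem)

lemma label_sub: "e \<in> E \<Longrightarrow> \<beta> e \<subseteq> E"
  by (auto simp: label_mem)

lemma finite_label: "e \<in> E \<Longrightarrow> finite (\<beta> e)"
  using label_sub finite_E finite_subset by blast

abbreviation K :: nat where "K \<equiv> card (\<beta> ` E)"

lemma sum_card_labels: "(\<Sum>B\<in>\<beta> ` E. card B) = m + l"
proof -
  have "m + l = (\<Sum>B\<in>\<beta> ` E. card {e \<in> E. \<beta> e = B})"
    using sum.image_gen[of E "\<lambda>_. 1::nat" \<beta>] card_E by simp
  also have "\<dots> = (\<Sum>B\<in>\<beta> ` E. card B)"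
  proof (rule sum.cong[OF refl])
    fix B assume "B \<in> \<beta> ` E"
    then obtain e where e: "e \<in> E" "B = \<beta> e" by blast
    have "{f \<in> E. \<beta> f = B} = B" using label_mem[OF e(1)] e(2) by blast
    then show "card {e \<in> E. \<beta> e = B} = card B" by simp
  qed
  finally show ?thesis by simp
qed

lemma card_labels_ge: "2 * K \<le> m + l"
proof -
  have "2 * K = (\<Sum>B\<in>\<beta> ` E. 2)" by simp
  also have "\<dots> \<le> (\<Sum>B\<in>\<beta> ` E. card B)" using two_le_card by (intro sum_mono) auto
  finally show ?thesis by (simp add: sum_card_labels)
qed

text \<open>Each of the other classes uses up at least two of the \<open>m + l\<close> edges, so a
  large class lowers the number of classes.\<close>

lemma card_labels_large_block:
  assumes e: "e \<in> E"
  shows "2 * K + card (\<beta> e) \<le> m + l + 2"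
proof -
  have fin: "finite (\<beta> ` E)" by simp
  have "K = Suc (card (\<beta> ` E - {\<beta> e}))" using e by (subst card_Suc_Diff1) auto
  then have "2 * K = 2 + (\<Sum>B\<in>\<beta> ` E - {\<beta> e}. 2)" by simp
  also have "\<dots> \<le> 2 + (\<Sum>B\<in>\<beta> ` E - {\<beta> e}. card B)" using two_le_card by (intro add_left_mono sum_mono) auto
  finally show ?thesis
    using sum.remove[OF fin, of "\<beta> e" card] e by (simp add: sum_card_labels)
qed

lemma card_labels_two_blocks:
  assumes e: "e \<in> E" "f \<in> E" "\<beta> e \<noteq> \<beta> f"
  shows "2 * K + card (\<beta> e) + card (\<beta> f) \<le> m + l + 4"
proof -
  have fin: "finite (\<beta> ` E)" by simp
  let ?R = "\<beta> ` E - {\<beta> e} - {\<beta> f}"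
  have "K = Suc (card (\<beta> ` E - {\<beta> e}))" using e by (subst card_Suc_Diff1) auto
  also have "card (\<beta> ` E - {\<beta> e}) = Suc (card ?R)" using e by (subst card_Suc_Diff1) auto
  finally have "2 * K = 4 + (\<Sum>B\<in>?R. 2)" by simp
  also have "\<dots> \<le> 4 + (\<Sum>B\<in>?R. card B)" using two_le_card by (intro add_left_mono sum_mono) auto
  finally show ?thesis
    using sum.remove[OF fin, of "\<beta> e" card] sum.remove[of "\<beta> ` E - {\<beta> e}" "\<beta> f" card] e
    by (simp add: sum_card_labels)
qed

text \<open>Once one circle is complete, the class that meets both circles gives access to the other
  one by a jump, and going around it does not raise the defect. So it suffices to find savings on
  one circle.\<close>

lemma D_finish:
  assumes c: "c \<in> {1, 2}" and D: "D (circ c) d"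
  shows "D E d"
proof -
  obtain e f c' where ef: "e \<in> circ c" "f \<in> circ c'" "\<beta> e = \<beta> f" "c' \<in> {1, 2}" "circ c \<union> circ c' = E"
    using bridge c unfolding E_def by (metis Un_commute insert_iff singletonD)
  have "\<beta> f \<in> \<kappa> (circ c)"
    using ef circ_E[OF c] nx_circ[OF ef(1)] kappa_I[of e "circ c"] by auto
  then have "D (circ c \<union> {f, nx f}) d"
    using ef circ_E[OF ef(4)] by (intro D_step0[OF D]) auto
  then have "D (circ c \<union> {f, nx f} \<union> circ c') d"
    using ef by (intro D_cycle[OF circ_cycle[OF ef(4)], of _ _ f]) auto
  moreover have "circ c \<union> {f, nx f} \<union> circ c' = E" using ef nx_circ[OF ef(2)] by auto
  ultimately show ?thesis by simp
qed

lemma D_basic: "D E 1"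
proof -
  have v: "(1, 0) \<in> circ 1" using len_pos[of 1] by (simp add: circ_iff)
  have "D (circ 1) 1"
    using v circ_E[of 1] by (intro D_cycle_eq[OF circ_cycle D_start, of 1 "(1, 0)" "(1, 0)"]) auto
  then show ?thesis using D_finish[of 1] by simp
qed

text \<open>The exponent \<open>(m + l) / 2\<close> is compensated by the factors
  \<open>1 / sqrt (real n)\<close> of the \<open>m + l\<close> matrix entries, which leaves the
  power \<open>-\<delta>\<close> of \<open>n\<close>.\<close>

lemma count_if:
  assumes "D E d" "real K + d \<le> real (m + l) / 2 - \<delta>"
  shows "real (card \<Omega>) \<le> C * real n powr (real (m + l) / 2 - \<delta>) * real (alpha2 n r) ^ (m + l)"
proof -
  have "real (card \<Omega>) \<le> C * real n powr (real K + d) * real (alpha2 n r) ^ card E"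
    by (rule card_Omega[OF assms(1)])
  also have "\<dots> \<le> C * real n powr (real (m + l) / 2 - \<delta>) * real (alpha2 n r) ^ (m + l)"
    using assms(2) n_pos C_ge_1 by (intro mult_mono powr_mono) (auto simp: card_E)
  finally show ?thesis .
qed

lemma N_triple:
  assumes e: "e \<in> E" and adj: "\<beta> e = \<beta> (nx e)"
    and bad: "\<And>x. x \<in> \<Omega> \<Longrightarrow> x e \<noteq> x (nx (nx e)) \<or> x e = x (nx e)"
  shows "N {e, nx e, nx (nx e)} \<le> card (bad_triples n r)"
proof -
  let ?T = "{e, nx e, nx (nx e)}" let ?f = "\<lambda>z. (z e, z (nx e), z (nx (nx e)))"
  have fin: "finite (bad_triples n r)"
    by (rule finite_subset[of _ "{1..n} \<times> {1..n} \<times> {1..n}"]) (auto simp: bad_triples_def)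
  have "inj_on ?f ((\<lambda>x. restrict x ?T) ` \<Omega>)"
  proof (rule inj_onI, clarify)
    fix x y assume "restrict x ?T e = restrict y ?T e" "restrict x ?T (nx e) = restrict y ?T (nx e)"
      "restrict x ?T (nx (nx e)) = restrict y ?T (nx (nx e))"
    then show "restrict x ?T = restrict y ?T" by (auto simp: fun_eq_iff restrict_def)
  qed
  moreover have "?f ` (\<lambda>x. restrict x ?T) ` \<Omega> \<subseteq> bad_triples n r"
  proof clarsimp
    fix x assume x: "x \<in> \<Omega>"
    have "((x e, x (nx e)), (x (nx e), x (nx (nx e)))) \<in> r"
      using label_related[OF x e nx_in_E[OF e] adj] .
    then show "(x e, x (nx e), x (nx (nx e))) \<in> bad_triples n r"
      using bad[OF x] Omega_range[OF x e] Omega_range[OF x nx_in_E[OF e]]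
        Omega_range[OF x nx_in_E[OF nx_in_E[OF e]]] by (auto simp: bad_triples_def)
  qed
  ultimately show ?thesis unfolding N_def by (rule card_inj_on_le[OF _ _ fin])
qed

lemma len_ge_card:
  assumes "A \<subseteq> circ c" shows "card A \<le> len c"
  using card_mono[OF finite_circ assms] by simp

text \<open>By \<open>two_le_card\<close> the class of such an edge has further elements, all of
  them on the other circle. A spoke can serve as the closing edge of its own circle.\<close>

definition spoke :: "nat \<Rightarrow> nat \<times> nat \<Rightarrow> bool" where
  "spoke c k \<longleftrightarrow> c \<in> {1, 2} \<and> k \<in> circ c \<and> (\<forall>f\<in>circ c. f \<noteq> k \<longrightarrow> \<beta> f \<noteq> \<beta> k)"

lemma D_spoke: "spoke c k \<Longrightarrow> D E 0"
  unfolding spoke_def by (meson D_finish D_unique circ_cycle)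

lemma bridge_pair_spokes:
  assumes e: "e \<in> circ 1" "f \<in> circ 2" "\<beta> e = \<beta> f" and card: "card (\<beta> e) = 2"
  shows "spoke 1 e" "spoke 2 f"
proof -
  have E: "e \<in> E" "f \<in> E" using e by (auto simp: E_def)
  have ne: "e \<noteq> f" using e(1,2) by (auto simp: circ_iff)
  have "{e, f} = \<beta> e"
    by (rule card_subset_eq) (use E e card ne in \<open>auto simp: label_mem finite_label\<close>)
  then have mem: "g = e \<or> g = f" if "g \<in> E" "\<beta> g = \<beta> e" for g
    using label_mem[OF E(1), of g] that by blast
  have *: "f \<notin> circ 1" "e \<notin> circ 2" using e(1,2) by (auto simp: circ_iff)
  have "\<beta> g \<noteq> \<beta> e" if "g \<in> circ 1" "g \<noteq> e" for g
    using mem[of g] that *(1) unfolding E_def by blast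
  then show "spoke 1 e" using e(1) by (simp add: spoke_def)
  have "\<beta> g \<noteq> \<beta> f" if "g \<in> circ 2" "g \<noteq> f" for g
    using mem[of g] that *(2) e(3) unfolding E_def by blast
  then show "spoke 2 f" using e(2) by (simp add: spoke_def)
qed

text \<open>On the first circle \<open>e\<close> and \<open>nx e\<close> are neighbours, but their
  partners \<open>f\<close> and \<open>f'\<close> are not. Placing \<open>e\<close> and
  \<open>nx e\<close> makes both labels known, so on the second circle the revelation begins with a
  jump to \<open>f\<close> and later jumps to \<open>f'\<close>. The edge before \<open>f'\<close>
  and the edge before \<open>f\<close> are completed without a choice, which turns the defect one of
  the start into \<open>-1\<close>.\<close>

lemma D_crossing_spokes:
  assumes ml: "m = l" and inj: "inj_on \<beta> (circ 1)" "inj_on \<beta> (circ 2)"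
    and e: "e \<in> circ 1" "f \<in> circ 2" "f' \<in> circ 2" "\<beta> e = \<beta> f" "\<beta> (nx e) = \<beta> f'"
    and nadj: "nx f \<noteq> f'" "nx f' \<noteq> f" and m3: "m \<ge> 3"
  shows "D E (- 1)"
proof -
  define L where "L = m"
  have L: "len 1 = L" "len 2 = L" "L \<ge> 3" unfolding L_def len_def using ml m3 by presburger+
  let ?s = "\<lambda>t. (nx ^^ t) f"
  have c1: "cycle (circ 1) L" using circ_cycle[of 1] L by simp
  have c2: "cycle (circ 2) L" using circ_cycle[of 2] L by simp
  have ne: "nx e \<noteq> e" using nx_ne[OF e(1)] L by simp
  have e1: "nx e \<in> circ 1" using nx_circ[OF e(1)] .
  have s2: "?s t \<in> circ 2" for t using e(2) by (induction t) (auto intro: nx_circ)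
  have E: "e \<in> E" "f \<in> E" "f' \<in> E" "nx e \<in> E" "?s t \<in> E" for t
    using e e1 s2 by (auto simp: E_def)
  have seq: "?s a = ?s b \<longleftrightarrow> a = b" if "a < L" "b < L" for a b
    using cycleD(3)[of "circ 2" L f a b] c2 e(2) that by simp
  have seqb: "\<beta> (?s a) = \<beta> (?s b) \<longleftrightarrow> a = b" if "a < L" "b < L" for a b
    using seq[OF that] inj_onD[OF inj(2) _ s2 s2] by blast
  have sL: "?s L = f" using cycleD(5)[of "circ 2" L f] c2 e(2) by simp
  obtain t where t: "t < L" "f' = ?s t" using cycleD(4)[of "circ 2" L f f'] c2 e(2,3) by auto
  have "t \<noteq> 0"
  proof
    assume "t = 0"
    then have "\<beta> e = \<beta> (nx e)" using t(2) e by simp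
    then show False using inj_onD[OF inj(1) _ e(1) e1] ne by metis
  qed
  moreover have "t \<noteq> 1" using t(2) nadj(1) by auto
  ultimately have t2: "t \<ge> 2" by simp
  have "t \<noteq> L - 1"
  proof
    assume "t = L - 1"
    then have "Suc t = L" using L by simp
    then have "nx (?s t) = f" using sL by (metis comp_apply funpow.simps(2))
    then show False using nadj(2) t(2) by simp
  qed
  then have tL: "t + 2 \<le> L" using t(1) by simp
  then have L4: "L \<ge> 4" using t2 by simp
  define U0 where "U0 = {e, nx e, nx (nx e)}"
  \<comment> \<open>As \<open>L \<ge> 4\<close>, the three vertices in \<open>U0\<close> complete
    only the edges \<open>e\<close> and \<open>nx e\<close>.\<close>
  have n3: "nx (nx (nx e)) \<notin> U0"
  proof -
    have seqe: "(nx ^^ a) e = (nx ^^ b) e \<longleftrightarrow> a = b" if "a < L" "b < L" for a b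
      using cycleD(3)[of "circ 1" L e a b] c1 e(1) that by simp
    show ?thesis using seqe[of 3 0] seqe[of 3 1] seqe[of 3 2] L4
      by (auto simp: U0_def numeral_3_eq_3 numeral_2_eq_2)
  qed
  have D0: "D U0 1"
  proof -
    have "U0 = (\<lambda>j. (nx ^^ j) e) ` {..2}" by (auto simp: U0_def numeral_2_eq_2 atMost_Suc)
    then show ?thesis using D_segment[OF E(1), of 2] by simp
  qed
  have U0c: "U0 \<subseteq> circ 1" using e(1) nx_circ by (auto simp: U0_def)
  \<comment> \<open>Known labels other than those of \<open>f\<close> and \<open>f'\<close> come
    from edges inside the revealed part of the second circle.\<close>
  have kap: "\<exists>a\<in>A. nx (?s a) \<in> ?s ` A \<and> b = \<beta> (?s a)"
    if hyp: "b \<in> \<kappa> (U0 \<union> ?s ` A)" "b \<noteq> \<beta> f" "b \<noteq> \<beta> f'" for A b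
  proof -
    obtain h where h: "h \<in> E" "b = \<beta> h" "h \<in> U0 \<union> ?s ` A" "nx h \<in> U0 \<union> ?s ` A"
      using hyp(1) unfolding \<kappa>_def by blast
    have dis: "g \<notin> U0" if "g \<in> circ 2" for g using U0c that by (auto simp: circ_iff)
    have dis': "g \<notin> ?s ` A" if "g \<in> circ 1" for g
    proof
      assume "g \<in> ?s ` A"
      then have "g \<in> circ 2" using s2 by blast
      then show False using that by (simp add: circ_iff)
    qed
    show ?thesis
    proof (cases "h \<in> U0")
      case True
      then have "nx h \<in> U0" using h(4) dis'[of "nx h"] U0c nx_circ by blast
      then have "h \<noteq> nx (nx e)" using n3 by metis
      then have "h = e \<or> h = nx e" using True unfolding U0_def by blast
      then show ?thesis using h(2) e hyp by auto
    next
      case False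
      then obtain a where a: "a \<in> A" "h = ?s a" using h(3) by blast
      have "nx h \<in> circ 2" using a(2) s2 nx_circ by blast
      then have "nx h \<in> ?s ` A" using h(4) dis by blast
      then show ?thesis using a h(2) by blast
    qed
  qed
  have kapU0: "\<beta> e \<in> \<kappa> (U0 \<union> X)" "\<beta> (nx e) \<in> \<kappa> (U0 \<union> X)" for X
    using E by (auto intro!: kappa_I simp: U0_def)
  let ?U2 = "U0 \<union> ?s ` {..t - 1}"
  have D2: "D ?U2 1"
  proof -
    have "D (U0 \<union> {f, nx f}) 1"
      using kapU0[of "{}"] e E by (intro D_step0[OF D0]) auto
    then have "D (U0 \<union> {f, nx f} \<union> ?s ` {..t - 1}) 1" using E by (intro D_path) auto
    moreover have "U0 \<union> {f, nx f} \<union> ?s ` {..t - 1} = ?U2"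
    proof -
      have "f = ?s 0" "nx f = ?s 1" by simp_all
      moreover have "0 \<in> {..t - 1}" "1 \<in> {..t - 1}" using t2 by auto
      ultimately have "f \<in> ?s ` {..t - 1}" "nx f \<in> ?s ` {..t - 1}" by blast+
      then show ?thesis by blast
    qed
    ultimately show ?thesis by simp
  qed
  have bf: "\<beta> f = \<beta> (?s 0)" "\<beta> f' = \<beta> (?s t)" using t by simp_all
  have lt: "t - 1 < L" "t - 1 \<noteq> 0" "t - 1 \<noteq> t" "L - 1 < L" "L - 1 \<noteq> 0" "L - 1 \<noteq> t" "0 < L"
    using t2 tL by linarith+
  have g1: "\<beta> (?s (t - 1)) \<noteq> \<beta> f" "\<beta> (?s (t - 1)) \<noteq> \<beta> f'"
    using seqb[of "t - 1" 0] seqb[of "t - 1" t] lt t(1) unfolding bf by blast+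
  have g2: "\<beta> (?s (L - 1)) \<noteq> \<beta> f" "\<beta> (?s (L - 1)) \<noteq> \<beta> f'"
    using seqb[of "L - 1" 0] seqb[of "L - 1" t] lt t(1) unfolding bf by blast+
  have Suc_s: "nx (?s a) = ?s (Suc a)" for a by simp
  have k1: "\<beta> (?s (t - 1)) \<notin> \<kappa> ?U2"
  proof
    assume "\<beta> (?s (t - 1)) \<in> \<kappa> ?U2"
    from kap[OF this g1] obtain a b where ab: "a \<le> t - 1" "b \<le> t - 1" "?s (Suc a) = ?s b"
      "\<beta> (?s (t - 1)) = \<beta> (?s a)" by auto
    have "t - 1 = a" using seqb[of "t - 1" a] ab t(1) by auto
    then have "Suc a = t" using t2 by simp
    then have "t = b" using seq[of t b] ab t(1) by auto
    then show False using ab(2) t2 by simp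
  qed
  have kL: "\<beta> (?s (L - 1)) \<notin> \<kappa> (U0 \<union> ?s ` {..L - 2})"
  proof
    assume "\<beta> (?s (L - 1)) \<in> \<kappa> (U0 \<union> ?s ` {..L - 2})"
    from kap[OF this g2] obtain a where a: "a \<le> L - 2" "\<beta> (?s (L - 1)) = \<beta> (?s a)" by auto
    then have "L - 1 = a" using seqb[of "L - 1" a] L4 by auto
    then show False using a(1) L4 by simp
  qed
  have tstep: "nx (?s (t - 1)) = f'"
  proof -
    have "Suc (t - 1) = t" using t2 by simp
    then show ?thesis using Suc_s[of "t - 1"] t(2) by metis
  qed
  have cond: "f' \<in> ?U2 \<or> nx f' \<in> ?U2 \<or> \<beta> f' \<in> \<kappa> ?U2" using kapU0(2) e by simp
  have s1U: "?s (t - 1) \<in> ?U2" by blast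
  have fU: "f \<in> ?U2" by (rule UnI2, rule image_eqI[of _ _ 0]) auto
  have nxl: "nx (?s (L - 1)) = f"
  proof -
    have "Suc (L - 1) = L" using L4 by simp
    then show ?thesis using Suc_s[of "L - 1"] sL by metis
  qed
  have "\<exists>U. D U (- 1) \<and> f \<in> U \<and> e \<in> U"
  \<comment> \<open>If \<open>f'\<close> is the last edge but one of the second circle, counted from
    \<open>f\<close>, the jump to \<open>f'\<close> also places the vertex before \<open>f\<close>,
    and both edges are completed at once.\<close>
  proof (cases "t = L - 2")
    case True
    have nf': "nx f' = ?s (L - 1)"
    proof -
      have "Suc t = L - 1" using True L4 by simp
      then show ?thesis using Suc_s[of t] t(2) by metis
    qed
    have ne2: "\<beta> (?s (t - 1)) \<noteq> \<beta> (?s (L - 1))" using seqb[of "t - 1" "L - 1"] True t2 lt by auto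
    have "D (?U2 \<union> {f', nx f'}) (1 - real (card {?s (t - 1), ?s (L - 1)}))"
    proof (rule D_step[OF D2 _ cond])
      show "f' \<in> E" "{?s (t - 1), ?s (L - 1)} \<subseteq> E" using E by auto
      show "g \<in> ?U2 \<union> {f', nx f'} \<and> nx g \<in> ?U2 \<union> {f', nx f'}" if "g \<in> {?s (t - 1), ?s (L - 1)}" for g
      proof -
        from that have "g = ?s (t - 1) \<or> g = ?s (L - 1)" by blast
        then show ?thesis
        proof
          assume "g = ?s (t - 1)"
          then show ?thesis using s1U tstep by simp
        next
          assume "g = ?s (L - 1)"
          then show ?thesis using nf' nxl fU by simp
        qed
      qed
      show "inj_on \<beta> {?s (t - 1), ?s (L - 1)}" using ne2 by (auto simp: inj_on_def)
      have "\<kappa> ?U2 \<subseteq> \<kappa> (U0 \<union> ?s ` {..L - 2})" using True by (intro kappa_mono) auto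
      then show "\<beta> ` {?s (t - 1), ?s (L - 1)} \<inter> \<kappa> ?U2 = {}" using k1 kL by blast
      show "\<beta> f' \<notin> \<beta> ` {?s (t - 1), ?s (L - 1)}" using g1 g2 by auto
    qed
    moreover have "?s (t - 1) \<noteq> ?s (L - 1)" using ne2 by auto
    moreover have "e \<in> ?U2 \<union> {f', nx f'}" "f \<in> ?U2 \<union> {f', nx f'}" using fU by (auto simp: U0_def)
    ultimately show ?thesis by (intro exI[of _ "?U2 \<union> {f', nx f'}"]) auto
  next
    case False
    then have t3: "t + 1 \<le> L - 2" using tL by simp
    have "D (?U2 \<union> {f', nx f'}) (1 - 1)"
      by (rule D_step1[OF D2 _ cond, of "?s (t - 1)"]) (use E s1U tstep k1 g1 in auto)
    then have "D (?U2 \<union> {f', nx f'} \<union> ?s ` {..L - 2}) 0"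
      using E fU by (intro D_path) auto
    moreover have "?U2 \<union> {f', nx f'} \<union> ?s ` {..L - 2} = U0 \<union> ?s ` {..L - 2}"
    proof -
      have "nx f' = ?s (t + 1)" using t(2) by simp
      moreover have "?s t \<in> ?s ` {..L - 2}" "?s (t + 1) \<in> ?s ` {..L - 2}"
        by (rule imageI, use t3 in simp)+
      ultimately have "f' \<in> ?s ` {..L - 2}" "nx f' \<in> ?s ` {..L - 2}" using t(2) by metis+
      moreover have "?s ` {..t - 1} \<subseteq> ?s ` {..L - 2}" using t3 by (intro image_mono) auto
      ultimately show ?thesis by blast
    qed
    ultimately have D4: "D (U0 \<union> ?s ` {..L - 2}) 0" by (simp only:)
    let ?U4 = "U0 \<union> ?s ` {..L - 2}" let ?h = "?s (L - 2)"
    have nh: "nx ?h = ?s (L - 1)"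
    proof -
      have "Suc (L - 2) = L - 1" using L4 by simp
      then show ?thesis using Suc_s[of "L - 2"] by metis
    qed
    have f4: "f \<in> ?U4" by (rule UnI2, rule image_eqI[of _ _ 0]) auto
    have "D (?U4 \<union> {?h, nx ?h}) (0 - 1)"
    proof (rule D_step1[OF D4, of _ "?s (L - 1)"])
      show "?h \<in> E" "?s (L - 1) \<in> E" by (rule E)+
      show "?h \<in> ?U4 \<or> nx ?h \<in> ?U4 \<or> \<beta> ?h \<in> \<kappa> ?U4" by blast
      show "?s (L - 1) \<in> ?U4 \<union> {?h, nx ?h}" using nh by simp
      show "nx (?s (L - 1)) \<in> ?U4 \<union> {?h, nx ?h}" using f4 unfolding nxl by blast
      show "\<beta> (?s (L - 1)) \<notin> \<kappa> ?U4" by (rule kL)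
      have "L - 2 < L" "L - 1 < L" "L - 1 \<noteq> L - 2" using L4 by linarith+
      then show "\<beta> (?s (L - 1)) \<noteq> \<beta> ?h" using seqb by blast
    qed
    then have "D (?U4 \<union> {?h, nx ?h}) (- 1)" by simp
    moreover have "f \<in> ?U4 \<union> {?h, nx ?h}" "e \<in> ?U4 \<union> {?h, nx ?h}" using f4 by (auto simp: U0_def)
    ultimately show ?thesis by blast
  qed
  then obtain U where U: "D U (- 1)" "f \<in> U" "e \<in> U" by blast
  have "D (U \<union> circ 1) (- 1)" using c1 U e by (intro D_cycle[of "circ 1" L _ _ e]) auto
  then have "D (U \<union> circ 1 \<union> circ 2) (- 1)" using c2 U e by (intro D_cycle[of "circ 2" L _ _ f]) auto
  moreover have "U \<subseteq> E" using U(1) unfolding D_def by blast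
  then have "U \<union> circ 1 \<union> circ 2 = E" unfolding E_def by blast
  ultimately show ?thesis by simp
qed

lemma N_loop:
  assumes e: "e \<in> E" and loop: "\<And>x. x \<in> \<Omega> \<Longrightarrow> x e = x (nx e)"
  shows "real (N {e, nx e}) \<le> C * real n"
proof -
  have "inj_on (\<lambda>z. z e) ((\<lambda>x. restrict x {e, nx e}) ` \<Omega>)"
  proof (rule inj_onI, clarify)
    fix x y assume xy: "x \<in> \<Omega>" "y \<in> \<Omega>" "restrict x {e, nx e} e = restrict y {e, nx e} e"
    then have "x (nx e) = y (nx e)" using loop[of x] loop[of y] by simp
    then show "restrict x {e, nx e} = restrict y {e, nx e}" using xy(3) by (auto simp: fun_eq_iff)
  qed
  moreover have "(\<lambda>z. z e) ` (\<lambda>x. restrict x {e, nx e}) ` \<Omega> \<subseteq> {1..n}"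
    using Omega_range[OF _ e] by auto
  ultimately have "N {e, nx e} \<le> card {1..n}" unfolding N_def by (rule card_inj_on_le) simp
  moreover have "1 * real n \<le> C * real n" using C_ge_1 by (intro mult_right_mono) auto
  ultimately show ?thesis by simp
qed

text \<open>For length two the ends of the loop are all vertices of the circle, so there is no
  separate closing step and the defect stays at zero.\<close>

lemma D_loop:
  assumes e: "e \<in> E" and loop: "\<And>x. x \<in> \<Omega> \<Longrightarrow> x e = x (nx e)"
  shows "len (fst e) \<ge> 3 \<Longrightarrow> inj_on \<beta> (circ (fst e)) \<Longrightarrow> D E (- 1)"
    and "len (fst e) = 2 \<Longrightarrow> D E 0"
proof -
  have c: "fst e \<in> {1, 2}" "e \<in> circ (fst e)" using e by (auto simp: E_iff circ_iff)
  show "D E (- 1)" if "len (fst e) \<ge> 3" "inj_on \<beta> (circ (fst e))"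
    by (rule D_finish[OF c(1) D_start_pair_unique[OF circ_cycle[OF c(1)] that(1) c(2) N_loop[OF e loop] that(2)]])
  show "D E 0" if "len (fst e) = 2"
  proof -
    have "circ (fst e) = {e, nx e}"
      using circle_cycle(2)[OF c(2)] that by (auto simp: numeral_2_eq_2 lessThan_Suc)
    moreover have "D {e, nx e} 0"
    proof (rule D_initial)
      show "{e, nx e} \<subseteq> E" using e nx_in_E by auto
      have "\<beta> e \<in> \<kappa> {e, nx e}" using e by (intro kappa_I) auto
      then have "card {\<beta> e} \<le> card (\<kappa> {e, nx e})" by (intro card_mono finite_kappa) auto
      then have "real n powr 1 \<le> real n powr (real (card (\<kappa> {e, nx e})) + 0)"
        using n_pos by (intro powr_mono) auto
      then have "C * real n \<le> C * real n powr (real (card (\<kappa> {e, nx e})) + 0)"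
        using C_ge_1 n_pos by (intro mult_left_mono) auto
      then show "real (N {e, nx e}) \<le> C * real n powr (real (card (\<kappa> {e, nx e})) + 0)"
        using N_loop[OF e loop] by linarith
    qed
    ultimately show ?thesis using D_finish[OF c(1)] by simp
  qed
qed

text \<open>An adjacent pair that forms a class escapes cancellation either as a triple counted in
  (C2) or by starting with a loop. The second alternative is the reason for the triples with
  \<open>p = q\<close> in \<open>bad_triples\<close>.\<close>

lemma adjacent_block:
  assumes e: "e \<in> circ c" "c \<in> {1, 2}" "len c \<ge> 3" and adj: "\<beta> e = \<beta> (nx e)" and card: "card (\<beta> e) = 2"
    and nc: "\<And>x. x \<in> \<Omega> \<Longrightarrow> \<not> cancelling r x e"
  shows "\<beta> e = {e, nx e}" "\<And>x. x \<in> \<Omega> \<Longrightarrow> x e \<noteq> x (nx (nx e)) \<or> x e = x (nx e)"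
proof -
  have eE: "e \<in> E" "nx e \<in> E" using e(1,2) nx_circ[OF e(1)] circ_E by auto
  have ne: "nx e \<noteq> e" using nx_ne[OF e(1)] e(3) by simp
  have "{e, nx e} \<subseteq> \<beta> e" using eE adj by (auto simp: label_mem)
  then have "{e, nx e} = \<beta> e"
    by (rule card_subset_eq[OF finite_label[OF eE(1)]]) (use ne card in simp)
  then show b: "\<beta> e = {e, nx e}" by simp
  fix x assume x: "x \<in> \<Omega>"
  have "fst e = c" using e(1) by (simp add: circ_iff)
  then show "x e \<noteq> x (nx (nx e)) \<or> x e = x (nx e)"
    using nc[OF x] b label[OF x eE(1)] eE e(3) unfolding cancelling_def by auto
qed

text \<open>The patterns in which a loop may be all that keeps the walks out of the main term. The
  gain from the loop cannot be used for \<Omega> as a whole, as the loop may sit at a different edge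
  for each \<open>x\<close>. The value of \<open>K\<close> and the injectivity are recorded for the
  count after splitting by its position.\<close>

definition loop_exception :: bool where
  "loop_exception \<longleftrightarrow> m = l \<and> (\<forall>x\<in>\<Omega>. \<exists>e\<in>E. x e = x (nx e)) \<and>
     (m \<ge> 3 \<and> K = m \<and> inj_on \<beta> (circ 1) \<and> inj_on \<beta> (circ 2) \<or> m = 2 \<and> K = 1)"

text \<open>As \<open>2 * K = m + l\<close>, the defect has to become negative. A class that meets
  both circles consists of one edge on each, so both circles have a closing edge. A second gain
  comes from a label that repeats on a circle, through (C2) if it repeats at neighbouring edges and
  through a jump otherwise. Without repetitions the classes match the circles edge by edge, and a
  matching that does not respect neighbours is a crossing.\<close>

lemma all_pairs_case:
  assumes pairs2: "\<And>e. e \<in> E \<Longrightarrow> card (\<beta> e) = 2"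
    and nc: "\<And>x e. x \<in> \<Omega> \<Longrightarrow> \<not> cancelling r x e"
    and nm: "\<And>x. x \<in> \<Omega> \<Longrightarrow> \<not> main_config r x"
    and T: "real (card (bad_triples n r)) \<le> C * real n powr (2 - \<delta>)" and \<delta>: "\<delta> \<le> 1 / 2"
  shows "(\<exists>d. D E d \<and> d \<le> - \<delta>) \<or> loop_exception"
proof -
  obtain e0 f0 where b0: "e0 \<in> circ 1" "f0 \<in> circ 2" "\<beta> e0 = \<beta> f0" using bridge by blast
  have sp: "spoke 1 e0" "spoke 2 f0"
    by (rule bridge_pair_spokes[OF b0 pairs2]; use b0(1) in \<open>simp add: E_def\<close>)+
  have spoke: "\<exists>k. spoke c k" if "c \<in> {1, 2}" for c using sp that by blast
  show ?thesis
  proof (cases "\<exists>c\<in>{1, 2}. \<not> inj_on \<beta> (circ c)")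
    case True
    then obtain c where c: "c \<in> {1, 2}" "\<not> inj_on \<beta> (circ c)" by blast
    note cyc = circ_cycle[OF c(1)]
    obtain f g where fg: "f \<in> circ c" "g \<in> circ c" "f \<noteq> g" "\<beta> f = \<beta> g"
      using c(2) by (auto simp: inj_on_def)
    obtain k where k: "k \<in> circ c" "\<And>f. f \<in> circ c \<Longrightarrow> f \<noteq> k \<Longrightarrow> \<beta> f \<noteq> \<beta> k"
      using spoke[OF c(1)] unfolding spoke_def by blast
    \<comment> \<open>A repeated label and a spoke occupy three different edges.\<close>
    have L3: "len c \<ge> 3"
    proof -
      have "k \<noteq> f" "k \<noteq> g" using k(2) fg by metis+
      then have "card {k, f, g} = 3" using fg by simp
      moreover have "card {k, f, g} \<le> len c" using k fg by (intro len_ge_card) auto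
      ultimately show ?thesis by simp
    qed
    show ?thesis
    proof (cases "\<exists>e\<in>circ c. \<beta> e = \<beta> (nx e)")
      case True
      then obtain e where e: "e \<in> circ c" "\<beta> e = \<beta> (nx e)" by blast
      have eE: "e \<in> E" using e(1) circ_E[OF c(1)] by auto
      note bad = adjacent_block(2)[OF e(1) c(1) L3 e(2) pairs2[OF eE] nc]
      have "real (N {e, nx e, nx (nx e)}) \<le> C * real n powr (2 - \<delta>)"
        using N_triple[OF eE e(2) bad] T by linarith
      from D_start_triple_unique[OF cyc L3 e this k]
      show ?thesis using D_finish[OF c(1)] by blast
    next
      case False
      then have "D (circ c) (- 1)" using D_repeat_unique[OF cyc k _ fg] by blast
      then have "D E (- 1)" by (rule D_finish[OF c(1)])
      then show ?thesis using \<delta> by (intro disjI1 exI[of _ "- 1"]) auto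
    qed
  next
    case False
    then have inj: "inj_on \<beta> (circ 1)" "inj_on \<beta> (circ 2)" by auto
    have ex: "\<exists>f\<in>circ c'. \<beta> f = \<beta> e" if e: "e \<in> circ c" and c: "c \<in> {1, 2}" "c' \<in> {1, 2}" "c \<noteq> c'" for e c c'
    proof -
      have eE: "e \<in> E" using e circ_E[OF c(1)] by auto
      have "\<not> \<beta> e \<subseteq> {e}" using pairs2[OF eE] card_mono[of "{e}" "\<beta> e"] by auto
      then obtain f where f: "f \<in> \<beta> e" "f \<noteq> e" by blast
      then have "f \<in> E" "\<beta> f = \<beta> e" using label_mem[OF eE] by auto
      moreover have "f \<notin> circ c" using inj e f(2) calculation(2) c by (auto simp: inj_on_def)
      ultimately show ?thesis using c unfolding E_def by auto
    qed
    have "\<beta> ` circ c \<subseteq> \<beta> ` circ c'" if "c \<in> {1, 2}" "c' \<in> {1, 2}" "c \<noteq> c'" for c c'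
      using ex[OF _ that] by (metis image_eqI image_subsetI)
    from this[of 1 2] this[of 2 1] have "\<beta> ` circ 1 = \<beta> ` circ 2" by simp
    then have im: "\<beta> ` circ 1 = \<beta> ` circ 2" "\<beta> ` E = \<beta> ` circ 1" by (auto simp: E_def image_Un)
    have cc: "card (\<beta> ` circ 1) = m" "card (\<beta> ` circ 2) = l"
      using card_image[OF inj(1)] card_image[OF inj(2)] unfolding card_circ by (auto simp: len_def)
    have ml: "m = l" using cc im(1) by metis
    have Km: "K = m" using cc(1) im(2) by metis
    obtain x0 where x0: "x0 \<in> \<Omega>" using Omega_nonempty by blast
    have "m \<noteq> 1" using nm[OF x0, unfolded main_config_def] ml by blast
    \<comment> \<open>On a circle of length two, transposition makes both edges equivalent, against
      the injectivity of the labels.\<close>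
    moreover have "m \<noteq> 2"
    proof
      assume m2: "m = 2"
      let ?e = "(1, 0) :: nat \<times> nat"
      have e: "?e \<in> circ 1" "len 1 = 2" using m2 unfolding circ_iff len_def by auto
      have eE: "?e \<in> E" "nx ?e \<in> E" using e(1) nx_circ[OF e(1)] circ_E[of 1] by auto
      have "(ed x0 ?e, ed x0 (nx ?e)) \<in> r"
        using r_transpose[of "x0 ?e" "x0 (nx ?e)"] ed_pairs[OF x0 eE(1)] nx_nx_2[OF e]
        by (simp add: ed_def)
      then have "\<beta> ?e = \<beta> (nx ?e)" using label_iff[OF x0 eE] by simp
      then show False using inj_onD[OF inj(1) _ e(1) nx_circ[OF e(1)]] nx_ne[OF e(1)] e(2) by auto
    qed
    ultimately have m3: "m \<ge> 3" using m_pos by simp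
    show ?thesis
    proof (cases "\<exists>e\<in>circ 1. \<exists>f\<in>circ 2. \<exists>f'\<in>circ 2. \<beta> e = \<beta> f \<and> \<beta> (nx e) = \<beta> f' \<and> nx f \<noteq> f' \<and> nx f' \<noteq> f")
      case True
      then have "D E (- 1)" using D_crossing_spokes[OF ml inj _ _ _ _ _ _ _ m3] by blast
      then show ?thesis using \<delta> by (intro disjI1 exI[of _ "- 1"]) auto
    next
      case False
      have "dihedral_config r x" if x: "x \<in> \<Omega>" for x
        unfolding dihedral_config_def
      proof (intro conjI ballI impI)
        fix e assume e: "e \<in> E"
        have c: "fst e \<in> {1, 2}" "e \<in> circ (fst e)" using e by (auto simp: E_iff circ_iff)
        have "f = e" if "f \<in> cls r x e" "f \<in> circ (fst e)" for f
        proof -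
          have "\<beta> f = \<beta> e" using that(1) label[OF x e] label_mem[OF e] by auto
          then show ?thesis using inj c that(2) by (auto simp: inj_on_def)
        qed
        moreover have "e \<in> cls r x e" using label_self[OF e] label[OF x e] by simp
        ultimately show "cls r x e \<inter> circ (fst e) = {e}" using c by blast
      next
        fix e f f' assume a: "e \<in> circ 1" "f \<in> circ 2" "f' \<in> circ 2"
          "(ed x e, ed x f) \<in> r" "(ed x (nx e), ed x f') \<in> r"
        then have E: "e \<in> E" "f \<in> E" "f' \<in> E" "nx e \<in> E" using nx_circ[OF a(1)] by (auto simp: E_def)
        show "nx f = f' \<or> nx f' = f"
          using False a label_iff[OF x E(1,2)] label_iff[OF x E(4,3)] by blast
      qed
      then have "\<exists>e\<in>E. x e = x (nx e)" if "x \<in> \<Omega>" for x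
        using nm[OF that, unfolded main_config_def] that ml by blast
      then show ?thesis using ml m3 Km inj unfolding loop_exception_def by blast
    qed
  qed
qed

text \<open>Without spokes, a class that meets both circles has two edges on each and thus at least
  four. This lowers \<open>K\<close> so far that the defect \<open>1 - \<delta>\<close> is good
  enough in the tight case.\<close>

lemma double_bridge_case:
  assumes no_spoke: "\<And>e f. e \<in> circ 1 \<Longrightarrow> f \<in> circ 2 \<Longrightarrow> \<beta> e = \<beta> f \<Longrightarrow> \<not> spoke 1 e \<and> \<not> spoke 2 f"
    and nc: "\<And>x e. x \<in> \<Omega> \<Longrightarrow> \<not> cancelling r x e"
    and nm: "\<And>x. x \<in> \<Omega> \<Longrightarrow> \<not> main_config r x"
    and T: "real (card (bad_triples n r)) \<le> C * real n powr (2 - \<delta>)"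
    and \<delta>: "0 < \<delta>" "\<delta> \<le> 1 / 2"
  shows "(\<exists>d. D E d \<and> real K + d \<le> real (m + l) / 2 - \<delta>) \<or> loop_exception"
proof -
  obtain e0 f0 where b0: "e0 \<in> circ 1" "f0 \<in> circ 2" "\<beta> e0 = \<beta> f0" using bridge by blast
  have E0: "e0 \<in> E" "f0 \<in> E" using b0 by (auto simp: E_def)
  let ?B = "\<beta> e0"
  obtain e1 where e1: "e1 \<in> circ 1" "e1 \<noteq> e0" "\<beta> e1 = ?B"
    using no_spoke[OF b0] b0(1) by (auto simp: spoke_def)
  obtain f1 where f1: "f1 \<in> circ 2" "f1 \<noteq> f0" "\<beta> f1 = ?B"
    using no_spoke[OF b0] b0(2,3) by (auto simp: spoke_def)
  have E1: "e1 \<in> E" "f1 \<in> E" using e1 f1 by (auto simp: E_def)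
  have four: "{e0, e1, f0, f1} \<subseteq> ?B" using E0 E1 e1 f1 b0 label_mem[OF E0(1)] by auto
  have c4: "card {e0, e1, f0, f1} = 4"
  proof -
    have ne: "x \<noteq> y" if "x \<in> circ 1" "y \<in> circ 2" for x y using that by (auto simp: circ_iff)
    show ?thesis
      using e1(2)[symmetric] f1(2)[symmetric] ne[OF b0(1,2)] ne[OF b0(1) f1(1)] ne[OF e1(1) b0(2)]
        ne[OF e1(1) f1(1)] by simp
  qed
  have B4: "card ?B \<ge> 4" using card_mono[OF finite_label[OF E0(1)] four] c4 by simp
  show ?thesis
  proof (cases "2 * K + 3 \<le> m + l")
    case True
    then have "2 * real K + 3 \<le> real (m + l)" by linarith
    then have "real K + 1 \<le> real (m + l) / 2 - \<delta>" using \<delta> by argo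
    then show ?thesis using D_basic by blast
  next
    case False
    have KB: "m + l = 2 * K + 2" using False card_labels_large_block[OF E0(1)] B4 by linarith
    then have "card ?B = 4" using card_labels_large_block[OF E0(1)] B4 by linarith
    then have Beq: "{e0, e1, f0, f1} = ?B" by (intro card_subset_eq finite_label E0 four) (simp add: c4)
    have others: "card (\<beta> e) = 2" if "e \<in> E" "\<beta> e \<noteq> ?B" for e
      using card_labels_two_blocks[OF E0(1) that(1)] that two_le_card[OF that(1)] KB B4 by auto
    have le1: "len 1 \<ge> 2" using len_ge_card[of "{e0, e1}" 1] e1 b0(1) by simp
    have le2: "len 2 \<ge> 2" using len_ge_card[of "{f0, f1}" 2] f1 b0(2) by simp
    show ?thesis
    proof (cases "len 1 = 2 \<and> len 2 = 2")
      case True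
      then have m2: "m = 2" and l2: "l = 2" by (auto simp: len_def)
      then have ml: "m = l" by metis
      have "K = 1" using KB m2 l2 by linarith
      moreover have "\<exists>e\<in>E. x e = x (nx e)" if "x \<in> \<Omega>" for x
        using nm[OF that, unfolded main_config_def] ml m2 by blast
      ultimately show ?thesis using ml m2 unfolding loop_exception_def by blast
    next
      case False
      then have "len 1 \<ge> 3 \<or> len 2 \<ge> 3" using le1 le2 by linarith
      then have "\<exists>c\<in>{1, 2}. len c \<ge> 3" by blast
      then obtain c where c: "c \<in> {1, 2}" "len c \<ge> 3" by blast
      note cyc = circ_cycle[OF c(1)]
      obtain i j where ij: "i \<in> circ c" "j \<in> circ c" "i \<noteq> j" "\<beta> i = ?B" "\<beta> j = ?B"
        "\<And>g. g \<in> circ c \<Longrightarrow> \<beta> g = ?B \<Longrightarrow> g = i \<or> g = j"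
      proof -
        have mem: "g \<in> {e0, e1, f0, f1}" if "g \<in> circ c" "\<beta> g = ?B" for g
          using Beq label_mem[OF E0(1), of g] that circ_E[OF c(1)] by auto
        show ?thesis
        proof (cases "c = 1")
          case True
          then have "g = e0 \<or> g = e1" if "g \<in> circ c" "\<beta> g = ?B" for g
            using mem[OF that] that(1) b0(2) f1(1) by (auto simp: circ_iff)
          then show ?thesis using that[of e0 e1] b0 e1 True by auto
        next
          case False
          then have "c = 2" using c(1) by simp
          then have "g = f0 \<or> g = f1" if "g \<in> circ c" "\<beta> g = ?B" for g
            using mem[OF that] that(1) b0(1) e1(1) by (auto simp: circ_iff)
          then show ?thesis using that[of f0 f1] b0 f1 \<open>c = 2\<close> by auto
        qed
      qed
      show ?thesis
      proof (cases "\<exists>e\<in>circ c. \<beta> e = \<beta> (nx e) \<and> \<beta> e \<noteq> ?B")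
        case True
        then obtain e where e: "e \<in> circ c" "\<beta> e = \<beta> (nx e)" "\<beta> e \<noteq> ?B" by blast
        have eE: "e \<in> E" using e(1) circ_E[OF c(1)] by auto
        note bad = adjacent_block(2)[OF e(1) c e(2) others[OF eE e(3)] nc]
        have "real (N {e, nx e, nx (nx e)}) \<le> C * real n powr (2 - \<delta>)"
          using N_triple[OF eE e(2) bad] T by linarith
        from D_start_triple(2)[OF cyc c(2) e(1,2) this] have "D E (1 - \<delta>)" by (rule D_finish[OF c(1)])
        moreover have "real (m + l) = 2 * real K + 2" using KB by linarith
        then have "real K + (1 - \<delta>) \<le> real (m + l) / 2 - \<delta>" by argo
        ultimately show ?thesis by blast
      next
        case False
        \<comment> \<open>The circle is cut open such that equal neighbouring labels can meet only
          across the cut. At this point such neighbours must be the two edges of the class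
          \<open>?B\<close>, and then the cut is made between them.\<close>
        have "\<exists>e\<in>circ c. \<forall>t. Suc t < len c \<longrightarrow> \<beta> ((nx ^^ t) e) \<noteq> \<beta> ((nx ^^ Suc t) e)"
        proof (cases "\<exists>e\<in>circ c. \<beta> e = \<beta> (nx e)")
          case True
          then obtain e where e: "e \<in> circ c" "\<beta> e = \<beta> (nx e)" by blast
          then have eB: "\<beta> e = ?B" "\<beta> (nx e) = ?B" using False by auto
          have "len c \<ge> 2" using c(2) by linarith
          note ne = nx_ne[OF e(1) this] nx_circ[OF e(1)]
          have two: "g = e \<or> g = nx e" if "g \<in> circ c" "\<beta> g = ?B" for g
            using ij(6)[OF that] ij(6)[OF e(1) eB(1)] ij(6)[OF ne(2) eB(2)] ne(1) by metis
          let ?s = "\<lambda>t. (nx ^^ t) (nx e)"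
          have s: "?s t \<in> circ c" for t using ne(2) by (induction t) (simp_all add: nx_circ)
          have seq: "?s a = ?s b \<longleftrightarrow> a = b" if "a < len c" "b < len c" for a b
            using cycleD(3)[OF cyc ne(2) that] .
          have last: "?s (len c - 1) = e" using cycle_last[OF cyc e(1)] .
          have "\<beta> (?s t) \<noteq> \<beta> (?s (Suc t))" if t: "Suc t < len c" for t
          proof
            assume eq: "\<beta> (?s t) = \<beta> (?s (Suc t))"
            then have "\<beta> (?s t) = ?B" using False s[of t] by auto
            then have "?s t = ?s (len c - 1) \<or> ?s t = ?s 0" "?s (Suc t) = ?s (len c - 1) \<or> ?s (Suc t) = ?s 0"
              using two[OF s[of t]] two[OF s[of "Suc t"]] eq last by auto
            then have "t = len c - 1 \<or> t = 0" "Suc t = len c - 1 \<or> Suc t = 0"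
              using seq[of t "len c - 1"] seq[of t 0] seq[of "Suc t" "len c - 1"] seq[of "Suc t" 0] t by auto
            then show False using t c(2) by linarith
          qed
          then show ?thesis using ne(2) by blast
        next
          case False
          then have "\<beta> ((nx ^^ t) i) \<noteq> \<beta> ((nx ^^ Suc t) i)" for t
          proof -
            have "(nx ^^ t) i \<in> circ c" using ij(1) by (induction t) (auto intro: nx_circ)
            then show ?thesis using False by auto
          qed
          then show ?thesis using ij(1) by blast
        qed
        then obtain e where e: "e \<in> circ c" "\<And>t. Suc t < len c \<Longrightarrow> \<beta> ((nx ^^ t) e) \<noteq> \<beta> ((nx ^^ Suc t) e)"
          by blast
        have eq: "\<beta> i = \<beta> j" using ij(4,5) by simp
        have "D (circ c) 0" by (rule D_repeat[OF cyc e ij(1-3) eq])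
        then have "D E 0" by (rule D_finish[OF c(1)])
        moreover have "real (m + l) = 2 * real K + 2" using KB by linarith
        then have "real K + 0 \<le> real (m + l) / 2 - \<delta>" using \<delta> by argo
        ultimately show ?thesis by blast
      qed
    qed
  qed
qed

text \<open>A spoke gives defect zero. Together with a class of three or more edges it leaves the
  exponent one half below \<open>(m + l) / 2\<close>, which pays for
  \<open>\<delta> \<le> 1 / 2\<close>; if all classes are pairs, \<open>all_pairs_case\<close> takes
  over.\<close>

lemma D_or_loop:
  assumes nc: "\<And>x e. x \<in> \<Omega> \<Longrightarrow> \<not> cancelling r x e"
    and nm: "\<And>x. x \<in> \<Omega> \<Longrightarrow> \<not> main_config r x"
    and T: "real (card (bad_triples n r)) \<le> C * real n powr (2 - \<delta>)"
    and \<delta>: "0 < \<delta>" "\<delta> \<le> 1 / 2"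
  shows "(\<exists>d. D E d \<and> real K + d \<le> real (m + l) / 2 - \<delta>) \<or> loop_exception"
proof (cases "\<exists>e f. e \<in> circ 1 \<and> f \<in> circ 2 \<and> \<beta> e = \<beta> f \<and> (spoke 1 e \<or> spoke 2 f)")
  case False
  then show ?thesis using double_bridge_case[OF _ nc nm T \<delta>] by blast
next
  case True
  then have D0: "D E 0" using D_spoke by blast
  show ?thesis
  proof (cases "\<forall>e\<in>E. card (\<beta> e) = 2")
    case True
    have K: "2 * K \<le> m + l" by (rule card_labels_ge)
    from True all_pairs_case[OF _ nc nm T \<delta>(2)] consider d where "D E d" "d \<le> - \<delta>" | loop_exception by blast
    then show ?thesis
    proof cases
      case 1
      moreover have "2 * real K \<le> real (m + l)" using K by linarith
      then have "real K + d \<le> real (m + l) / 2 - \<delta>" using 1(2) by argo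
      ultimately show ?thesis by blast
    qed blast
  next
    case False
    then obtain e where "e \<in> E" "card (\<beta> e) \<noteq> 2" by blast
    then have "card (\<beta> e) \<ge> 3" using two_le_card[of e] by simp
    then have "2 * K + 1 \<le> m + l" using card_labels_large_block[OF \<open>e \<in> E\<close>] by simp
    then have "2 * real K + 1 \<le> real (m + l)" by linarith
    then have "real K + 0 \<le> real (m + l) / 2 - \<delta>" using \<delta> by argo
    then show ?thesis using D0 by blast
  qed
qed

text \<open>In the exceptional case \<Omega> is covered by the sets of walks with a loop at a fixed
  edge; the factor \<open>m + l\<close> counts these edges. Each of these sets has the same labels,
  so the counting applies to it anew, with the loop as starting set.\<close>

lemma card_Omega_le:
  assumes nc: "\<And>x e. x \<in> \<Omega> \<Longrightarrow> \<not> cancelling r x e"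
    and nm: "\<And>x. x \<in> \<Omega> \<Longrightarrow> \<not> main_config r x"
    and T: "real (card (bad_triples n r)) \<le> C * real n powr (2 - \<delta>)"
    and \<delta>: "0 < \<delta>" "\<delta> \<le> 1 / 2"
  shows "real (card \<Omega>) \<le> real (m + l) * (C * real n powr (real (m + l) / 2 - \<delta>) * real (alpha2 n r) ^ (m + l))"
    (is "_ \<le> _ * ?R")
proof -
  have R0: "?R \<ge> 0" using C_ge_1 by simp
  from D_or_loop[OF nc nm T \<delta>] consider d where "D E d" "real K + d \<le> real (m + l) / 2 - \<delta>" | loop_exception
    by blast
  then show ?thesis
  proof cases
    case 1
    have "real (card \<Omega>) \<le> 1 * ?R" using count_if[OF 1] by simp
    also have "\<dots> \<le> real (m + l) * ?R" using R0 m_pos by (intro mult_right_mono) auto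
    finally show ?thesis .
  next
    case 2
    define F where "F e = {x \<in> \<Omega>. x e = x (nx e)}" for e
    have F: "real (card (F e)) \<le> ?R" if e: "e \<in> E" for e
    proof (cases "F e = {}")
      case True
      then show ?thesis using R0 by simp
    next
      case False
      interpret F: labelled_configs m l n r \<beta> "F e" C
        using finite_E nx_E n_pos C_ge_1 equiv_r Omega_sub label_related label False two_le_card bridge r_transpose
        by unfold_locales (auto simp: F_def)
      have "\<exists>d. F.D E d \<and> real K + d \<le> real (m + l) / 2 - \<delta>"
      proof (cases "m = 2")
        \<comment> \<open>The exponent is \<open>K + 0 = 1\<close> and
          \<open>(m + l) / 2 = 2\<close>, so the weaker bound for a loop on a circle of length two
          suffices.\<close>
        case True
        have ml: "m = l" using 2 unfolding loop_exception_def by blast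
        have "\<not> m \<ge> 3" using True by linarith
        then have K1: "K = 1" using 2 unfolding loop_exception_def by blast
        have len2: "len (fst e) = 2" using ml True unfolding len_def by presburger
        have "F.D E 0" by (rule F.D_loop(2)[OF e _ len2]) (simp add: F_def)
        moreover have "real (m + l) = 4" using True ml by linarith
        then have "real K + 0 \<le> real (m + l) / 2 - \<delta>" using \<delta> K1 by simp
        ultimately show ?thesis by blast
      next
        case False
        then have m3: "m \<ge> 3" "m = l" "K = m" "inj_on \<beta> (circ 1)" "inj_on \<beta> (circ 2)"
          using 2 unfolding loop_exception_def by blast+
        have "len (fst e) \<ge> 3" using m3(1,2) unfolding len_def by presburger
        moreover have "inj_on \<beta> (circ (fst e))" using m3(4,5) e by (auto simp: E_iff)
        ultimately have "F.D E (- 1)" using F.D_loop(1)[OF e] by (simp add: F_def)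
        moreover have "real (m + l) = 2 * real K" using m3(2,3) by linarith
        then have "real K + (- 1) \<le> real (m + l) / 2 - \<delta>" using \<delta> by argo
        ultimately show ?thesis by blast
      qed
      then show ?thesis using F.count_if by blast
    qed
    have "\<Omega> = (\<Union>e\<in>E. F e)" using 2 unfolding loop_exception_def F_def by blast
    then have "card \<Omega> \<le> (\<Sum>e\<in>E. card (F e))" using card_UN_le[OF finite_E, of F] by simp
    then have "real (card \<Omega>) \<le> real (\<Sum>e\<in>E. card (F e))" by (simp only: of_nat_le_iff)
    also have "\<dots> = (\<Sum>e\<in>E. real (card (F e)))" by (rule of_nat_sum)
    also have "\<dots> \<le> real (card E) * ?R" by (rule sum_bounded_above[OF F])
    finally show ?thesis unfolding card_E .
  qed
qed

end

context two_circles
begin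

definition rest_configs :: "nat \<Rightarrow> ((nat \<times> nat) \<times> (nat \<times> nat)) set \<Rightarrow> (nat \<times> nat \<Rightarrow> nat) set" where
  "rest_configs n r = {x \<in> E \<rightarrow>\<^sub>E {1..n}. contributing r x \<and> (\<forall>e. \<not> cancelling r x e) \<and> \<not> main_config r x}"

text \<open>The configurations are sorted by their patterns \<beta>, whose number depends on
  \<open>m\<close> and \<open>l\<close> only. Taking the patterns as extensional functions makes
  them finitely many.\<close>

lemma card_rest_configs:
  assumes n: "n \<ge> 1" and equiv: "equiv (pairs n) r"
    and tr: "\<And>p q. (p, q) \<in> pairs n \<Longrightarrow> ((p, q), (q, p)) \<in> r"
    and C: "C \<ge> 1" and T: "real (card (bad_triples n r)) \<le> C * real n powr (2 - \<delta>)"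
    and \<delta>: "0 < \<delta>" "\<delta> \<le> 1 / 2"
  shows "real (card (rest_configs n r)) \<le>
    real (card (E \<rightarrow>\<^sub>E Pow E)) * (real (m + l) * (C * real n powr (real (m + l) / 2 - \<delta>) * real (alpha2 n r) ^ (m + l)))"
    (is "_ \<le> _ * ?R")
proof -
  let ?P = "E \<rightarrow>\<^sub>E Pow E"
  define F where "F \<beta> = {x \<in> rest_configs n r. \<forall>e\<in>E. \<beta> e = cls r x e}" for \<beta> :: "nat \<times> nat \<Rightarrow> (nat \<times> nat) set"
  have R0: "?R \<ge> 0" using C by simp
  have finP: "finite ?P" by (intro finite_PiE) auto
  have "rest_configs n r = (\<Union>\<beta>\<in>?P. F \<beta>)"
  proof -
    have "\<exists>\<beta>\<in>?P. x \<in> F \<beta>" if "x \<in> rest_configs n r" for x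
      by (intro bexI[of _ "restrict (cls r x) E"]) (use that in \<open>auto simp: F_def cls_def\<close>)
    then show ?thesis by (auto simp: F_def)
  qed
  then have "card (rest_configs n r) \<le> (\<Sum>\<beta>\<in>?P. card (F \<beta>))" using card_UN_le[OF finP, of F] by simp
  then have "real (card (rest_configs n r)) \<le> real (\<Sum>\<beta>\<in>?P. card (F \<beta>))" by (simp only: of_nat_le_iff)
  also have "\<dots> = (\<Sum>\<beta>\<in>?P. real (card (F \<beta>)))" by (rule of_nat_sum)
  also have "\<dots> \<le> (\<Sum>\<beta>\<in>?P. ?R)"
  proof (rule sum_mono)
    fix \<beta> assume "\<beta> \<in> ?P"
    show "real (card (F \<beta>)) \<le> ?R"
    proof (cases "F \<beta> = {}")
      case True
      then show ?thesis using R0 by simp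
    next
      case False
      then obtain x0 where x0: "x0 \<in> F \<beta>" by blast
      have selfr: "(ed x e, ed x e) \<in> r" if "x \<in> E \<rightarrow>\<^sub>E {1..n}" "e \<in> E" for x e
      proof -
        have "ed x e \<in> pairs n" using that nx_in_E[OF that(2)] by (auto simp: ed_def)
        then show ?thesis using equiv by (auto simp: equiv_def refl_on_def)
      qed
      have lab: "((x e, x (nx e)), (x f, x (nx f))) \<in> r"
        if "x \<in> F \<beta>" "e \<in> E" "f \<in> E" "\<beta> e = \<beta> f" for x e f
      proof -
        have "x \<in> E \<rightarrow>\<^sub>E {1..n}" using that(1) by (auto simp: F_def rest_configs_def)
        from selfr[OF this that(3)] have "f \<in> cls r x f" using that(3) by (simp add: cls_def)
        then have "f \<in> cls r x e" using that by (auto simp: F_def)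
        then show ?thesis by (simp add: cls_def ed_def)
      qed
      have "\<exists>e\<in>circ 1. \<exists>f\<in>circ 2. \<beta> e = \<beta> f"
      proof -
        obtain e f where ef: "e \<in> circ 1" "f \<in> circ 2" "(ed x0 e, ed x0 f) \<in> r"
          using x0 by (auto simp: F_def rest_configs_def contributing_def)
        have "(ed x0 f, ed x0 e) \<in> r" using ef(3) equiv by (auto simp: equiv_def dest: symD)
        then have "cls r x0 e = cls r x0 f" using ef(3) equiv
          unfolding cls_def equiv_def by (auto dest: transD)
        moreover have "e \<in> E" "f \<in> E" using ef by (auto simp: E_def)
        moreover have "\<forall>e\<in>E. \<beta> e = cls r x0 e" using x0 unfolding F_def by blast
        ultimately have "\<beta> e = \<beta> f" by metis
        then show ?thesis using ef(1,2) by blast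
      qed
      then interpret F: labelled_configs m l n r \<beta> "F \<beta>" C
        using finite_E nx_in_E n C equiv lab False tr x0
        by unfold_locales (auto simp: F_def rest_configs_def contributing_def)
      show ?thesis
        by (rule F.card_Omega_le[OF _ _ T \<delta>]) (auto simp: F_def rest_configs_def)
    qed
  qed
  also have "\<dots> = real (card ?P) * ?R" by simp
  finally show ?thesis .
qed

end

section \<open>Joint moments of the entries\<close>

text \<open>A product is bounded by a power of its largest factor. This replaces Hoelder's
  inequality, both for integrability and for uniform bounds in terms of absolute moments.\<close>

lemma norm_prod_le_sum_power:
  fixes z :: "'i \<Rightarrow> complex"
  assumes "finite F"
  shows "cmod (\<Prod>e\<in>F. z e) \<le> 1 + (\<Sum>e\<in>F. cmod (z e) ^ card F)"
proof (cases "F = {}")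
  case False
  let ?M = "Max ((\<lambda>e. cmod (z e)) ` F)"
  have "?M \<in> (\<lambda>e. cmod (z e)) ` F" using assms False by (intro Max_in) auto
  then obtain e where e: "e \<in> F" "?M = cmod (z e)" by blast
  have "cmod (\<Prod>e\<in>F. z e) = (\<Prod>e\<in>F. cmod (z e))" by (simp add: prod_norm)
  also have "\<dots> \<le> (\<Prod>e\<in>F. ?M)" using assms by (intro prod_mono) auto
  also have "\<dots> = cmod (z e) ^ card F" by (simp add: e(2))
  also have "\<dots> \<le> (\<Sum>e\<in>F. cmod (z e) ^ card F)"
    using assms e(1) by (intro member_le_sum) auto
  finally show ?thesis by simp
qed simp

locale entry_model = prob_space M
  for M :: "'w measure" +
  fixes n :: nat and r :: "((nat \<times> nat) \<times> (nat \<times> nat)) set"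
    and a :: "nat \<times> nat \<Rightarrow> 'w \<Rightarrow> complex" and s :: real
  assumes n_pos: "n \<ge> 1" and equiv_r: "equiv (pairs n) r"
    and r_transpose: "\<And>p q. (p, q) \<in> pairs n \<Longrightarrow> ((p, q), (q, p)) \<in> r"
    and measurable_a: "\<And>P. P \<in> pairs n \<Longrightarrow> a P \<in> borel_measurable M"
    and hermitian_a: "\<And>p q \<omega>. (p, q) \<in> pairs n \<Longrightarrow> \<omega> \<in> space M \<Longrightarrow> a (p, q) \<omega> = cnj (a (q, p) \<omega>)"
    and indep_a: "indep_classes n M r a"
    and centered_a: "\<And>P. P \<in> pairs n \<Longrightarrow> (\<integral>\<omega>. a P \<omega> \<partial>M) = 0"
    and integrable_power: "\<And>P k. P \<in> pairs n \<Longrightarrow> integrable M (\<lambda>\<omega>. cmod (a P \<omega>) ^ k)"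
    and variance_a: "\<And>p q. (p, q) \<in> pairs n \<Longrightarrow> p \<noteq> q \<Longrightarrow> (\<integral>\<omega>. (cmod (a (p, q) \<omega>))\<^sup>2 \<partial>M) = s\<^sup>2"
begin

definition mom :: "'i set \<Rightarrow> ('i \<Rightarrow> nat \<times> nat) \<Rightarrow> complex" where
  "mom F Y = (\<integral>\<omega>. (\<Prod>e\<in>F. a (Y e) \<omega>) \<partial>M)"

lemma mom_empty [simp]: "mom {} Y = 1"
  by (simp add: mom_def prob_space)

lemma integrable_sum_power:
  assumes "finite F" "Y ` F \<subseteq> pairs n"
  shows "integrable M (\<lambda>\<omega>. 1 + (\<Sum>e\<in>F. cmod (a (Y e) \<omega>) ^ k))"
  using assms by (intro Bochner_Integration.integrable_add Bochner_Integration.integrable_sum integrable_power) auto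

lemma integrable_prod:
  assumes F: "finite F" "Y ` F \<subseteq> pairs n"
  shows "integrable M (\<lambda>\<omega>. \<Prod>e\<in>F. a (Y e) \<omega>)"
proof (rule Bochner_Integration.integrable_bound[OF integrable_sum_power[OF F, of "card F"]])
  show "(\<lambda>\<omega>. \<Prod>e\<in>F. a (Y e) \<omega>) \<in> borel_measurable M"
    using F measurable_a by (intro borel_measurable_prod) auto
  show "AE \<omega> in M. norm (\<Prod>e\<in>F. a (Y e) \<omega>) \<le> norm (1 + (\<Sum>e\<in>F. cmod (a (Y e) \<omega>) ^ card F))"
  proof (rule AE_I2)
    fix \<omega>
    have "0 \<le> (\<Sum>e\<in>F. cmod (a (Y e) \<omega>) ^ card F)" by (intro sum_nonneg) auto
    then show "norm (\<Prod>e\<in>F. a (Y e) \<omega>) \<le> norm (1 + (\<Sum>e\<in>F. cmod (a (Y e) \<omega>) ^ card F))"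
      using norm_prod_le_sum_power[OF F(1), of "\<lambda>e. a (Y e) \<omega>"] by simp
  qed
qed

lemma norm_mom_le:
  assumes F: "finite F" "Y ` F \<subseteq> pairs n"
    and B: "\<And>P. P \<in> pairs n \<Longrightarrow> (\<integral>\<omega>. cmod (a P \<omega>) ^ card F \<partial>M) \<le> B"
  shows "cmod (mom F Y) \<le> 1 + real (card F) * B"
proof -
  have "cmod (mom F Y) \<le> (\<integral>\<omega>. cmod (\<Prod>e\<in>F. a (Y e) \<omega>) \<partial>M)"
    unfolding mom_def by (rule integral_norm_bound)
  also have "\<dots> \<le> (\<integral>\<omega>. 1 + (\<Sum>e\<in>F. cmod (a (Y e) \<omega>) ^ card F) \<partial>M)"
    by (rule integral_mono[OF integrable_norm[OF integrable_prod[OF F]] integrable_sum_power[OF F]])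
       (rule norm_prod_le_sum_power[OF F(1)])
  also have "\<dots> = 1 + (\<Sum>e\<in>F. \<integral>\<omega>. cmod (a (Y e) \<omega>) ^ card F \<partial>M)"
  proof -
    have int: "integrable M (\<lambda>\<omega>. cmod (a (Y e) \<omega>) ^ card F)" if "e \<in> F" for e
      using F(2) that by (intro integrable_power) auto
    then show ?thesis
      by (subst Bochner_Integration.integral_add)
         (simp_all add: prob_space Bochner_Integration.integral_sum[OF int])
  qed
  also have "\<dots> \<le> 1 + (\<Sum>e\<in>F. B)"
    using F B by (intro add_left_mono sum_mono) auto
  finally show ?thesis by simp
qed

text \<open>The product of the entries in one class is a measurable function of the random vector
  attached to that class, and these vectors are independent.\<close>

lemma mom_classes:
  assumes F: "finite F" "Y ` F \<subseteq> pairs n"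
  shows "mom F Y = (\<Prod>C\<in>pairs n // r. mom {e \<in> F. Y e \<in> C} Y)"
proof -
  let ?Q = "pairs n // r"
  have finQ: "finite ?Q" by (rule finite_quotient) (use equiv_r in \<open>auto simp: equiv_def refl_on_def\<close>)
  have QE: "?Q \<noteq> {}" using n_pos by (auto simp: quotient_def)
  define g where "g C v = (\<Prod>e\<in>{e \<in> F. Y e \<in> C}. v (Y e))" for C and v :: "nat \<times> nat \<Rightarrow> complex"
  define X where "X C \<omega> = (\<lambda>P\<in>C. a P \<omega>)" for C \<omega>
  have gX: "g C (X C \<omega>) = (\<Prod>e\<in>{e \<in> F. Y e \<in> C}. a (Y e) \<omega>)" for C \<omega>
    by (auto simp: g_def X_def intro!: prod.cong)
  have "indep_vars (\<lambda>_. borel) (\<lambda>C \<omega>. g C (X C \<omega>)) ?Q"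
  proof (rule indep_vars_compose2[where X = X and Y = g and M' = "\<lambda>C. Pi\<^sub>M C (\<lambda>_. borel)"])
    show "indep_vars (\<lambda>C. Pi\<^sub>M C (\<lambda>_. borel)) X ?Q"
      using indep_a unfolding indep_classes_def X_def .
    fix C
    show "g C \<in> borel_measurable (Pi\<^sub>M C (\<lambda>_. borel))"
      unfolding g_def by (intro borel_measurable_prod measurable_component_singleton) auto
  qed
  then have iv: "indep_vars (\<lambda>_. borel) (\<lambda>C \<omega>. \<Prod>e\<in>{e \<in> F. Y e \<in> C}. a (Y e) \<omega>) ?Q"
    by (simp add: gX)
  have "mom F Y = (\<integral>\<omega>. (\<Prod>C\<in>?Q. \<Prod>e\<in>{e \<in> F. Y e \<in> C}. a (Y e) \<omega>) \<partial>M)"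
    unfolding mom_def
  proof (rule arg_cong[of _ _ "integral\<^sup>L M"], rule ext)
    fix \<omega>
    have "(\<Prod>C\<in>?Q. \<Prod>e\<in>{e \<in> F. r `` {Y e} = C}. a (Y e) \<omega>) = (\<Prod>e\<in>F. a (Y e) \<omega>)"
      by (rule prod.group[OF F(1) finQ]) (use F(2) in \<open>auto simp: quotient_def\<close>)
    moreover have "{e \<in> F. r `` {Y e} = C} = {e \<in> F. Y e \<in> C}" if C: "C \<in> ?Q" for C
    proof -
      have "r `` {P} = C \<longleftrightarrow> P \<in> C" if "P \<in> pairs n" for P
      proof -
        obtain c where c: "c \<in> pairs n" "C = r `` {c}" using C unfolding quotient_def by blast
        have "r `` {P} = C \<longleftrightarrow> (P, c) \<in> r" unfolding c(2) by (rule eq_equiv_class_iff[OF equiv_r that c(1)])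
        moreover have "(P, c) \<in> r \<longleftrightarrow> P \<in> C" using equiv_r c(2) by (auto simp: equiv_def dest: symD)
        ultimately show ?thesis by simp
      qed
      moreover have "Y e \<in> pairs n" if "e \<in> F" for e using F(2) that by blast
      ultimately show ?thesis by blast
    qed
    ultimately show "(\<Prod>e\<in>F. a (Y e) \<omega>) = (\<Prod>C\<in>?Q. \<Prod>e\<in>{e \<in> F. Y e \<in> C}. a (Y e) \<omega>)" by simp
  qed
  also have "\<dots> = (\<Prod>C\<in>?Q. \<integral>\<omega>. (\<Prod>e\<in>{e \<in> F. Y e \<in> C}. a (Y e) \<omega>) \<partial>M)"
    by (rule indep_vars_lebesgue_integral[OF finQ iv]) (use F in \<open>auto intro!: integrable_prod\<close>)
  finally show ?thesis by (simp add: mom_def)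
qed

text \<open>No class meets both parts, so every factor in \<open>mom_classes\<close> belongs to one
  of them.\<close>

lemma mom_split:
  assumes F: "finite F" "Y ` F \<subseteq> pairs n" and F12: "F = F1 \<union> F2" "F1 \<inter> F2 = {}"
    and unrelated: "\<And>e f. e \<in> F1 \<Longrightarrow> f \<in> F2 \<Longrightarrow> (Y e, Y f) \<notin> r"
  shows "mom F Y = mom F1 Y * mom F2 Y"
proof -
  have "mom {e \<in> F. Y e \<in> C} Y = mom {e \<in> F1. Y e \<in> C} Y * mom {e \<in> F2. Y e \<in> C} Y"
    if C: "C \<in> pairs n // r" for C
  proof -
    have "{e \<in> F1. Y e \<in> C} = {} \<or> {e \<in> F2. Y e \<in> C} = {}"
      using unrelated quotient_eq_iff[OF equiv_r C C] by blast
    then show ?thesis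
    proof
      assume "{e \<in> F1. Y e \<in> C} = {}"
      moreover from this have "{e \<in> F. Y e \<in> C} = {e \<in> F2. Y e \<in> C}" using F12 by auto
      ultimately show ?thesis by (simp only: mom_empty mult_1_left)
    next
      assume "{e \<in> F2. Y e \<in> C} = {}"
      moreover from this have "{e \<in> F. Y e \<in> C} = {e \<in> F1. Y e \<in> C}" using F12 by auto
      ultimately show ?thesis by (simp only: mom_empty mult_1_right)
    qed
  qed
  moreover have "finite F1" "Y ` F1 \<subseteq> pairs n" "finite F2" "Y ` F2 \<subseteq> pairs n"
    using F F12 by auto
  ultimately show ?thesis
    using mom_classes[OF F] mom_classes[of F1 Y] mom_classes[of F2 Y] by (simp add: prod.distrib)
qed

lemma mom_singleton: "Y e \<in> pairs n \<Longrightarrow> mom {e} Y = 0"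
  using centered_a by (simp add: mom_def)

lemma mom_isolated:
  assumes F: "finite F" "Y ` F \<subseteq> pairs n" and e: "e \<in> F" "\<And>f. f \<in> F \<Longrightarrow> f \<noteq> e \<Longrightarrow> (Y e, Y f) \<notin> r"
  shows "mom F Y = 0"
proof -
  have "mom F Y = mom {e} Y * mom (F - {e}) Y"
    by (rule mom_split[OF F]) (use e in auto)
  then show ?thesis using mom_singleton[of Y e] F e(1) by auto
qed

lemma mom_edge_pair:
  assumes "e \<noteq> f" "Y e = (p, q)" "Y f = (q, p)" "(p, q) \<in> pairs n" "p \<noteq> q"
  shows "mom {e, f} Y = of_real (s\<^sup>2)"
proof -
  have "mom {e, f} Y = (\<integral>\<omega>. complex_of_real ((cmod (a (p, q) \<omega>))\<^sup>2) \<partial>M)"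
    unfolding mom_def
  proof (rule Bochner_Integration.integral_cong[OF refl])
    fix \<omega> assume "\<omega> \<in> space M"
    then have "a (q, p) \<omega> = cnj (a (p, q) \<omega>)" using hermitian_a[of q p \<omega>] assms(4) by auto
    then show "(\<Prod>e\<in>{e, f}. a (Y e) \<omega>) = complex_of_real ((cmod (a (p, q) \<omega>))\<^sup>2)"
      using assms(1-3) by (simp add: complex_norm_square[symmetric])
  qed
  also have "\<dots> = of_real (s\<^sup>2)" by (simp only: integral_complex_of_real variance_a[OF assms(4,5)])
  finally show ?thesis .
qed

end

section \<open>Chebyshev polynomials and closed walks\<close>

lemma sum_PiE_insert:
  fixes f :: "('i \<Rightarrow> 'a) \<Rightarrow> 'c::comm_monoid_add"
  assumes "v \<notin> I"
  shows "(\<Sum>x\<in>insert v I \<rightarrow>\<^sub>E T. f x) = (\<Sum>y\<in>T. \<Sum>x\<in>I \<rightarrow>\<^sub>E T. f (x(v := y)))"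
proof -
  have "(\<Sum>x\<in>insert v I \<rightarrow>\<^sub>E T. f x) = (\<Sum>(y, x)\<in>T \<times> (I \<rightarrow>\<^sub>E T). f (x(v := y)))"
    unfolding PiE_insert_eq
    by (subst sum.reindex[OF inj_combinator[OF assms]]) (auto intro!: sum.cong)
  then show ?thesis by (simp add: sum.cartesian_product)
qed

text \<open>Matchings of consecutive edges of the path with edges \<open>b, \<dots>, b + k - 1\<close>; the number \<open>i\<close>
  stands for the pair of edges \<open>i, i + 1\<close>.\<close>

definition path_matchings :: "nat \<Rightarrow> nat \<Rightarrow> nat set set" where
  "path_matchings b k = {S. \<forall>i\<in>S. b \<le> i \<and> Suc i < b + k \<and> Suc i \<notin> S}"

lemma path_matchings_sub: "S \<in> path_matchings b k \<Longrightarrow> S \<subseteq> {b..<b + k}"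
  by (force simp: path_matchings_def)

lemma finite_path_matchings [simp]: "finite (path_matchings b k)"
  by (rule finite_subset[of _ "Pow {b..<b + k}"]) (use path_matchings_sub in auto)

lemma path_matchings_finite: "S \<in> path_matchings b k \<Longrightarrow> finite S"
  by (rule finite_subset[OF path_matchings_sub]) simp_all

lemma path_matchings_0 [simp]: "path_matchings b 0 = {{}}"
  by (force simp: path_matchings_def)

lemma path_matchings_1 [simp]: "path_matchings b (Suc 0) = {{}}"
  by (force simp: path_matchings_def)

lemma path_matchings_rec:
  "path_matchings b (k + 2) = path_matchings b (k + 1) \<union> insert (b + k) ` path_matchings b k"
proof (intro equalityI subsetI)
  fix S assume S: "S \<in> path_matchings b (k + 2)"
  show "S \<in> path_matchings b (k + 1) \<union> insert (b + k) ` path_matchings b k"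
  proof (cases "b + k \<in> S")
    case True
    have "i < b + k \<and> Suc i \<noteq> b + k" if "i \<in> S" "i \<noteq> b + k" for i
    proof -
      have "Suc i < b + (k + 2)" "Suc i \<notin> S" using S that(1) unfolding path_matchings_def by blast+
      moreover from this have "Suc i \<noteq> b + k" using True by metis
      ultimately show ?thesis using that(2) by linarith
    qed
    then have "S - {b + k} \<in> path_matchings b k"
      using S by (force simp: path_matchings_def)
    moreover have "S = insert (b + k) (S - {b + k})" using True by blast
    ultimately show ?thesis by blast
  next
    case False
    have "Suc i < b + (k + 1)" if "i \<in> S" for i
    proof -
      have "Suc i < b + (k + 2)" using S that by (auto simp: path_matchings_def)
      moreover have "i \<noteq> b + k" using that False by blast
      ultimately show ?thesis by linarith
    qed
    then show ?thesis using S by (auto simp: path_matchings_def)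
  qed
next
  fix S assume "S \<in> path_matchings b (k + 1) \<union> insert (b + k) ` path_matchings b k"
  then show "S \<in> path_matchings b (k + 2)" by (force simp: path_matchings_def)
qed

definition path_weight :: "(nat \<Rightarrow> nat \<Rightarrow> complex) \<Rightarrow> complex \<Rightarrow> nat \<Rightarrow> nat \<Rightarrow> (nat \<Rightarrow> nat) \<Rightarrow> nat set \<Rightarrow> complex" where
  "path_weight A t b k x S = (\<Prod>i\<in>S. t * of_bool (x i = x (Suc (Suc i)))) *
     (\<Prod>e\<in>{b..<b + k} - (S \<union> Suc ` S). A (x e) (x (Suc e)))"

definition path_poly :: "(nat \<Rightarrow> nat \<Rightarrow> complex) \<Rightarrow> complex \<Rightarrow> nat \<Rightarrow> nat \<Rightarrow> (nat \<Rightarrow> nat) \<Rightarrow> complex" where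
  "path_poly A t b k x = (\<Sum>S\<in>path_matchings b k. path_weight A t b k x S)"

lemma path_poly_0 [simp]: "path_poly A t b 0 x = 1"
  by (simp add: path_poly_def path_weight_def)

lemma path_poly_1 [simp]: "path_poly A t b (Suc 0) x = A (x b) (x (Suc b))"
  by (simp add: path_poly_def path_weight_def)

lemma path_poly_rec:
  "path_poly A t b (k + 2) x = path_poly A t b (k + 1) x * A (x (b + k + 1)) (x (b + k + 2)) +
     t * of_bool (x (b + k) = x (b + k + 2)) * path_poly A t b k x"
proof -
  have dis: "path_matchings b (k + 1) \<inter> insert (b + k) ` path_matchings b k = {}"
    by (force simp: path_matchings_def)
  have nin: "b + k \<notin> S" if "S \<in> path_matchings b k" for S
    using path_matchings_sub[OF that] by auto
  then have inj: "inj_on (insert (b + k)) (path_matchings b k)"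
    by (intro inj_onI) (metis Diff_insert_absorb)
  have 1: "path_weight A t b (k + 2) x S = path_weight A t b (k + 1) x S * A (x (b + k + 1)) (x (b + k + 2))"
    if S: "S \<in> path_matchings b (k + 1)" for S
  proof -
    have "{b..<b + (k + 2)} - (S \<union> Suc ` S) = insert (b + k + 1) ({b..<b + (k + 1)} - (S \<union> Suc ` S))"
      using S by (force simp: path_matchings_def)
    then show ?thesis by (simp add: path_weight_def)
  qed
  have 2: "path_weight A t b (k + 2) x (insert (b + k) S) =
      t * of_bool (x (b + k) = x (b + k + 2)) * path_weight A t b k x S" if S: "S \<in> path_matchings b k" for S
  proof -
    have "{b..<b + (k + 2)} - (insert (b + k) S \<union> Suc ` insert (b + k) S) = {b..<b + k} - (S \<union> Suc ` S)"
      by auto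
    then show ?thesis using nin[OF S] path_matchings_finite[OF S] by (simp add: path_weight_def)
  qed
  have "path_poly A t b (k + 2) x = (\<Sum>S\<in>path_matchings b (k + 1). path_weight A t b (k + 2) x S) +
      (\<Sum>S\<in>path_matchings b k. path_weight A t b (k + 2) x (insert (b + k) S))"
    unfolding path_poly_def path_matchings_rec
    by (subst sum.union_disjoint) (use dis in \<open>simp_all add: sum.reindex[OF inj] del: add_Suc_right add_2_eq_Suc add_2_eq_Suc'\<close>)
  also have "\<dots> = path_poly A t b (k + 1) x * A (x (b + k + 1)) (x (b + k + 2)) +
     t * of_bool (x (b + k) = x (b + k + 2)) * path_poly A t b k x"
    unfolding path_poly_def sum_distrib_left sum_distrib_right
    by (intro arg_cong2[of _ _ _ _ "(+)"] sum.cong refl 1 2)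
  finally show ?thesis .
qed

lemma path_weight_cong:
  assumes "\<And>i. b \<le> i \<Longrightarrow> i \<le> b + k \<Longrightarrow> x i = y i" and S: "S \<in> path_matchings b k"
  shows "path_weight A t b k x S = path_weight A t b k y S"
proof -
  have "b \<le> i \<and> Suc i < b + k" if "i \<in> S" for i using S that by (auto simp: path_matchings_def)
  then show ?thesis unfolding path_weight_def using assms(1)
    by (intro arg_cong2[of _ _ _ _ "(*)"] prod.cong) force+
qed

lemma path_poly_cong:
  assumes "\<And>i. b \<le> i \<Longrightarrow> i \<le> b + k \<Longrightarrow> x i = y i"
  shows "path_poly A t b k x = path_poly A t b k y"
  unfolding path_poly_def by (intro sum.cong refl path_weight_cong assms)

text \<open>Up to normalisation, the entry \<open>(p, q)\<close> of \<open>cheb_snd s k\<close>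
  evaluated at the matrix. The first vertex \<open>b\<close> is variable because a matching of the
  cycle that uses the pair across position zero leaves a path starting at one.\<close>

definition path_sum :: "nat \<Rightarrow> (nat \<Rightarrow> nat \<Rightarrow> complex) \<Rightarrow> complex \<Rightarrow> nat \<Rightarrow> nat \<Rightarrow> nat \<Rightarrow> nat \<Rightarrow> complex" where
  "path_sum n A t b k p q =
     (\<Sum>x\<in>{b..b + k} \<rightarrow>\<^sub>E {1..n}. of_bool (x b = p) * of_bool (x (b + k) = q) * path_poly A t b k x)"

lemma sum_of_bool_mult_eq:
  fixes f :: "'a \<Rightarrow> 'c::semiring_1"
  assumes "finite I" "q \<in> I"
  shows "(\<Sum>y\<in>I. of_bool (y = q) * f y) = f q" "(\<Sum>y\<in>I. of_bool (q = y) * f y) = f q"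
proof -
  have "(\<Sum>y\<in>I. of_bool (y = q) * f y) = (\<Sum>y\<in>I. if y = q then f y else 0)"
    by (intro sum.cong) auto
  then show "(\<Sum>y\<in>I. of_bool (y = q) * f y) = f q" using assms by simp
  then show "(\<Sum>y\<in>I. of_bool (q = y) * f y) = f q" by (simp only: eq_commute[of q])
qed

lemma path_sum_0:
  assumes "p \<in> {1..n}" shows "path_sum n A t b 0 p q = of_bool (p = q)"
proof -
  have "path_sum n A t b 0 p q = (\<Sum>x\<in>insert b {} \<rightarrow>\<^sub>E {1..n}. of_bool (x b = p) * of_bool (x b = q))"
    by (simp add: path_sum_def)
  also have "\<dots> = (\<Sum>y\<in>{1..n}. of_bool (y = p) * of_bool (y = q))"
    by (subst sum_PiE_insert) simp_all
  also have "\<dots> = of_bool (p = q)" using assms by (intro sum_of_bool_mult_eq) auto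
  finally show ?thesis .
qed

lemma path_sum_1:
  assumes "p \<in> {1..n}" "q \<in> {1..n}" shows "path_sum n A t b (Suc 0) p q = A p q"
proof -
  have "{b..b + Suc 0} = insert (Suc b) (insert b {})" by auto
  then have "path_sum n A t b (Suc 0) p q =
     (\<Sum>x\<in>insert (Suc b) (insert b {}) \<rightarrow>\<^sub>E {1..n}. of_bool (x b = p) * of_bool (x (Suc b) = q) * A (x b) (x (Suc b)))"
    by (simp add: path_sum_def)
  also have "\<dots> = (\<Sum>y\<in>{1..n}. \<Sum>z\<in>{1..n}. of_bool (z = p) * of_bool (y = q) * A z y)"
    by (subst sum_PiE_insert, simp)+ simp
  also have "\<dots> = (\<Sum>y\<in>{1..n}. of_bool (y = q) * (\<Sum>z\<in>{1..n}. of_bool (z = p) * A z y))"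
    unfolding sum_distrib_left by (simp only: mult_ac)
  also have "\<dots> = A p q" using assms by (simp add: sum_of_bool_mult_eq)
  finally show ?thesis .
qed

text \<open>If the last two edges are matched, the vertex \<open>b + k + 1\<close> between them
  occurs in no factor, and summation over it gives \<open>of_nat n\<close>.\<close>

lemma path_sum_rec:
  assumes q: "q \<in> {1..n}"
  shows "path_sum n A t b (k + 2) p q =
    (\<Sum>u\<in>{1..n}. path_sum n A t b (k + 1) p u * A u q) + t * of_nat n * path_sum n A t b k p q"
proof -
  let ?I = "\<lambda>k. {b..b + k} \<rightarrow>\<^sub>E {1..n}"
  have ins: "{b..b + (k + 2)} = insert (b + k + 2) {b..b + (k + 1)}"
    "{b..b + (k + 1)} = insert (b + k + 1) {b..b + k}" by auto
  have "path_sum n A t b (k + 2) p q = (\<Sum>y\<in>{1..n}. \<Sum>x\<in>?I (k + 1). of_bool (x b = p) * of_bool (y = q) *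
      path_poly A t b (k + 2) (x(b + k + 2 := y)))"
    unfolding path_sum_def ins(1)
    by (subst sum_PiE_insert) (auto intro!: sum.cong)
  also have "\<dots> = (\<Sum>y\<in>{1..n}. of_bool (y = q) * (\<Sum>x\<in>?I (k + 1). of_bool (x b = p) *
      path_poly A t b (k + 2) (x(b + k + 2 := y))))"
    by (simp add: sum_distrib_left mult_ac)
  also have "\<dots> = (\<Sum>x\<in>?I (k + 1). of_bool (x b = p) * path_poly A t b (k + 2) (x(b + k + 2 := q)))"
    by (rule sum_of_bool_mult_eq) (use q in auto)
  also have "\<dots> = (\<Sum>x\<in>?I (k + 1). of_bool (x b = p) * path_poly A t b (k + 1) x * A (x (b + k + 1)) q) +
      t * (\<Sum>x\<in>?I (k + 1). of_bool (x b = p) * of_bool (x (b + k) = q) * path_poly A t b k x)"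
  proof -
    have "path_poly A t b (k + 2) (x(b + k + 2 := q)) = path_poly A t b (k + 1) x * A (x (b + k + 1)) q +
        t * of_bool (x (b + k) = q) * path_poly A t b k x" for x
    proof -
      have "path_poly A t b (k + 1) (x(b + k + 2 := q)) = path_poly A t b (k + 1) x"
        "path_poly A t b k (x(b + k + 2 := q)) = path_poly A t b k x"
        by (rule path_poly_cong, simp)+
      then show ?thesis by (subst path_poly_rec) simp
    qed
    then show ?thesis by (simp add: algebra_simps sum.distrib sum_distrib_left del: add_2_eq_Suc')
  qed
  also have "(\<Sum>x\<in>?I (k + 1). of_bool (x b = p) * path_poly A t b (k + 1) x * A (x (b + k + 1)) q) =
      (\<Sum>u\<in>{1..n}. path_sum n A t b (k + 1) p u * A u q)"
  proof -
    have "(\<Sum>x\<in>?I (k + 1). of_bool (x b = p) * path_poly A t b (k + 1) x * A (x (b + k + 1)) q) =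
      (\<Sum>x\<in>?I (k + 1). \<Sum>u\<in>{1..n}. of_bool (x (b + k + 1) = u) * (of_bool (x b = p) * path_poly A t b (k + 1) x * A u q))"
      by (intro sum.cong refl sum_of_bool_mult_eq(2)[symmetric]) auto
    also have "\<dots> = (\<Sum>u\<in>{1..n}. \<Sum>x\<in>?I (k + 1). of_bool (x (b + k + 1) = u) * (of_bool (x b = p) * path_poly A t b (k + 1) x * A u q))"
      by (rule sum.swap)
    also have "\<dots> = (\<Sum>u\<in>{1..n}. path_sum n A t b (k + 1) p u * A u q)"
      unfolding path_sum_def sum_distrib_right
      by (intro sum.cong refl) (simp add: mult_ac)
    finally show ?thesis .
  qed
  also have "(\<Sum>x\<in>?I (k + 1). of_bool (x b = p) * of_bool (x (b + k) = q) * path_poly A t b k x) =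
      of_nat n * path_sum n A t b k p q"
  proof -
    have pc: "path_poly A t b k (x(b + k + 1 := y)) = path_poly A t b k x" for x y
      by (rule path_poly_cong) simp
    show ?thesis unfolding path_sum_def ins(2)
      by (subst sum_PiE_insert) (simp_all add: pc del: One_nat_def)
  qed
  finally show ?thesis by (simp only: mult.assoc)
qed

text \<open>Rescaled Chebyshev polynomials of the second kind.\<close>

fun cheb_snd :: "real \<Rightarrow> nat \<Rightarrow> real poly" where
  "cheb_snd s 0 = 1"
| "cheb_snd s (Suc 0) = [:0, 1:]"
| "cheb_snd s (Suc (Suc k)) = pCons 0 (cheb_snd s (Suc k)) - Polynomial.smult (s\<^sup>2) (cheb_snd s k)"

lemma cheb_snd_monic: "degree (cheb_snd s k) = k \<and> coeff (cheb_snd s k) k = 1"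
proof (induction s k rule: cheb_snd.induct)
  case (3 s k)
  let ?P = "pCons 0 (cheb_snd s (Suc k))" let ?Q = "Polynomial.smult (s\<^sup>2) (cheb_snd s k)"
  have "cheb_snd s (Suc k) \<noteq> 0" using 3 by auto
  then have dP: "degree ?P = Suc (Suc k)" using 3 by simp
  have dQ: "degree ?Q \<le> k" using 3 degree_smult_le[of "s\<^sup>2" "cheb_snd s k"] by simp
  have "degree (?P - ?Q) = Suc (Suc k)"
    using dP dQ degree_add_eq_left[of "- ?Q" ?P] by simp
  moreover have "coeff (?P - ?Q) (Suc (Suc k)) = 1" using 3 by (simp add: coeff_eq_0)
  ultimately show ?case by simp
qed simp_all

lemma cheb_snd_scale:
  assumes "s \<noteq> 0"
  shows "poly (cheb_snd s k) x = s ^ k * poly (cheb_snd 1 k) (x / s)"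
proof (induction k rule: induct_nat_012)
  case (ge2 k)
  then show ?case using assms by (simp add: field_simps power2_eq_square)
qed (use assms in simp_all)

text \<open>Both sides satisfy the same three-term recursion with the factor
  \<open>2 * cos \<theta>\<close>, so the two initial values decide.\<close>

lemma cheb_snd_diff_cos:
  "poly (cheb_snd 1 (k + 2)) (2 * cos \<theta>) - poly (cheb_snd 1 k) (2 * cos \<theta>) = 2 * cos (real (k + 2) * \<theta>)"
proof (induction k rule: induct_nat_012)
  case 0
  show ?case using cos_double_cos[of \<theta>] by (simp add: power2_eq_square algebra_simps)
next
  case 1
  have "cos (3 * \<theta>) = 4 * cos \<theta> ^ 3 - 3 * cos \<theta>" by (rule cos_treble_cos)
  then show ?case by (simp add: algebra_simps power3_eq_cube eval_nat_numeral)
next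
  case (ge2 k)
  have "cos (real (Suc (Suc k) + 2) * \<theta>) + cos (real (k + 2) * \<theta>) = 2 * cos \<theta> * cos (real (Suc k + 2) * \<theta>)"
    using cos_add[of "real (Suc k + 2) * \<theta>" \<theta>] cos_diff[of "real (Suc k + 2) * \<theta>" \<theta>]
    by (simp add: algebra_simps)
  moreover have "poly (cheb_snd 1 (Suc (Suc k) + 2)) (2 * cos \<theta>) - poly (cheb_snd 1 (Suc (Suc k))) (2 * cos \<theta>)
     = 2 * cos \<theta> * (poly (cheb_snd 1 (Suc k + 2)) (2 * cos \<theta>) - poly (cheb_snd 1 (Suc k)) (2 * cos \<theta>))
       - (poly (cheb_snd 1 (k + 2)) (2 * cos \<theta>) - poly (cheb_snd 1 k) (2 * cos \<theta>))"
    by (simp add: algebra_simps)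
  ultimately show ?case using ge2 by (simp add: algebra_simps)
qed

text \<open>The first kind is a difference of polynomials of the second kind. Degree one is set
  apart because \<open>m - 2\<close> would be cut off to zero and \<open>s\<^sup>2\<close> would be
  subtracted wrongly.\<close>

definition cheb_fst :: "real \<Rightarrow> nat \<Rightarrow> real poly" where
  "cheb_fst s m = (if m = 1 then [:0, 1:] else cheb_snd s m - Polynomial.smult (s\<^sup>2) (cheb_snd s (m - 2)))"

lemma cheb_eq:
  assumes "m \<ge> 1" shows "cheb m = cheb_fst 1 m"
proof -
  have "lead_coeff (cheb_fst 1 m) = 1 \<and> (\<forall>\<theta>. poly (cheb_fst 1 m) (2 * cos \<theta>) = 2 * cos (real m * \<theta>))"
  proof (cases "m = 1")
    case False
    then obtain k where k: "m = k + 2" using assms by (metis add_2_eq_Suc' le_neq_implies_less less_imp_Suc_add add_Suc_shift plus_1_eq_Suc One_nat_def)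
    have "degree (cheb_snd 1 m - cheb_snd 1 k) = m"
      using degree_add_eq_left[of "- cheb_snd 1 k" "cheb_snd 1 m"] cheb_snd_monic[of 1 m] cheb_snd_monic[of 1 k] k by simp
    moreover have "coeff (cheb_snd 1 k) m = 0"
      by (rule coeff_eq_0) (use cheb_snd_monic[of 1 k] k in simp)
    then have "coeff (cheb_snd 1 m - cheb_snd 1 k) m = 1"
      using cheb_snd_monic[of 1 m] by simp
    moreover have "cheb_fst 1 m = cheb_snd 1 m - cheb_snd 1 k" using k by (simp add: cheb_fst_def)
    ultimately show ?thesis using cheb_snd_diff_cos[of k] k by (simp del: cheb_snd.simps add_2_eq_Suc')
  qed (simp add: cheb_fst_def)
  then show ?thesis unfolding cheb_def by (rule the1_equality[OF cheb_ex1[OF assms]])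
qed

lemma cheb_scaled_eq:
  assumes "m \<ge> 1" "s > 0" shows "cheb_scaled m s = cheb_fst s m"
proof -
  have "poly (cheb_scaled m s) = poly (cheb_fst s m)"
  proof
    fix x
    show "poly (cheb_scaled m s) x = poly (cheb_fst s m) x"
    proof (cases "m = 1")
      case True
      then show ?thesis using assms by (simp add: cheb_scaled_def cheb_eq cheb_fst_def poly_pcompose)
    next
      case False
      then have m: "2 + (m - 2) = m" using assms(1) by simp
      have "s\<^sup>2 * s ^ (m - 2) = s ^ m" by (simp only: power_add[symmetric] m)
      then show ?thesis using assms False cheb_snd_scale[of s m x] cheb_snd_scale[of s "m - 2" x]
        by (simp add: cheb_scaled_def cheb_eq cheb_fst_def poly_pcompose algebra_simps)
    qed
  qed
  then show ?thesis by (simp add: poly_eq_poly_eq_iff)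
qed

section \<open>Polynomials of the matrix and the expansion of the trace\<close>

definition mat_poly_entry :: "complex mat \<Rightarrow> real poly \<Rightarrow> nat \<Rightarrow> nat \<Rightarrow> complex" where
  "mat_poly_entry X P i j = (\<Sum>k\<le>degree P. of_real (coeff P k) * (X ^\<^sub>m k) $$ (i, j))"

lemma mat_poly_entry_upto:
  assumes "degree P \<le> N"
  shows "mat_poly_entry X P i j = (\<Sum>k\<le>N. of_real (coeff P k) * (X ^\<^sub>m k) $$ (i, j))"
  unfolding mat_poly_entry_def
  by (rule sum.mono_neutral_left) (use assms in \<open>auto simp: coeff_eq_0\<close>)

lemma mat_poly_entry_diff:
  "mat_poly_entry X (P - Polynomial.smult c Q) i j = mat_poly_entry X P i j - of_real c * mat_poly_entry X Q i j"
proof -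
  let ?N = "max (degree P) (degree Q)"
  have "degree (P - Polynomial.smult c Q) \<le> ?N"
    using degree_smult_le[of c Q] by (intro degree_diff_le) auto
  then show ?thesis
    by (subst (1 2 3) mat_poly_entry_upto[of _ ?N])
       (auto simp: sum_subtractf sum_distrib_left algebra_simps)
qed

lemma mat_poly_entry_pCons:
  assumes X: "X \<in> carrier_mat n n" and ij: "i < n" "j < n"
  shows "mat_poly_entry X (pCons 0 P) i j = (\<Sum>u<n. mat_poly_entry X P i u * X $$ (u, j))"
proof -
  have "mat_poly_entry X (pCons 0 P) i j = (\<Sum>k\<le>Suc (degree P). of_real (coeff (pCons 0 P) k) * (X ^\<^sub>m k) $$ (i, j))"
    by (rule mat_poly_entry_upto) (rule degree_pCons_le)
  also have "\<dots> = (\<Sum>k\<le>degree P. of_real (coeff P k) * (X ^\<^sub>m Suc k) $$ (i, j))"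
    by (subst sum.atMost_Suc_shift) simp
  also have "\<dots> = (\<Sum>k\<le>degree P. \<Sum>u<n. of_real (coeff P k) * (X ^\<^sub>m k) $$ (i, u) * X $$ (u, j))"
  proof (rule sum.cong[OF refl])
    fix k
    have Xk: "X ^\<^sub>m k \<in> carrier_mat n n" using X by (rule pow_carrier_mat)
    have "(X ^\<^sub>m Suc k) $$ (i, j) = (\<Sum>u<n. (X ^\<^sub>m k) $$ (i, u) * X $$ (u, j))"
      using Xk X ij by (simp add: scalar_prod_def atLeast0LessThan)
    then show "of_real (coeff P k) * (X ^\<^sub>m Suc k) $$ (i, j) =
      (\<Sum>u<n. of_real (coeff P k) * (X ^\<^sub>m k) $$ (i, u) * X $$ (u, j))"
      by (simp only: sum_distrib_left mult.assoc)
  qed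
  also have "\<dots> = (\<Sum>u<n. mat_poly_entry X P i u * X $$ (u, j))"
    unfolding mat_poly_entry_def sum_distrib_right by (rule sum.swap)
  finally show ?thesis .
qed

text \<open>Both sides satisfy the same recursion: the factor \<open>of_nat n\<close> that a matched
  pair produces in \<open>path_sum_rec\<close> is compensated by
  \<open>c\<^sup>2 * of_nat n = 1\<close>.\<close>

lemma mat_poly_entry_cheb_snd:
  assumes n: "n \<ge> 1" and ij: "i < n" "j < n"
    and X: "X = mat n n (\<lambda>(i, j). c * A (i + 1) (j + 1))" and c: "c\<^sup>2 * of_nat n = 1"
  shows "mat_poly_entry X (cheb_snd s k) i j = c ^ k * path_sum n A (- of_real (s\<^sup>2)) b k (i + 1) (j + 1)"
  using ij
proof (induction k arbitrary: j rule: induct_nat_012)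
  case 0
  have "X ^\<^sub>m 0 = 1\<^sub>m n" using X by simp
  then show ?case using 0 path_sum_0[of "i + 1" n A _ b "j + 1"] by (simp add: mat_poly_entry_def)
next
  case 1
  have XC: "X \<in> carrier_mat n n" using X by simp
  have "X ^\<^sub>m 1 = X" using XC by simp
  then show ?case using 1 path_sum_1[of "i + 1" n "j + 1" A _ b] X by (simp add: mat_poly_entry_def)
next
  case (ge2 k)
  let ?t = "- of_real (s\<^sup>2) :: complex"
  let ?S = "path_sum n A ?t b"
  have XC: "X \<in> carrier_mat n n" using X by simp
  have "mat_poly_entry X (cheb_snd s (Suc (Suc k))) i j =
    (\<Sum>u<n. mat_poly_entry X (cheb_snd s (Suc k)) i u * X $$ (u, j)) - of_real (s\<^sup>2) * mat_poly_entry X (cheb_snd s k) i j"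
    using mat_poly_entry_pCons[OF XC ge2.prems] by (simp add: mat_poly_entry_diff)
  also have "(\<Sum>u<n. mat_poly_entry X (cheb_snd s (Suc k)) i u * X $$ (u, j)) =
     (\<Sum>u<n. c ^ (k + 2) * (?S (k + 1) (i + 1) (u + 1) * A (u + 1) (j + 1)))"
    using ge2 X by (intro sum.cong refl) (simp add: power_add algebra_simps power2_eq_square)
  also have "\<dots> = c ^ (k + 2) * (\<Sum>u\<in>{1..n}. ?S (k + 1) (i + 1) u * A u (j + 1))"
  proof -
    have "(\<Sum>u\<in>{1..n}. ?S (k + 1) (i + 1) u * A u (j + 1)) = (\<Sum>u<n. ?S (k + 1) (i + 1) (u + 1) * A (u + 1) (j + 1))"
      by (rule sum.reindex_bij_witness[of _ "\<lambda>u. u + 1" "\<lambda>u. u - 1"]) auto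
    then show ?thesis by (simp only: sum_distrib_left)
  qed
  also have "of_real (s\<^sup>2) * mat_poly_entry X (cheb_snd s k) i j = c ^ (k + 2) * (of_real (s\<^sup>2) * of_nat n * ?S k (i + 1) (j + 1))"
  proof -
    have f1: "c ^ (k + 2) * of_nat n = c ^ k" unfolding power_add by (simp only: mult.assoc c mult_1_right)
    have f2: "c ^ (k + 2) * (of_real (s\<^sup>2) * of_nat n * ?S k (i + 1) (j + 1)) = of_real (s\<^sup>2) * ((c ^ (k + 2) * of_nat n) * ?S k (i + 1) (j + 1))"
      by (simp only: mult_ac)
    show ?thesis by (simp only: f2 f1 ge2.IH(1)[OF ge2.prems])
  qed
  finally have "mat_poly_entry X (cheb_snd s (Suc (Suc k))) i j =
     c ^ (k + 2) * ((\<Sum>u\<in>{1..n}. ?S (k + 1) (i + 1) u * A u (j + 1)) + ?t * of_nat n * ?S k (i + 1) (j + 1))"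
    by (simp only: distrib_left mult_minus_left mult_minus_right diff_conv_add_uminus)
  also have "\<dots> = c ^ (k + 2) * ?S (k + 2) (i + 1) (j + 1)"
    by (subst path_sum_rec) (use ge2.prems in auto)
  finally show ?case by simp
qed

text \<open>As for paths, \<open>i\<close> stands for the pair of edges \<open>i\<close> and
  \<open>i + 1\<close>, now modulo \<open>m\<close>. For \<open>m = 1\<close> only the empty set is
  left. For \<open>m = 2\<close> the pair of edges is counted twice, as \<open>0\<close> and as
  \<open>1\<close>, in agreement with the constant term \<open>- 2 * s\<^sup>2\<close> of the
  rescaled polynomial of degree two.\<close>

definition cycle_matchings :: "nat \<Rightarrow> nat set set" where
  "cycle_matchings m = {S. S \<subseteq> {..<m} \<and> (\<forall>i\<in>S. Suc i mod m \<notin> S)}"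

definition cycle_weight :: "(nat \<Rightarrow> nat \<Rightarrow> complex) \<Rightarrow> complex \<Rightarrow> nat \<Rightarrow> (nat \<Rightarrow> nat) \<Rightarrow> nat set \<Rightarrow> complex" where
  "cycle_weight A t m x S = (\<Prod>i\<in>S. t * of_bool (x i = x (Suc (Suc i mod m) mod m))) *
     (\<Prod>e\<in>{..<m} - (S \<union> (\<lambda>i. Suc i mod m) ` S). A (x e) (x (Suc e mod m)))"

text \<open>The pair across position zero, represented by \<open>m - 1\<close>, is either absent,
  which leaves a matching of the path, or present, which leaves the edges from \<open>1\<close> to
  \<open>m - 2\<close>.\<close>

lemma cycle_matchings_split:
  assumes m: "m \<ge> 1"
  shows "cycle_matchings m = path_matchings 0 m \<union> (if m \<ge> 2 then insert (m - 1) ` path_matchings 1 (m - 2) else {})"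
    (is "_ = _ \<union> ?R")
proof (intro equalityI subsetI)
  fix S assume S: "S \<in> cycle_matchings m"
  have S1: "i < m" "Suc i mod m \<notin> S" if "i \<in> S" for i
    using S that unfolding cycle_matchings_def by blast+
  show "S \<in> path_matchings 0 m \<union> ?R"
  proof (cases "m - 1 \<in> S")
    case False
    have "Suc i < m \<and> Suc i \<notin> S" if i: "i \<in> S" for i
    proof -
      have "i \<noteq> m - 1" using i False by metis
      then have "Suc i < m" using S1(1)[OF i] by linarith
      then show ?thesis using S1(2)[OF i] by simp
    qed
    then show ?thesis by (simp add: path_matchings_def)
  next
    case True
    have "Suc (m - 1) mod m = 0" using m by simp
    then have z: "0 \<notin> S" using S1(2)[OF True] by metis
    have m2: "m \<ge> 2"
    proof (rule ccontr)
      assume "\<not> m \<ge> 2"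
      then have "m - 1 = 0" by simp
      then show False using True z by metis
    qed
    have "1 \<le> i \<and> Suc i < 1 + (m - 2) \<and> Suc i \<notin> S" if i: "i \<in> S" "i \<noteq> m - 1" for i
    proof -
      have "i \<noteq> 0" using i(1) z by metis
      have "Suc i < m" using S1(1)[OF i(1)] i(2) by linarith
      then have n: "Suc i \<notin> S" using S1(2)[OF i(1)] by simp
      then have "Suc i \<noteq> m - 1" using True by metis
      then show ?thesis using n \<open>i \<noteq> 0\<close> \<open>Suc i < m\<close> m2 by simp
    qed
    then have "S - {m - 1} \<in> path_matchings 1 (m - 2)" unfolding path_matchings_def by blast
    moreover have "S = insert (m - 1) (S - {m - 1})" using True by blast
    ultimately have "S \<in> insert (m - 1) ` path_matchings 1 (m - 2)" by (rule image_eqI[rotated])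
    then show ?thesis using m2 by simp
  qed
next
  fix S assume "S \<in> path_matchings 0 m \<union> ?R"
  then consider "S \<in> path_matchings 0 m" | S' where "m \<ge> 2" "S = insert (m - 1) S'" "S' \<in> path_matchings 1 (m - 2)"
    by (cases "m \<ge> 2") auto
  then show "S \<in> cycle_matchings m"
  proof cases
    case 1
    have "i < m \<and> Suc i mod m \<notin> S" if "i \<in> S" for i
    proof -
      have "Suc i < m" "Suc i \<notin> S" using 1 that by (auto simp: path_matchings_def)
      then show ?thesis by simp
    qed
    then show ?thesis unfolding cycle_matchings_def by blast
  next
    case 2
    have S': "1 \<le> i" "Suc i < m - 1" "Suc i \<notin> S'" if "i \<in> S'" for i
    proof -
      have "1 \<le> i" "Suc i < 1 + (m - 2)" "Suc i \<notin> S'" using 2(3) that unfolding path_matchings_def by blast+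
      then show "1 \<le> i" "Suc i < m - 1" "Suc i \<notin> S'" using 2(1) by auto
    qed
    have "i < m \<and> Suc i mod m \<notin> S" if "i \<in> S" for i
    proof (cases "i = m - 1")
      case True
      have "Suc (m - 1) mod m = 0" using m by simp
      moreover have "0 \<notin> S" using 2(1,2) S'(1)[of 0] by auto
      ultimately show ?thesis using True m by simp
    next
      case False
      then have i: "i \<in> S'" using that 2(2) by simp
      then have "Suc i mod m = Suc i" using S'(2)[OF i] by simp
      then show ?thesis using S'(2,3)[OF i] 2(2) by simp
    qed
    then show ?thesis unfolding cycle_matchings_def by blast
  qed
qed

text \<open>If the pair across position zero is matched, the vertex \<open>0\<close> is free and
  gives the factor \<open>of_nat n\<close>, and the condition \<open>x 1 = x (m - 1)\<close> closes
  up the remaining path of length \<open>m - 2\<close>. The two summands are the traces of the two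
  terms in \<open>cheb_fst\<close>.\<close>

lemma cycle_sum_eq:
  assumes m: "m \<ge> 1"
  shows "(\<Sum>x\<in>{..<m} \<rightarrow>\<^sub>E {1..n}. \<Sum>S\<in>cycle_matchings m. cycle_weight A t m x S) =
    (\<Sum>p\<in>{1..n}. path_sum n A t 0 m p p) +
    (if m \<ge> 2 then t * of_nat n * (\<Sum>p\<in>{1..n}. path_sum n A t 1 (m - 2) p p) else 0)"
proof -
  let ?I = "{..<m} \<rightarrow>\<^sub>E {1..n}"
  let ?R = "if m \<ge> 2 then insert (m - 1) ` path_matchings 1 (m - 2) else {}"
  have closed: "(\<Sum>p\<in>{1..n}. path_sum n A t b k p p) =
     (\<Sum>x\<in>{b..b + k} \<rightarrow>\<^sub>E {1..n}. of_bool (x b = x (b + k)) * path_poly A t b k x)" for b k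
  proof -
    have "(\<Sum>p\<in>{1..n}. path_sum n A t b k p p) =
      (\<Sum>x\<in>{b..b + k} \<rightarrow>\<^sub>E {1..n}. \<Sum>p\<in>{1..n}. of_bool (x b = p) * (of_bool (x (b + k) = p) * path_poly A t b k x))"
      unfolding path_sum_def by (subst sum.swap) (simp only: mult.assoc)
    also have "\<dots> = (\<Sum>x\<in>{b..b + k} \<rightarrow>\<^sub>E {1..n}. of_bool (x (b + k) = x b) * path_poly A t b k x)"
      by (intro sum.cong refl sum_of_bool_mult_eq(2)) auto
    finally show ?thesis by (simp only: eq_commute)
  qed
  have nin: "m - 1 \<notin> S" if "S \<in> path_matchings 1 (m - 2)" "m \<ge> 2" for S
  proof
    assume "m - 1 \<in> S"
    then have "m - 1 < 1 + (m - 2)" using path_matchings_sub[OF that(1)] by auto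
    then show False using that(2) by linarith
  qed
  have dis: "path_matchings 0 m \<inter> ?R = {}" by (force simp: path_matchings_def)
  have part1: "(\<Sum>S\<in>path_matchings 0 m. cycle_weight A t m x S) = path_poly A t 0 m (x(m := x 0))" for x
    unfolding path_poly_def
  proof (rule sum.cong[OF refl])
    fix S assume S: "S \<in> path_matchings 0 m"
    let ?y = "x(m := x 0)"
    have i: "Suc i < m" if "i \<in> S" for i using S that by (auto simp: path_matchings_def)
    have y: "?y (Suc e) = x (Suc e mod m)" if "e < m" for e
    proof (cases "Suc e = m")
      case True
      then show ?thesis by simp
    next
      case False
      then have "Suc e < m" using that by simp
      then show ?thesis by simp
    qed
    have "(\<lambda>i. Suc i mod m) ` S = Suc ` S" using i by (intro image_cong) auto
    moreover have "(\<Prod>i\<in>S. t * of_bool (x i = x (Suc (Suc i mod m) mod m))) = (\<Prod>i\<in>S. t * of_bool (?y i = ?y (Suc (Suc i))))"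
    proof (rule prod.cong[OF refl])
      fix j assume j: "j \<in> S"
      have "?y (Suc (Suc j)) = x (Suc (Suc j) mod m)" by (rule y[OF i[OF j]])
      then show "t * of_bool (x j = x (Suc (Suc j mod m) mod m)) = t * of_bool (?y j = ?y (Suc (Suc j)))"
        using i[OF j] by simp
    qed
    moreover have "(\<Prod>e\<in>{..<m} - (S \<union> Suc ` S). A (x e) (x (Suc e mod m))) =
       (\<Prod>e\<in>{0..<0 + m} - (S \<union> Suc ` S). A (?y e) (?y (Suc e)))"
      by (rule prod.cong) (use y in \<open>auto simp: atLeast0LessThan\<close>)
    ultimately show "cycle_weight A t m x S = path_weight A t 0 m ?y S"
      by (simp add: cycle_weight_def path_weight_def)
  qed
  have part2: "(\<Sum>S\<in>?R. cycle_weight A t m x S) =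
      (if m \<ge> 2 then t * of_bool (x 1 = x (m - 1)) * path_poly A t 1 (m - 2) x else 0)" for x
  proof (cases "m \<ge> 2")
    case True
    have inj: "inj_on (insert (m - 1)) (path_matchings 1 (m - 2))"
      using nin[OF _ True] by (intro inj_onI) (metis Diff_insert_absorb)
    have cw: "cycle_weight A t m x (insert (m - 1) S) = t * of_bool (x 1 = x (m - 1)) * path_weight A t 1 (m - 2) x S"
      if S: "S \<in> path_matchings 1 (m - 2)" for S
    proof -
      have i: "1 \<le> i" "Suc i < m - 1" if "i \<in> S" for i using S that True by (auto simp: path_matchings_def)
      have "Suc i mod m = Suc i" "Suc (Suc i) mod m = Suc (Suc i)" if "i \<in> S" for i using i[OF that] by auto
      then have im: "(\<lambda>i. Suc i mod m) ` S = Suc ` S"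
        "(\<Prod>i\<in>S. t * of_bool (x i = x (Suc (Suc i mod m) mod m))) = (\<Prod>i\<in>S. t * of_bool (x i = x (Suc (Suc i))))"
        by (auto intro!: prod.cong image_cong)
      have last: "Suc (m - 1) mod m = 0" "Suc 0 mod m = 1" using True by auto
      have set: "{..<m} - (insert (m - 1) S \<union> (\<lambda>i. Suc i mod m) ` insert (m - 1) S) = {1..<1 + (m - 2)} - (S \<union> Suc ` S)"
        unfolding image_insert im(1) last using True by auto
      have "(\<Prod>e\<in>{1..<1 + (m - 2)} - (S \<union> Suc ` S). A (x e) (x (Suc e mod m))) =
         (\<Prod>e\<in>{1..<1 + (m - 2)} - (S \<union> Suc ` S). A (x e) (x (Suc e)))"
        by (rule prod.cong) (use True in auto)
      then have edges: "(\<Prod>e\<in>{..<m} - (insert (m - 1) S \<union> (\<lambda>i. Suc i mod m) ` insert (m - 1) S). A (x e) (x (Suc e mod m))) =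
         (\<Prod>e\<in>{1..<1 + (m - 2)} - (S \<union> Suc ` S). A (x e) (x (Suc e)))"
        unfolding set .
      have "(\<Prod>i\<in>insert (m - 1) S. t * of_bool (x i = x (Suc (Suc i mod m) mod m))) =
         t * of_bool (x (m - 1) = x 1) * (\<Prod>i\<in>S. t * of_bool (x i = x (Suc (Suc i))))"
        by (subst prod.insert[OF path_matchings_finite[OF S] nin[OF S True]]) (simp only: last im(2))
      then show ?thesis unfolding cycle_weight_def path_weight_def edges
        by (simp only: mult.assoc eq_commute[of "x (m - 1)" "x 1"])
    qed
    have "(\<Sum>S\<in>insert (m - 1) ` path_matchings 1 (m - 2). cycle_weight A t m x S) =
        (\<Sum>S\<in>path_matchings 1 (m - 2). t * of_bool (x 1 = x (m - 1)) * path_weight A t 1 (m - 2) x S)"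
      unfolding sum.reindex[OF inj] o_def by (rule sum.cong[OF refl cw])
    then show ?thesis unfolding if_P[OF True] path_poly_def sum_distrib_left .
  qed simp
  have "(\<Sum>x\<in>?I. \<Sum>S\<in>cycle_matchings m. cycle_weight A t m x S) =
     (\<Sum>x\<in>?I. path_poly A t 0 m (x(m := x 0))) +
     (\<Sum>x\<in>?I. if m \<ge> 2 then t * of_bool (x 1 = x (m - 1)) * path_poly A t 1 (m - 2) x else 0)"
    unfolding cycle_matchings_split[OF m] sum.distrib[symmetric] part1[symmetric] part2[symmetric]
    by (intro sum.cong refl sum.union_disjoint) (use dis in auto)
  also have "(\<Sum>x\<in>?I. path_poly A t 0 m (x(m := x 0))) = (\<Sum>p\<in>{1..n}. path_sum n A t 0 m p p)"
  proof -
    have ins: "{0..0 + m} = insert m {..<m}" by auto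
    have "(\<Sum>p\<in>{1..n}. path_sum n A t 0 m p p) =
      (\<Sum>y\<in>{1..n}. \<Sum>x\<in>?I. of_bool (x 0 = y) * path_poly A t 0 m (x(m := y)))"
      unfolding closed ins using m by (subst sum_PiE_insert) auto
    also have "\<dots> = (\<Sum>x\<in>?I. \<Sum>y\<in>{1..n}. of_bool (x 0 = y) * path_poly A t 0 m (x(m := y)))"
      by (rule sum.swap)
    also have "\<dots> = (\<Sum>x\<in>?I. path_poly A t 0 m (x(m := x 0)))"
    proof (rule sum.cong[OF refl])
      fix x assume "x \<in> ?I"
      moreover have "0 \<in> {..<m}" using m by simp
      ultimately have "x 0 \<in> {1..n}" by (rule PiE_mem)
      then show "(\<Sum>y\<in>{1..n}. of_bool (x 0 = y) * path_poly A t 0 m (x(m := y))) = path_poly A t 0 m (x(m := x 0))"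
        by (rule sum_of_bool_mult_eq(2)[OF finite_atLeastAtMost])
    qed
    finally show ?thesis by simp
  qed
  also have "(\<Sum>x\<in>?I. if m \<ge> 2 then t * of_bool (x 1 = x (m - 1)) * path_poly A t 1 (m - 2) x else 0) =
     (if m \<ge> 2 then t * of_nat n * (\<Sum>p\<in>{1..n}. path_sum n A t 1 (m - 2) p p) else 0)"
  proof (cases "m \<ge> 2")
    case True
    have ins: "{..<m} = insert 0 {1..1 + (m - 2)}" using True by auto
    have m1: "1 + (m - 2) = m - 1" using True by simp
    have pc: "path_poly A t 1 (m - 2) (x(0 := y)) = path_poly A t 1 (m - 2) x" for x y
      by (rule path_poly_cong) simp
    have "(\<Sum>x\<in>?I. t * of_bool (x 1 = x (m - 1)) * path_poly A t 1 (m - 2) x) =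
       (\<Sum>y\<in>{1..n}. \<Sum>x\<in>{1..1 + (m - 2)} \<rightarrow>\<^sub>E {1..n}. t * of_bool ((x(0 := y)) 1 = (x(0 := y)) (m - 1)) * path_poly A t 1 (m - 2) (x(0 := y)))"
      unfolding ins by (rule sum_PiE_insert) simp
    also have "\<dots> = (\<Sum>y\<in>{1..n}. \<Sum>x\<in>{1..1 + (m - 2)} \<rightarrow>\<^sub>E {1..n}. t * of_bool (x 1 = x (m - 1)) * path_poly A t 1 (m - 2) x)"
      unfolding pc using True by (intro sum.cong refl) auto
    also have "\<dots> = t * of_nat n * (\<Sum>p\<in>{1..n}. path_sum n A t 1 (m - 2) p p)"
      unfolding closed m1 by (simp add: sum_distrib_left mult_ac)
    finally show ?thesis using True by simp
  qed simp
  finally show ?thesis .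
qed

lemma trace_cheb_expansion:
  assumes n: "n \<ge> 1" and s: "s > 0" and m: "m \<ge> 1"
  shows "trace_cheb n a s m \<omega> = of_real (1 / sqrt (real n)) ^ m *
    (\<Sum>x\<in>{..<m} \<rightarrow>\<^sub>E {1..n}. \<Sum>S\<in>cycle_matchings m. cycle_weight (\<lambda>p q. a (p, q) \<omega>) (- of_real (s\<^sup>2)) m x S)"
proof -
  let ?X = "ensemble_mat n a \<omega>" let ?c = "complex_of_real (1 / sqrt (real n))"
  let ?A = "\<lambda>p q. a (p, q) \<omega>" let ?t = "- complex_of_real (s\<^sup>2)"
  have X: "?X = mat n n (\<lambda>(i, j). ?c * ?A (i + 1) (j + 1))" by (simp add: ensemble_mat_def)
  have c: "?c\<^sup>2 * of_nat n = 1"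
  proof -
    have "(1 / sqrt (real n))\<^sup>2 * real n = 1" using n by (simp add: power_divide)
    then have "complex_of_real ((1 / sqrt (real n))\<^sup>2 * real n) = 1" by (simp only: of_real_1)
    then show ?thesis by (simp only: of_real_mult of_real_power of_real_of_nat_eq)
  qed
  note E = mat_poly_entry_cheb_snd[OF n _ _ X c]
  have reidx: "(\<Sum>i<n. f (i + 1)) = (\<Sum>p\<in>{1..n}. f p)" for f :: "nat \<Rightarrow> complex"
    by (rule sum.reindex_bij_witness[of _ "\<lambda>u. u - 1" "\<lambda>u. u + 1"]) auto
  have "trace_cheb n a s m \<omega> = (\<Sum>i<n. mat_poly_entry ?X (cheb_fst s m) i i)"
    unfolding trace_cheb_def trace_mat_def poly_mat_def cheb_scaled_eq[OF m s] mat_poly_entry_def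
    by (auto simp: ensemble_mat_def coeff_map_poly degree_map_poly intro!: sum.cong)
  also have "\<dots> = ?c ^ m * ((\<Sum>p\<in>{1..n}. path_sum n ?A ?t 0 m p p) +
    (if m \<ge> 2 then ?t * of_nat n * (\<Sum>p\<in>{1..n}. path_sum n ?A ?t 1 (m - 2) p p) else 0))"
  proof (cases "m = 1")
    case True
    have "(\<Sum>i<n. mat_poly_entry ?X (cheb_fst s m) i i) = (\<Sum>i<n. ?c ^ 1 * path_sum n ?A ?t 0 1 (i + 1) (i + 1))"
      using E[of _ _ s 1 0] True by (intro sum.cong refl) (simp add: cheb_fst_def)
    also have "\<dots> = (\<Sum>p\<in>{1..n}. ?c ^ 1 * path_sum n ?A ?t 0 1 p p)" by (rule reidx)
    finally show ?thesis using True by (simp add: sum_distrib_left)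
  next
    case False
    then have m2: "m \<ge> 2" using m by simp
    have cm: "?c ^ (m - 2) = ?c ^ m * of_nat n"
    proof -
      have "?c ^ m = ?c ^ (m - 2) * ?c\<^sup>2" using m2 by (metis le_add_diff_inverse2 power_add)
      then show ?thesis using c by (simp only: mult.assoc mult_1_right)
    qed
    have ent: "mat_poly_entry ?X (cheb_fst s m) i i = ?c ^ m * path_sum n ?A ?t 0 m (i + 1) (i + 1)
        - of_real (s\<^sup>2) * (?c ^ (m - 2) * path_sum n ?A ?t 1 (m - 2) (i + 1) (i + 1))" if "i < n" for i
      unfolding cheb_fst_def if_not_P[OF False] mat_poly_entry_diff
      using E[OF that that, of s m 0] E[OF that that, of s "m - 2" 1] by simp
    have "(\<Sum>i<n. mat_poly_entry ?X (cheb_fst s m) i i) =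
      (\<Sum>i<n. ?c ^ m * path_sum n ?A ?t 0 m (i + 1) (i + 1) - of_real (s\<^sup>2) * (?c ^ (m - 2) * path_sum n ?A ?t 1 (m - 2) (i + 1) (i + 1)))"
      by (intro sum.cong refl ent) simp
    also have "\<dots> = (\<Sum>p\<in>{1..n}. ?c ^ m * path_sum n ?A ?t 0 m p p - of_real (s\<^sup>2) * (?c ^ (m - 2) * path_sum n ?A ?t 1 (m - 2) p p))"
      by (rule reidx)
    also have "\<dots> = ?c ^ m * (\<Sum>p\<in>{1..n}. path_sum n ?A ?t 0 m p p) - of_real (s\<^sup>2) * ?c ^ (m - 2) * (\<Sum>p\<in>{1..n}. path_sum n ?A ?t 1 (m - 2) p p)"
      unfolding sum_subtractf sum_distrib_left by (simp only: mult.assoc)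
    finally show ?thesis unfolding cm if_P[OF m2] by (simp only: ring_distribs mult_minus_left mult_minus_right mult_ac) simp
  qed
  finally show ?thesis unfolding cycle_sum_eq[OF m] .
qed

section \<open>The covariance as a sum over pairs of closed walks\<close>

locale covariance_model = entry_model M n r a s + two_circles m l
  for M :: "'w measure" and n r a s m l
begin

definition matchings :: "(nat \<times> nat) set set" where
  "matchings = {S. S \<subseteq> E \<and> (\<forall>e\<in>S. nx e \<notin> S)}"

definition free :: "(nat \<times> nat) set \<Rightarrow> (nat \<times> nat) set" where
  "free S = E - (S \<union> nx ` S)"

definition coef :: "(nat \<times> nat \<Rightarrow> nat) \<Rightarrow> (nat \<times> nat) set \<Rightarrow> complex" where
  "coef x S = (\<Prod>e\<in>S. - of_real (s\<^sup>2) * of_bool (x e = x (nx (nx e))))"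

text \<open>The covariance of the product of the entries of \<open>F\<close> on the first circle
  with the product of those on the second.\<close>

definition excess :: "(nat \<times> nat) set \<Rightarrow> (nat \<times> nat \<Rightarrow> nat) \<Rightarrow> complex" where
  "excess F x = mom F (ed x) - mom (F \<inter> circ 1) (ed x) * mom (F \<inter> circ 2) (ed x)"

definition contrib :: "(nat \<times> nat \<Rightarrow> nat) \<Rightarrow> (nat \<times> nat) set \<Rightarrow> complex" where
  "contrib x S = coef x S * excess (free S) x"

abbreviation configs :: "(nat \<times> nat \<Rightarrow> nat) set" where
  "configs \<equiv> E \<rightarrow>\<^sub>E {1..n}"

definition restr :: "nat \<Rightarrow> (nat \<times> nat \<Rightarrow> nat) \<Rightarrow> nat \<Rightarrow> nat" where
  "restr c x = (\<lambda>i\<in>{..<len c}. x (c, i))"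

definition part :: "nat \<Rightarrow> (nat \<times> nat) set \<Rightarrow> nat set" where
  "part c S = {i. (c, i) \<in> S}"

definition join_config :: "(nat \<Rightarrow> nat) \<Rightarrow> (nat \<Rightarrow> nat) \<Rightarrow> nat \<times> nat \<Rightarrow> nat" where
  "join_config x1 x2 = (\<lambda>e\<in>E. if fst e = 1 then x1 (snd e) else x2 (snd e))"

definition join_set :: "nat set \<Rightarrow> nat set \<Rightarrow> (nat \<times> nat) set" where
  "join_set S1 S2 = {e \<in> E. if fst e = 1 then snd e \<in> S1 else snd e \<in> S2}"

lemma finite_configs: "finite configs"
  by (intro finite_PiE) auto

lemma finite_matchings: "finite matchings"
  by (rule finite_subset[of _ "Pow E"]) (auto simp: matchings_def)

lemma ed_configs: "x \<in> configs \<Longrightarrow> F \<subseteq> E \<Longrightarrow> ed x ` F \<subseteq> pairs n"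
  using nx_in_E by (auto simp: ed_def)

lemma nx_Pair: "nx (c, i) = (c, Suc i mod len c)"
  by (simp add: nx_def)

lemma Pair_in_E: "c \<in> {1, 2} \<Longrightarrow> (c, i) \<in> E \<longleftrightarrow> i < len c"
  by (auto simp: E_iff)

lemma restr_mem: "c \<in> {1, 2} \<Longrightarrow> x \<in> configs \<Longrightarrow> restr c x \<in> {..<len c} \<rightarrow>\<^sub>E {1..n}"
proof (rule PiE_I)
  fix i assume a: "c \<in> {1, 2}" "x \<in> configs" "i \<in> {..<len c}"
  then have "(c, i) \<in> E" using Pair_in_E[OF a(1)] by simp
  then have "x (c, i) \<in> {1..n}" using a(2) by (rule PiE_mem[rotated])
  then show "restr c x i \<in> {1..n}" using a(3) by (simp add: restr_def)
qed (simp add: restr_def)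

lemma part_mem:
  assumes c: "c \<in> {1, 2}" and S: "S \<in> matchings"
  shows "part c S \<in> cycle_matchings (len c)"
proof -
  have "i < len c \<and> Suc i mod len c \<notin> part c S" if "i \<in> part c S" for i
  proof -
    have i: "(c, i) \<in> S" using that by (simp add: part_def)
    then have "(c, i) \<in> E" "nx (c, i) \<notin> S" using S unfolding matchings_def by blast+
    then show ?thesis using Pair_in_E[OF c] by (simp add: part_def nx_Pair)
  qed
  then show ?thesis unfolding cycle_matchings_def by blast
qed

text \<open>A walk and a matching on each circle amount to one placement and one matching on the
  disjoint union \<open>E\<close>.\<close>

lemma sum_product_join:
  fixes g1 g2 :: "(nat \<Rightarrow> nat) \<times> nat set \<Rightarrow> complex"
  shows "(\<Sum>j\<in>({..<m} \<rightarrow>\<^sub>E {1..n}) \<times> cycle_matchings m. g1 j) * (\<Sum>j\<in>({..<l} \<rightarrow>\<^sub>E {1..n}) \<times> cycle_matchings l. g2 j) =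
    (\<Sum>(x, S)\<in>configs \<times> matchings. g1 (restr 1 x, part 1 S) * g2 (restr 2 x, part 2 S))"
proof -
  have len12: "len 1 = m" "len 2 = l" by (simp_all add: len_def)
  let ?J1 = "({..<m} \<rightarrow>\<^sub>E {1..n}) \<times> cycle_matchings m" and ?J2 = "({..<l} \<rightarrow>\<^sub>E {1..n}) \<times> cycle_matchings l"
  have E12: "(1, i) \<in> E \<longleftrightarrow> i < m" "(2, i) \<in> E \<longleftrightarrow> i < l" for i
    using Pair_in_E[of 1 i] Pair_in_E[of 2 i] len12 by auto
  have bk: "restr 1 (join_config x1 x2) = x1 \<and> restr 2 (join_config x1 x2) = x2 \<and>
      part 1 (join_set S1 S2) = S1 \<and> part 2 (join_set S1 S2) = S2"
    if "((x1, S1), (x2, S2)) \<in> ?J1 \<times> ?J2" for x1 S1 x2 S2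
  proof -
    have x: "x1 \<in> {..<m} \<rightarrow>\<^sub>E {1..n}" "x2 \<in> {..<l} \<rightarrow>\<^sub>E {1..n}" "S1 \<subseteq> {..<m}" "S2 \<subseteq> {..<l}"
      using that by (auto simp: cycle_matchings_def)
    have "restr 1 (join_config x1 x2) = restrict x1 {..<m}" "restr 2 (join_config x1 x2) = restrict x2 {..<l}"
    proof -
      show "restr 1 (join_config x1 x2) = restrict x1 {..<m}"
        by (rule ext) (use E12(1) in \<open>simp add: restr_def join_config_def len_def restrict_def\<close>)
      show "restr 2 (join_config x1 x2) = restrict x2 {..<l}"
        by (rule ext) (use E12(2) in \<open>simp add: restr_def join_config_def len_def restrict_def\<close>)
    qed
    moreover have "restrict x1 {..<m} = x1" "restrict x2 {..<l} = x2" using x(1,2) PiE_restrict by blast+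
    moreover have "part 1 (join_set S1 S2) = S1" "part 2 (join_set S1 S2) = S2"
      using x(3,4) E12 by (auto simp: part_def join_set_def)
    ultimately show ?thesis by simp
  qed
  have "(\<Sum>j\<in>?J1. g1 j) * (\<Sum>j\<in>?J2. g2 j) = (\<Sum>(j1, j2)\<in>?J1 \<times> ?J2. g1 j1 * g2 j2)"
    by (simp only: sum_product sum.cartesian_product)
  also have "\<dots> = (\<Sum>(x, S)\<in>configs \<times> matchings. g1 (restr 1 x, part 1 S) * g2 (restr 2 x, part 2 S))"
  proof (rule sum.reindex_bij_witness[of _ "\<lambda>(x, S). ((restr 1 x, part 1 S), (restr 2 x, part 2 S))"
        "\<lambda>((x1, S1), (x2, S2)). (join_config x1 x2, join_set S1 S2)"], goal_cases)
    case (1 jj)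
    obtain x1 S1 x2 S2 where jj: "jj = ((x1, S1), (x2, S2))" by (metis surj_pair)
    show ?case using bk[OF 1[unfolded jj]] by (simp add: jj)
  next
    case (2 jj)
    obtain x1 S1 x2 S2 where jj: "jj = ((x1, S1), (x2, S2))" by (metis surj_pair)
    have x: "x1 \<in> {..<m} \<rightarrow>\<^sub>E {1..n}" "x2 \<in> {..<l} \<rightarrow>\<^sub>E {1..n}" and S: "S1 \<in> cycle_matchings m" "S2 \<in> cycle_matchings l"
      using 2 by (auto simp: jj)
    have "join_config x1 x2 e \<in> {1..n}" if e: "e \<in> E" for e
    proof (cases "fst e = 1")
      case True
      then have "snd e \<in> {..<m}" using e by (simp add: E_iff len_def)
      then have "x1 (snd e) \<in> {1..n}" using x(1) by (rule PiE_mem[rotated])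
      then show ?thesis using True e by (simp add: join_config_def)
    next
      case False
      then have "snd e \<in> {..<l}" using e by (simp add: E_iff len_def)
      then have "x2 (snd e) \<in> {1..n}" using x(2) by (rule PiE_mem[rotated])
      then show ?thesis using False e by (simp add: join_config_def)
    qed
    then have "join_config x1 x2 \<in> configs" by (intro PiE_I) (auto simp: join_config_def)
    moreover have "nx e \<notin> join_set S1 S2" if e: "e \<in> join_set S1 S2" for e
    proof (cases "fst e = 1")
      case True
      then have "snd e \<in> S1" using e by (simp add: join_set_def)
      then have "Suc (snd e) mod m \<notin> S1" using S(1) unfolding cycle_matchings_def by blast
      then show ?thesis using True by (simp add: join_set_def nx_def len_def)
    next
      case False
      then have "snd e \<in> S2" using e by (simp add: join_set_def)
      then have "Suc (snd e) mod l \<notin> S2" using S(2) unfolding cycle_matchings_def by blast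
      then show ?thesis using False by (simp add: join_set_def nx_def len_def)
    qed
    then have "join_set S1 S2 \<in> matchings" by (auto simp: matchings_def join_set_def)
    ultimately show ?case by (simp add: jj)
  next
    case (3 xS)
    obtain x S where xS: "xS = (x, S)" by (metis surj_pair)
    have x: "x \<in> configs" and S: "S \<subseteq> E" using 3 by (auto simp: xS matchings_def)
    have "join_config (restr 1 x) (restr 2 x) = restrict x E"
      by (auto simp: join_config_def restr_def fun_eq_iff E_iff)
    moreover have "restrict x E = x" using x PiE_restrict by blast
    moreover have "join_set (part 1 S) (part 2 S) = S"
      using S by (auto simp: join_set_def part_def) (auto simp: E_iff)
    ultimately show ?case by (simp add: xS)
  next
    case (4 xS)
    obtain x S where xS: "xS = (x, S)" by (metis surj_pair)
    have "x \<in> configs" "S \<in> matchings" using 4 by (auto simp: xS)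
    then have "restr 1 x \<in> {..<m} \<rightarrow>\<^sub>E {1..n}" "restr 2 x \<in> {..<l} \<rightarrow>\<^sub>E {1..n}"
      "part 1 S \<in> cycle_matchings m" "part 2 S \<in> cycle_matchings l"
      using restr_mem[of 1 x] restr_mem[of 2 x] part_mem[of 1 S] part_mem[of 2 S] unfolding len12 by blast+
    then show ?case unfolding xS prod.case by blast
  next
    case (5 xS)
    obtain x1 S1 x2 S2 where jj: "xS = ((x1, S1), (x2, S2))" by (metis surj_pair)
    show ?case using bk[OF 5[unfolded jj]] by (simp add: jj)
  qed
  finally show ?thesis .
qed

lemma cycle_weight_restr:
  assumes c: "c \<in> {1, 2}" and x: "x \<in> configs" and S: "S \<in> matchings"
  shows "cycle_weight A t (len c) (restr c x) (part c S) =
    (\<Prod>e\<in>S \<inter> circ c. t * of_bool (x e = x (nx (nx e)))) * (\<Prod>e\<in>free S \<inter> circ c. A (x e) (x (nx e)))"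
proof -
  have SE: "S \<subseteq> E" using S by (simp add: matchings_def)
  have L: "len c \<ge> 1" by (rule len_pos)
  have md: "Suc i mod len c < len c" for i using L by simp
  have inj: "inj_on (Pair c) X" for X by (auto simp: inj_on_def)
  have S1: "S \<inter> circ c = Pair c ` part c S"
    using SE by (auto simp: part_def circ_iff E_iff)
  have S2: "free S \<inter> circ c = Pair c ` ({..<len c} - (part c S \<union> (\<lambda>i. Suc i mod len c) ` part c S))"
  proof -
    have "(c, i) \<in> nx ` S \<longleftrightarrow> i \<in> (\<lambda>i. Suc i mod len c) ` part c S" for i
    proof
      assume "(c, i) \<in> nx ` S"
      then obtain d j where d: "(d, j) \<in> S" "(c, i) = nx (d, j)" by auto
      then have "d = c" "i = Suc j mod len c" by (auto simp: nx_Pair)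
      then show "i \<in> (\<lambda>i. Suc i mod len c) ` part c S" using d(1) by (auto simp: part_def)
    next
      assume "i \<in> (\<lambda>i. Suc i mod len c) ` part c S"
      then obtain j where "(c, j) \<in> S" "i = Suc j mod len c" by (auto simp: part_def)
      then show "(c, i) \<in> nx ` S" by (intro image_eqI[of _ _ "(c, j)"]) (auto simp: nx_Pair)
    qed
    then have "(c, i) \<in> free S \<longleftrightarrow> i < len c \<and> i \<notin> part c S \<and> i \<notin> (\<lambda>i. Suc i mod len c) ` part c S" for i
      by (auto simp: free_def part_def Pair_in_E[OF c])
    then show ?thesis by (auto simp: circ_def)
  qed
  have r: "restr c x i = x (c, i)" if "i < len c" for i using that by (simp add: restr_def)
  have lt: "i < len c" if "i \<in> part c S" for i using that SE Pair_in_E[OF c] by (auto simp: part_def)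
  have "(\<Prod>i\<in>part c S. t * of_bool (restr c x i = restr c x (Suc (Suc i mod len c) mod len c))) =
     (\<Prod>e\<in>S \<inter> circ c. t * of_bool (x e = x (nx (nx e))))"
    unfolding S1 prod.reindex[OF inj] o_def
    by (rule prod.cong[OF refl]) (simp add: nx_Pair r[OF lt] r[OF md])
  moreover have "(\<Prod>e\<in>{..<len c} - (part c S \<union> (\<lambda>i. Suc i mod len c) ` part c S). A (restr c x e) (restr c x (Suc e mod len c))) =
     (\<Prod>e\<in>free S \<inter> circ c. A (x e) (x (nx e)))"
    unfolding S2 prod.reindex[OF inj] o_def
    by (rule prod.cong[OF refl]) (simp add: nx_Pair r r[OF md])
  ultimately show ?thesis unfolding cycle_weight_def by (rule arg_cong2[of _ _ _ _ "(*)"])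
qed

definition weight :: "nat \<Rightarrow> (nat \<Rightarrow> nat) \<times> nat set \<Rightarrow> 'w \<Rightarrow> complex" where
  "weight k j \<omega> = cycle_weight (\<lambda>p q. a (p, q) \<omega>) (- of_real (s\<^sup>2)) k (fst j) (snd j)"

lemma integrable_weight:
  assumes "j \<in> ({..<k} \<rightarrow>\<^sub>E {1..n}) \<times> cycle_matchings k" "k \<ge> 1"
  shows "integrable M (weight k j)"
proof -
  have x: "fst j \<in> {..<k} \<rightarrow>\<^sub>E {1..n}" using assms(1) by (simp add: mem_Times_iff)
  have "integrable M (\<lambda>\<omega>. (\<Prod>i\<in>snd j. - of_real (s\<^sup>2) * of_bool (fst j i = fst j (Suc (Suc i mod k) mod k))) *
     (\<Prod>e\<in>{..<k} - (snd j \<union> (\<lambda>i. Suc i mod k) ` snd j). a (fst j e, fst j (Suc e mod k)) \<omega>))"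
  proof (intro integrable_mult_right integrable_prod)
    have "fst j e \<in> {1..n}" if "e < k" for e using PiE_mem[OF x, of e] that by simp
    then show "(\<lambda>e. (fst j e, fst j (Suc e mod k))) ` ({..<k} - (snd j \<union> (\<lambda>i. Suc i mod k) ` snd j)) \<subseteq> pairs n"
      using assms(2) by auto
  qed simp
  then show ?thesis by (simp add: weight_def[abs_def] cycle_weight_def)
qed

lemma coef_split: "S \<in> matchings \<Longrightarrow> coef x S =
   (\<Prod>e\<in>S \<inter> circ 1. - of_real (s\<^sup>2) * of_bool (x e = x (nx (nx e)))) *
   (\<Prod>e\<in>S \<inter> circ 2. - of_real (s\<^sup>2) * of_bool (x e = x (nx (nx e))))"
proof -
  assume "S \<in> matchings"
  then have S: "S \<subseteq> E" by (simp add: matchings_def)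
  have "finite S" using S finite_E finite_subset by blast
  moreover have "S = (S \<inter> circ 1) \<union> (S \<inter> circ 2)" using S by (auto simp: E_def)
  moreover have "(S \<inter> circ 1) \<inter> (S \<inter> circ 2) = {}" using circ_disjoint[of 1 2] by auto
  ultimately show ?thesis unfolding coef_def by (metis (no_types, lifting) finite_Int prod.union_disjoint)
qed

lemma free_sub: "free S \<subseteq> E"
  by (auto simp: free_def)

lemma finite_free: "finite (free S)"
  using free_sub finite_E finite_subset by blast

lemma weight_product:
  assumes x: "x \<in> configs" and S: "S \<in> matchings"
  shows "weight m (restr 1 x, part 1 S) \<omega> * weight l (restr 2 x, part 2 S) \<omega> =
     coef x S * (\<Prod>e\<in>free S. a (ed x e) \<omega>)"
    and "weight m (restr 1 x, part 1 S) \<omega> =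
      (\<Prod>e\<in>S \<inter> circ 1. - of_real (s\<^sup>2) * of_bool (x e = x (nx (nx e)))) * (\<Prod>e\<in>free S \<inter> circ 1. a (ed x e) \<omega>)"
    and "weight l (restr 2 x, part 2 S) \<omega> =
      (\<Prod>e\<in>S \<inter> circ 2. - of_real (s\<^sup>2) * of_bool (x e = x (nx (nx e)))) * (\<Prod>e\<in>free S \<inter> circ 2. a (ed x e) \<omega>)"
proof -
  have len12: "len 1 = m" "len 2 = l" by (simp_all add: len_def)
  have c1: "1 \<in> {1, 2 :: nat}" and c2: "2 \<in> {1, 2 :: nat}" by simp_all
  show w1: "weight m (restr 1 x, part 1 S) \<omega> =
      (\<Prod>e\<in>S \<inter> circ 1. - of_real (s\<^sup>2) * of_bool (x e = x (nx (nx e)))) * (\<Prod>e\<in>free S \<inter> circ 1. a (ed x e) \<omega>)"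
    unfolding weight_def fst_conv snd_conv ed_def by (rule cycle_weight_restr[OF c1 x S, unfolded len12])
  show w2: "weight l (restr 2 x, part 2 S) \<omega> =
      (\<Prod>e\<in>S \<inter> circ 2. - of_real (s\<^sup>2) * of_bool (x e = x (nx (nx e)))) * (\<Prod>e\<in>free S \<inter> circ 2. a (ed x e) \<omega>)"
    unfolding weight_def fst_conv snd_conv ed_def by (rule cycle_weight_restr[OF c2 x S, unfolded len12])
  have un: "(free S \<inter> circ 1) \<union> (free S \<inter> circ 2) = free S" using free_sub[of S] unfolding E_def by blast
  have dis: "(free S \<inter> circ 1) \<inter> (free S \<inter> circ 2) = {}" using circ_disjoint[of 1 2] by auto
  have "(\<Prod>e\<in>(free S \<inter> circ 1) \<union> (free S \<inter> circ 2). a (ed x e) \<omega>) =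
      (\<Prod>e\<in>free S \<inter> circ 1. a (ed x e) \<omega>) * (\<Prod>e\<in>free S \<inter> circ 2. a (ed x e) \<omega>)"
    by (rule prod.union_disjoint) (use dis finite_free[of S] in simp_all)
  then have "(\<Prod>e\<in>free S. a (ed x e) \<omega>) = (\<Prod>e\<in>free S \<inter> circ 1. a (ed x e) \<omega>) * (\<Prod>e\<in>free S \<inter> circ 2. a (ed x e) \<omega>)"
    unfolding un .
  then show "weight m (restr 1 x, part 1 S) \<omega> * weight l (restr 2 x, part 2 S) \<omega> =
     coef x S * (\<Prod>e\<in>free S. a (ed x e) \<omega>)"
    unfolding w1 w2 coef_split[OF S] by (simp only: mult_ac)
qed

lemma cov2_eq:
  assumes s: "s > 0"
  shows "cov2 M (trace_cheb n a s m) (trace_cheb n a s l) =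
    of_real (1 / sqrt (real n)) ^ (m + l) * (\<Sum>x\<in>configs. \<Sum>S\<in>matchings. contrib x S)"
proof -
  let ?c = "complex_of_real (1 / sqrt (real n))"
  let ?J = "\<lambda>k. ({..<k} \<rightarrow>\<^sub>E {1..n}) \<times> cycle_matchings k"
  let ?B = "configs \<times> matchings"
  have tr: "trace_cheb n a s k \<omega> = ?c ^ k * (\<Sum>j\<in>?J k. weight k j \<omega>)" if "k \<ge> 1" for k \<omega>
    unfolding trace_cheb_expansion[OF n_pos s that] weight_def
    by (simp add: sum.cartesian_product split_def)
  have int: "integrable M (weight k j)" if "j \<in> ?J k" "k \<ge> 1" for j k
    using integrable_weight[OF that] .
  have E1: "(\<integral>\<omega>. trace_cheb n a s k \<omega> \<partial>M) = ?c ^ k * (\<Sum>j\<in>?J k. \<integral>\<omega>. weight k j \<omega> \<partial>M)" if "k \<ge> 1" for k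
    unfolding tr[OF that] integral_mult_right_zero
    by (subst Bochner_Integration.integral_sum) (use int[OF _ that] in auto)
  have intp: "integrable M (\<lambda>\<omega>. \<Prod>e\<in>F. a (ed x e) \<omega>)" if "x \<in> configs" "F \<subseteq> E" for x F
    using that finite_E finite_subset by (intro integrable_prod ed_configs) blast+
  have "(\<integral>\<omega>. trace_cheb n a s m \<omega> * trace_cheb n a s l \<omega> \<partial>M) =
     (\<integral>\<omega>. ?c ^ (m + l) * (\<Sum>(x, S)\<in>?B. coef x S * (\<Prod>e\<in>free S. a (ed x e) \<omega>)) \<partial>M)"
  proof (rule Bochner_Integration.integral_cong[OF refl])
    fix \<omega>
    have eq: "(\<Sum>j\<in>?J m. weight m j \<omega>) * (\<Sum>j\<in>?J l. weight l j \<omega>) =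
        (\<Sum>(x, S)\<in>?B. coef x S * (\<Prod>e\<in>free S. a (ed x e) \<omega>))"
      unfolding sum_product_join using weight_product(1) by (intro sum.cong refl) auto
    show "trace_cheb n a s m \<omega> * trace_cheb n a s l \<omega> =
      ?c ^ (m + l) * (\<Sum>(x, S)\<in>?B. coef x S * (\<Prod>e\<in>free S. a (ed x e) \<omega>))"
      unfolding tr[OF m_pos] tr[OF l_pos] power_add eq[symmetric] by (simp only: mult_ac)
  qed
  also have "\<dots> = ?c ^ (m + l) * (\<Sum>(x, S)\<in>?B. coef x S * mom (free S) (ed x))"
    unfolding integral_mult_right_zero mom_def split_def
    by (subst Bochner_Integration.integral_sum) (use intp free_sub in \<open>auto intro!: integrable_mult_right\<close>)
  finally have EE: "(\<integral>\<omega>. trace_cheb n a s m \<omega> * trace_cheb n a s l \<omega> \<partial>M) =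
    ?c ^ (m + l) * (\<Sum>(x, S)\<in>?B. coef x S * mom (free S) (ed x))" .
  have eq: "(\<Sum>j\<in>?J m. \<integral>\<omega>. weight m j \<omega> \<partial>M) * (\<Sum>j\<in>?J l. \<integral>\<omega>. weight l j \<omega> \<partial>M) =
     (\<Sum>(x, S)\<in>?B. coef x S * (mom (free S \<inter> circ 1) (ed x) * mom (free S \<inter> circ 2) (ed x)))"
    unfolding sum_product_join
  proof (rule sum.cong[OF refl], clarify)
    fix x S assume x: "x \<in> configs" and S: "S \<in> matchings"
    show "(\<integral>\<omega>. weight m (restr 1 x, part 1 S) \<omega> \<partial>M) * (\<integral>\<omega>. weight l (restr 2 x, part 2 S) \<omega> \<partial>M) =
       coef x S * (mom (free S \<inter> circ 1) (ed x) * mom (free S \<inter> circ 2) (ed x))"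
      unfolding weight_product(2,3)[OF x S] integral_mult_right_zero coef_split[OF S] mom_def
      by (simp only: mult_ac)
  qed
  have "(\<integral>\<omega>. trace_cheb n a s m \<omega> \<partial>M) * (\<integral>\<omega>. trace_cheb n a s l \<omega> \<partial>M) =
     ?c ^ (m + l) * (\<Sum>(x, S)\<in>?B. coef x S * (mom (free S \<inter> circ 1) (ed x) * mom (free S \<inter> circ 2) (ed x)))"
    unfolding E1[OF m_pos] E1[OF l_pos] power_add eq[symmetric] by (simp only: mult_ac)
  then have "cov2 M (trace_cheb n a s m) (trace_cheb n a s l) = ?c ^ (m + l) * (\<Sum>(x, S)\<in>?B. contrib x S)"
    unfolding cov2_def EE contrib_def excess_def
    by (simp only: right_diff_distrib split_def sum_subtractf)
  then show ?thesis by (simp add: sum.cartesian_product)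
qed

end

section \<open>Cancellation and vanishing of contributions\<close>

lemma diff_Un_insert:
  assumes "p \<in> E" "q \<in> E" "p \<notin> A" "p \<notin> B" "q \<notin> A" "q \<notin> B"
  shows "E - (A \<union> B) = insert p (insert q (E - (insert p A \<union> insert q B)))"
  using assms by blast

context two_circles
begin

lemma nx_inj: "e \<in> E \<Longrightarrow> f \<in> E \<Longrightarrow> nx e = nx f \<Longrightarrow> e = f"
proof -
  have inv: "(nx ^^ (len (fst e) - 1)) (nx e) = e" if e: "e \<in> E" for e
  proof -
    have c: "e \<in> circ (fst e)" using e by (simp add: E_iff circ_iff)
    have "Suc (len (fst e) - 1) = len (fst e)" using len_pos[of "fst e"] by simp
    then show ?thesis using circle_cycle(3)[OF c] by (metis comp_apply funpow_Suc_right)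
  qed
  assume "e \<in> E" "f \<in> E" "nx e = nx f"
  moreover from this have "fst e = fst f" by (metis fst_nx)
  ultimately show ?thesis using inv by metis
qed

lemma nx_nx_ne: "e \<in> circ c \<Longrightarrow> len c \<ge> 3 \<Longrightarrow> nx (nx e) \<noteq> e"
  using circle_cycle(1)[of e c] by (auto dest!: inj_onD[of _ _ 0 2] simp: numeral_2_eq_2)

end

context covariance_model
begin

lemma r_sym: "(P, Q) \<in> r \<Longrightarrow> (Q, P) \<in> r"
  using equiv_r by (auto simp: equiv_def dest: symD)

lemma r_trans: "(P, Q) \<in> r \<Longrightarrow> (Q, R) \<in> r \<Longrightarrow> (P, R) \<in> r"
  using equiv_r by (auto simp: equiv_def dest: transD)

lemma r_refl: "P \<in> pairs n \<Longrightarrow> (P, P) \<in> r"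
  using equiv_r by (auto simp: equiv_def refl_on_def)

lemma ed_mem: "x \<in> configs \<Longrightarrow> e \<in> E \<Longrightarrow> ed x e \<in> pairs n"
  using ed_configs[of x "{e}"] by auto

lemma ed_self: "x \<in> configs \<Longrightarrow> e \<in> E \<Longrightarrow> (ed x e, ed x e) \<in> r"
  by (rule r_refl[OF ed_mem])

lemma ed_swap_related:
  assumes x: "x \<in> configs" and e: "e \<in> E" and eq: "x e = x (nx (nx e))"
  shows "(ed x e, ed x (nx e)) \<in> r"
  using r_transpose[of "x e" "x (nx e)"] ed_mem[OF x e] eq by (simp add: ed_def)

text \<open>The class of \<open>e\<close> is exhausted by \<open>e\<close> and \<open>nx e\<close>,
  so their entries split off from any \<open>F\<close>. By hermitian symmetry the product of the two
  is the squared modulus of an off-diagonal entry.\<close>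

lemma mom_isolated_pair:
  assumes x: "x \<in> configs" and c: "cancelling r x e" and F: "F \<subseteq> E" "e \<notin> F" "nx e \<notin> F"
  shows "mom (insert e (insert (nx e) F)) (ed x) = of_real (s\<^sup>2) * mom F (ed x)"
proof -
  have e: "e \<in> E" "nx e \<in> E" "len (fst e) \<ge> 3" "cls r x e = {e, nx e}" "x e = x (nx (nx e))" "x e \<noteq> x (nx e)"
    using c nx_in_E by (auto simp: cancelling_def)
  have "e \<in> circ (fst e)" using e(1) by (simp add: E_iff circ_iff)
  then have ne: "nx e \<noteq> e" using nx_ne e(3) by simp
  let ?F = "insert e (insert (nx e) F)"
  have FE: "?F \<subseteq> E" using e(1,2) F(1) by blast
  have "mom ?F (ed x) = mom {e, nx e} (ed x) * mom F (ed x)"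
  proof (rule mom_split)
    show "finite ?F" by (rule finite_subset[OF FE finite_E])
    show "ed x ` ?F \<subseteq> pairs n" using ed_configs[OF x FE] .
    show "?F = {e, nx e} \<union> F" by blast
    show "{e, nx e} \<inter> F = {}" using F(2,3) by blast
    fix g f assume gf: "g \<in> {e, nx e}" "f \<in> F"
    show "(ed x g, ed x f) \<notin> r"
    proof
      assume r: "(ed x g, ed x f) \<in> r"
      have "g \<in> cls r x e" using gf(1) e(4) by simp
      then have "(ed x e, ed x g) \<in> r" by (simp add: cls_def)
      then have "f \<in> cls r x e" using r_trans[OF _ r] gf(2) F(1) by (auto simp: cls_def)
      then show False using e(4) F gf(2) by auto
    qed
  qed
  also have "mom {e, nx e} (ed x) = of_real (s\<^sup>2)"
    by (rule mom_edge_pair[of _ _ _ "x e" "x (nx e)"])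
       (use ne e ed_mem[OF x e(1)] in \<open>auto simp: ed_def\<close>)
  finally show ?thesis .
qed

text \<open>
  The matchings \<open>S\<close> and \<open>S \<union> {e}\<close> give opposite contributions, as the factor \<open>-s\<^sup>2\<close> replaces \<open>E(|a|\<^sup>2)\<close>.
\<close>

lemma contrib_cancel:
  assumes x: "x \<in> configs" and c: "cancelling r x e"
  shows "(\<Sum>S\<in>matchings. contrib x S) = 0"
proof -
  let ?f = "nx e"
  have e: "e \<in> E" "?f \<in> E" "len (fst e) \<ge> 3" "cls r x e = {e, ?f}" "x e = x (nx ?f)" "x e \<noteq> x ?f"
    using c nx_in_E by (auto simp: cancelling_def)
  have ec: "e \<in> circ (fst e)" "?f \<in> circ (fst e)" using e(1) nx_circ by (auto simp: E_iff circ_iff)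
  have ne: "?f \<noteq> e" "nx ?f \<noteq> e" "nx ?f \<noteq> ?f"
    using nx_ne[OF ec(1)] nx_ne[OF ec(2)] nx_nx_ne[OF ec(1)] e(3) by auto
  \<comment> \<open>\<open>A\<close> consists of the matchings to which the pair at \<open>e\<close>
    can be added, \<open>R\<close> of those in which \<open>e\<close> or \<open>nx e\<close> is
    matched with an edge outside this pair.\<close>
  define A where "A = {S \<in> matchings. e \<notin> S \<and> ?f \<notin> S \<and> e \<notin> nx ` S}"
  define R where "R = {S \<in> matchings. ?f \<in> S \<or> e \<in> nx ` S}"
  have AE: "S \<subseteq> E" if "S \<in> A" for S using that by (auto simp: A_def matchings_def)
  have insA: "insert e S \<in> matchings" if S: "S \<in> A" for S
    using S e(1) ne(1) by (auto simp: A_def matchings_def)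
  have split: "matchings = A \<union> insert e ` A \<union> R"
  proof (intro equalityI subsetI)
    fix S assume S: "S \<in> matchings"
    show "S \<in> A \<union> insert e ` A \<union> R"
    proof (cases "e \<in> S")
      case True
      then have "?f \<notin> S" "e \<notin> nx ` S" using S by (auto simp: matchings_def)
      then have "S - {e} \<in> A" using S by (auto simp: A_def matchings_def)
      moreover have "S = insert e (S - {e})" using True by blast
      ultimately show ?thesis by blast
    next
      case False
      then show ?thesis using S by (auto simp: A_def R_def)
    qed
  qed (use insA in \<open>auto simp: A_def R_def\<close>)
  \<comment> \<open>A nonzero coefficient would make the walk backtrack at the other pair as well,
    and transposition would put a third edge into the class of \<open>e\<close>.\<close>
  have R0: "contrib x S = 0" if S: "S \<in> R" for S
  proof -
    have SE: "S \<subseteq> E" using S by (auto simp: R_def matchings_def)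
    have finS: "finite S" by (rule finite_subset[OF SE finite_E])
    have "\<exists>g\<in>S. x g \<noteq> x (nx (nx g))"
    proof (rule ccontr)
      assume "\<not> ?thesis"
      then have all: "x g = x (nx (nx g))" if "g \<in> S" for g using that by blast
      from S have "?f \<in> S \<or> e \<in> nx ` S" by (simp add: R_def)
      then show False
      proof
        assume f: "?f \<in> S"
        have "ed x (nx ?f) = ed x e" using e(5) all[OF f] by (simp add: ed_def)
        then have "nx ?f \<in> cls r x e" using ed_self[OF x e(1)] nx_in_E[OF e(2)] by (simp add: cls_def)
        then have "nx (nx e) = e \<or> nx (nx e) = nx e" using e(4) by simp
        then show False using ne(2,3) by metis
      next
        assume "e \<in> nx ` S"
        then obtain g where g: "g \<in> S" "e = nx g" by blast
        have gE: "g \<in> E" using g SE by blast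
        have "(ed x g, ed x (nx g)) \<in> r" by (rule ed_swap_related[OF x gE all[OF g(1)]])
        then have "g \<in> cls r x e" using r_sym g(2) gE by (auto simp: cls_def)
        then have "g = e \<or> g = nx e" using e(4) by simp
        then show False using ne(1,2) g(2) by metis
      qed
    qed
    then have "coef x S = 0" unfolding coef_def using finS by (auto simp: prod_zero_iff)
    then show ?thesis by (simp add: contrib_def)
  qed
  have neg: "contrib x (insert e S) = - contrib x S" if S: "S \<in> A" for S
  proof -
    have finS: "finite S" by (rule finite_subset[OF AE[OF S] finite_E])
    have eS: "e \<notin> S" "?f \<notin> S" "e \<notin> nx ` S" using S by (auto simp: A_def)
    have fS: "?f \<notin> nx ` S"
    proof
      assume "?f \<in> nx ` S"
      then obtain g where "g \<in> S" "nx e = nx g" by blast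
      then have "g = e" using nx_inj[of e g] e(1) AE[OF S] by auto
      then show False using \<open>g \<in> S\<close> eS by blast
    qed
    let ?F = "free (insert e S)"
    have F: "?F \<subseteq> E" "e \<notin> ?F" "?f \<notin> ?F" by (auto simp: free_def)
    have free: "free S = insert e (insert ?f ?F)" unfolding free_def image_insert
      by (rule diff_Un_insert) (use e(1,2) eS fS in simp_all)
    have "excess (free S) x = of_real (s\<^sup>2) * excess ?F x"
    proof -
      let ?c = "fst e"
      have 1: "mom (free S) (ed x) = of_real (s\<^sup>2) * mom ?F (ed x)"
        unfolding free by (rule mom_isolated_pair[OF x c F])
      have own: "mom (free S \<inter> circ ?c) (ed x) = of_real (s\<^sup>2) * mom (?F \<inter> circ ?c) (ed x)"
      proof -
        have "free S \<inter> circ ?c = insert e (insert ?f (?F \<inter> circ ?c))" unfolding free using ec by blast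
        then show ?thesis using mom_isolated_pair[OF x c, of "?F \<inter> circ ?c"] F by auto
      qed
      have other: "free S \<inter> circ d = ?F \<inter> circ d" if "d \<noteq> ?c" for d
        unfolding free using circ_disjoint[OF that] ec by blast
      have "?c = 1 \<or> ?c = 2" using e(1) by (simp add: E_iff)
      then show ?thesis
      proof
        assume c1: "?c = 1"
        have o: "free S \<inter> circ 2 = ?F \<inter> circ 2" by (rule other) (use c1 in simp)
        show ?thesis unfolding excess_def 1 o own[unfolded c1]
          by (simp add: algebra_simps)
      next
        assume c2: "?c = 2"
        have o: "free S \<inter> circ 1 = ?F \<inter> circ 1" by (rule other) (use c2 in simp)
        show ?thesis unfolding excess_def 1 o own[unfolded c2]
          by (simp add: algebra_simps)
      qed
    qed
    moreover have "coef x (insert e S) = - of_real (s\<^sup>2) * coef x S"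
      unfolding coef_def using finS eS(1) e(5) by (simp add: prod.insert)
    ultimately show ?thesis by (simp add: contrib_def)
  qed
  have finA: "finite A" "finite R" using finite_matchings by (auto simp: A_def R_def)
  have inj: "inj_on (insert e) A" by (rule inj_onI) (metis (no_types, lifting) A_def Diff_insert_absorb mem_Collect_eq)
  have d1: "A \<inter> insert e ` A = {}" by (auto simp: A_def)
  have d2: "(A \<union> insert e ` A) \<inter> R = {}" using ne(1) by (auto simp: A_def R_def)
  have "(\<Sum>S\<in>matchings. contrib x S) = (\<Sum>S\<in>A. contrib x S) + (\<Sum>S\<in>insert e ` A. contrib x S) + (\<Sum>S\<in>R. contrib x S)"
    unfolding split using finA d1 d2 by (simp add: sum.union_disjoint)
  also have "\<dots> = (\<Sum>S\<in>A. contrib x S) + (\<Sum>S\<in>A. - contrib x S)"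
    using R0 neg by (simp add: sum.reindex[OF inj])
  finally show ?thesis by (simp add: sum_negf)
qed

text \<open>Matched edges are equivalent by backtracking and transposition. An unmatched edge alone
  in its class makes every moment containing it vanish, and so \<open>excess\<close>. If no class
  meets both circles, the joint moment factorises.\<close>

lemma contrib_nonzero:
  assumes x: "x \<in> configs" and S: "S \<in> matchings" and nz: "contrib x S \<noteq> 0"
  shows "contributing r x"
proof -
  have SE: "S \<subseteq> E" and SS: "\<And>e. e \<in> S \<Longrightarrow> nx e \<notin> S" using S by (auto simp: matchings_def)
  have finS: "finite S" by (rule finite_subset[OF SE finite_E])
  have co: "coef x S \<noteq> 0" and ex: "excess (free S) x \<noteq> 0" using nz by (auto simp: contrib_def)
  have eq: "x e = x (nx (nx e))" if "e \<in> S" for e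
    using co that finS by (auto simp: coef_def prod_zero_iff)
  have finF: "finite (free S \<inter> X)" for X using finite_free by simp
  have edF: "ed x ` (free S \<inter> X) \<subseteq> pairs n" for X using ed_configs[OF x] free_sub by (metis inf.coboundedI1)
  have two: "\<exists>f\<in>cls r x e. f \<noteq> e" if e: "e \<in> E" for e
  proof -
    consider "e \<in> S" | g where "g \<in> S" "e = nx g" | "e \<in> free S" using e unfolding free_def by blast
    then show ?thesis
    proof cases
      case 1
      then have "nx e \<in> cls r x e" using ed_swap_related[OF x e eq[OF 1]] nx_in_E[OF e] by (simp add: cls_def)
      moreover have "nx e \<noteq> e" using SS[OF 1] 1 by auto
      ultimately show ?thesis by blast
    next
      case 2
      have g: "g \<in> E" using 2 SE by blast
      have "g \<in> cls r x e" using r_sym[OF ed_swap_related[OF x g eq[OF 2(1)]]] 2(2) g by (simp add: cls_def)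
      moreover have "g \<noteq> e" using SS[OF 2(1)] 2 by auto
      ultimately show ?thesis by blast
    next
      case 3
      show ?thesis
      proof (rule ccontr)
        assume "\<not> ?thesis"
        then have iso: "(ed x e, ed x f) \<notin> r" if "f \<in> E" "f \<noteq> e" for f using that unfolding cls_def by blast
        have "mom (free S \<inter> X) (ed x) = 0" if "e \<in> X" for X
          by (rule mom_isolated[OF finF edF, of e]) (use that 3 iso free_sub in blast)+
        moreover have "e \<in> circ 1 \<or> e \<in> circ 2" using e by (simp add: E_def)
        ultimately have "mom (free S \<inter> UNIV) (ed x) = 0"
          "mom (free S \<inter> circ 1) (ed x) = 0 \<or> mom (free S \<inter> circ 2) (ed x) = 0" by blast+
        then have "excess (free S) x = 0" by (auto simp: excess_def)
        then show False using ex by simp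
      qed
    qed
  qed
  have "card (cls r x e) \<ge> 2" if e: "e \<in> E" for e
  proof -
    obtain f where f: "f \<in> cls r x e" "f \<noteq> e" using two[OF e] by blast
    have "e \<in> cls r x e" using ed_self[OF x e] e by (simp add: cls_def)
    then have "card {e, f} \<le> card (cls r x e)" using f by (intro card_mono) (auto simp: cls_def)
    then show ?thesis using f(2) by simp
  qed
  moreover have "\<exists>e\<in>circ 1. \<exists>f\<in>circ 2. (ed x e, ed x f) \<in> r"
  proof (rule ccontr)
    assume no: "\<not> ?thesis"
    have "mom (free S \<inter> UNIV) (ed x) = mom (free S \<inter> circ 1) (ed x) * mom (free S \<inter> circ 2) (ed x)"
    proof (rule mom_split[OF finF edF])
      show "free S \<inter> UNIV = free S \<inter> circ 1 \<union> free S \<inter> circ 2" using free_sub[of S] unfolding E_def by blast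
      show "free S \<inter> circ 1 \<inter> (free S \<inter> circ 2) = {}" using circ_disjoint[of 1 2] by auto
    qed (use no in blast)
    then show False using ex by (simp add: excess_def)
  qed
  ultimately show ?thesis by (simp add: contributing_def)
qed

lemma norm_contrib_le:
  assumes x: "x \<in> configs" and S: "S \<in> matchings"
    and B: "\<And>k P. k \<le> m + l \<Longrightarrow> P \<in> pairs n \<Longrightarrow> (\<integral>\<omega>. cmod (a P \<omega>) ^ k \<partial>M) \<le> B" and B0: "B \<ge> 0"
  shows "cmod (contrib x S) \<le> max 1 (s\<^sup>2) ^ (m + l) *
     ((1 + real (m + l) * B) + (1 + real (m + l) * B) * (1 + real (m + l) * B))"
proof -
  let ?D = "1 + real (m + l) * B"
  have D0: "?D \<ge> 0" using B0 by simp
  have SE: "S \<subseteq> E" using S by (auto simp: matchings_def)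
  have "cmod (coef x S) = (\<Prod>e\<in>S. cmod (- of_real (s\<^sup>2) * of_bool (x e = x (nx (nx e)))))"
    unfolding coef_def by (rule prod_norm[symmetric])
  also have "\<dots> \<le> (\<Prod>e\<in>S. max 1 (s\<^sup>2))" by (intro prod_mono) (auto simp: norm_mult norm_power)
  also have "\<dots> = max 1 (s\<^sup>2) ^ card S" by simp
  also have "\<dots> \<le> max 1 (s\<^sup>2) ^ (m + l)"
    using card_mono[OF finite_E SE] card_E by (intro power_increasing) auto
  finally have c: "cmod (coef x S) \<le> max 1 (s\<^sup>2) ^ (m + l)" .
  have mo: "cmod (mom F (ed x)) \<le> ?D" if F: "F \<subseteq> E" for F
  proof -
    have fin: "finite F" by (rule finite_subset[OF F finite_E])
    have card: "card F \<le> m + l" using card_mono[OF finite_E F] card_E by simp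
    have "cmod (mom F (ed x)) \<le> 1 + real (card F) * B"
      by (rule norm_mom_le[OF fin ed_configs[OF x F]]) (rule B[OF card])
    also have "\<dots> \<le> ?D" using card B0 by (intro add_left_mono mult_right_mono) auto
    finally show ?thesis .
  qed
  have sub: "free S \<subseteq> E" "free S \<inter> X \<subseteq> E" for X using free_sub by auto
  have "cmod (excess (free S) x) \<le> cmod (mom (free S) (ed x)) + cmod (mom (free S \<inter> circ 1) (ed x) * mom (free S \<inter> circ 2) (ed x))"
    unfolding excess_def by (rule norm_triangle_ineq4)
  also have "\<dots> \<le> ?D + ?D * ?D"
    unfolding norm_mult using mo[OF sub(1)] mo[OF sub(2)] D0 by (intro add_mono mult_mono) auto
  finally have "cmod (excess (free S) x) \<le> ?D + ?D * ?D" .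
  then show ?thesis unfolding contrib_def norm_mult using c D0 by (intro mult_mono) auto
qed

text \<open>Outside the main configurations and \<open>rest_configs\<close> the sum over the
  matchings vanishes: either every term is zero or a cancelling pair is present. For the rest, a
  uniform bound on the terms and the number of configurations suffice.\<close>

lemma cov2_error:
  assumes s: "s > 0"
    and B: "\<And>k P. k \<le> m + l \<Longrightarrow> P \<in> pairs n \<Longrightarrow> (\<integral>\<omega>. cmod (a P \<omega>) ^ k \<partial>M) \<le> B" and B0: "B \<ge> 0"
  shows "cmod (cov2 M (trace_cheb n a s m) (trace_cheb n a s l) -
      of_real (1 / sqrt (real n)) ^ (m + l) * (\<Sum>x\<in>{x \<in> configs. main_config r x}. \<Sum>S\<in>matchings. contrib x S))
    \<le> (1 / sqrt (real n)) ^ (m + l) * (real (card (rest_configs n r)) * (real (card matchings) * (max 1 (s\<^sup>2) ^ (m + l) *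
     ((1 + real (m + l) * B) + (1 + real (m + l) * B) * (1 + real (m + l) * B)))))"
    (is "_ \<le> _ * (_ * ?R)")
proof -
  let ?c = "complex_of_real (1 / sqrt (real n))" let ?\<phi> = "\<lambda>x. \<Sum>S\<in>matchings. contrib x S"
  let ?main = "{x \<in> configs. main_config r x}"
  have rest: "rest_configs n r \<subseteq> configs - ?main" by (auto simp: rest_configs_def)
  have "?\<phi> x = 0" if x: "x \<in> configs - ?main - rest_configs n r" for x
  proof (cases "contributing r x")
    case True
    then obtain e where "cancelling r x e" using x unfolding rest_configs_def by blast
    then show ?thesis using contrib_cancel x by blast
  next
    case False
    then show ?thesis using contrib_nonzero x by (intro sum.neutral) blast
  qed
  then have "(\<Sum>x\<in>configs - ?main. ?\<phi> x) = (\<Sum>x\<in>rest_configs n r. ?\<phi> x)"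
    using rest finite_configs by (intro sum.mono_neutral_right) auto
  moreover have "(\<Sum>x\<in>configs. ?\<phi> x) = (\<Sum>x\<in>configs - ?main. ?\<phi> x) + (\<Sum>x\<in>?main. ?\<phi> x)"
    by (rule sum.subset_diff) (use finite_configs in auto)
  ultimately have "(\<Sum>x\<in>configs. ?\<phi> x) - (\<Sum>x\<in>?main. ?\<phi> x) = (\<Sum>x\<in>rest_configs n r. ?\<phi> x)" by simp
  then have eq: "cov2 M (trace_cheb n a s m) (trace_cheb n a s l) - ?c ^ (m + l) * (\<Sum>x\<in>?main. ?\<phi> x) =
      ?c ^ (m + l) * (\<Sum>x\<in>rest_configs n r. ?\<phi> x)"
    unfolding cov2_eq[OF s] by (simp only: right_diff_distrib[symmetric])
  have "cmod (?\<phi> x) \<le> ?R" if x: "x \<in> rest_configs n r" for x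
  proof -
    have xc: "x \<in> configs" using x rest by blast
    show ?thesis using sum_norm_le[of matchings "contrib x" "\<lambda>_. max 1 (s\<^sup>2) ^ (m + l) *
     ((1 + real (m + l) * B) + (1 + real (m + l) * B) * (1 + real (m + l) * B))"] norm_contrib_le[OF xc _ B B0]
      by simp
  qed
  then have "cmod (\<Sum>x\<in>rest_configs n r. ?\<phi> x) \<le> (\<Sum>x\<in>rest_configs n r. ?R)" by (intro sum_norm_le)
  then have "cmod (\<Sum>x\<in>rest_configs n r. ?\<phi> x) \<le> real (card (rest_configs n r)) * ?R" by simp
  moreover have "cmod ?c = 1 / sqrt (real n)" unfolding norm_of_real by simp
  ultimately show ?thesis unfolding eq norm_mult norm_power
    by (metis mult_left_mono zero_le_power real_sqrt_ge_zero of_nat_0_le_iff zero_le_divide_1_iff)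
qed

section \<open>Main terms for walks of lengths one and two\<close>

lemma empty_matching: "{} \<in> matchings" "free {} = E" "coef x {} = 1"
  by (simp_all add: matchings_def free_def coef_def)

lemma contrib_empty: "contrib x {} = excess E x"
  by (simp add: contrib_def empty_matching)

lemma E_circ: "E \<inter> circ 1 = circ 1" "E \<inter> circ 2 = circ 2"
  unfolding E_def by blast+

lemma circ_1: "len c = 1 \<Longrightarrow> circ c = {(c, 0)}"
  by (auto simp: circ_def)

lemma circ_2: "len c = 2 \<Longrightarrow> circ c = {(c, 0), (c, 1)}"
  by (auto simp: circ_def)

lemma inverse_sqrt_power: "complex_of_real (1 / sqrt (real n)) ^ (k + k) = 1 / of_nat n ^ k"
proof -
  have "(1 / sqrt (real n))\<^sup>2 = 1 / real n" by (simp add: power_divide)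
  then have "(1 / sqrt (real n)) ^ (k + k) = 1 / real n ^ k"
    by (simp only: mult_2[symmetric] power_mult power_one_over)
  then have "complex_of_real ((1 / sqrt (real n)) ^ (k + k)) = complex_of_real (1 / real n ^ k)" by (rule arg_cong)
  then show ?thesis by (simp only: of_real_power of_real_divide of_real_1 of_real_of_nat_eq)
qed

lemma sum_over_configs_1:
  assumes ml: "m = 1" "l = 1"
  shows "(\<Sum>x\<in>{x \<in> configs. (ed x (1, 0), ed x (2, 0)) \<in> r}. g (x (1, 0)) (x (2, 0))) =
    (\<Sum>(p, q)\<in>{(p, q) \<in> pairs n. ((p, p), (q, q)) \<in> r}. g p q :: complex)"
proof -
  have len1: "len c = 1" for c using ml unfolding len_def by simp
  have E: "E = {(1, 0), (2, 0)}" unfolding E_def circ_1[OF len1] by auto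
  have nx: "nx (c, 0) = (c, 0)" for c using len1 by (auto simp: nx_def)
  define j where "j pq = (\<lambda>e\<in>E. if fst e = 1 then fst pq else snd pq)" for pq :: "nat \<times> nat"
  have j: "j pq (1, 0) = fst pq" "j pq (2, 0) = snd pq" for pq by (simp_all add: j_def E)
  show ?thesis
  proof (rule sum.reindex_bij_witness[of _ j "\<lambda>x. (x (1, 0), x (2, 0))"])
    fix x assume x: "x \<in> {x \<in> configs. (ed x (1, 0), ed x (2, 0)) \<in> r}"
    then have xc: "x \<in> configs" by simp
    have "j (x (1, 0), x (2, 0)) e = x e" for e
    proof (cases "e \<in> E")
      case True
      then show ?thesis by (auto simp: j_def E)
    next
      case False
      then show ?thesis using PiE_arb[OF xc False] by (simp add: j_def)
    qed
    then show "j (x (1, 0), x (2, 0)) = x" by (rule ext)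
    have "x (1, 0) \<in> {1..n}" "x (2, 0) \<in> {1..n}" using PiE_mem[OF xc] E by blast+
    moreover have "(ed x (1, 0), ed x (2, 0)) \<in> r" using x by blast
    ultimately show "(x (1, 0), x (2, 0)) \<in> {(p, q) \<in> pairs n. ((p, p), (q, q)) \<in> r}"
      unfolding ed_def nx by blast
  next
    fix pq assume pq: "pq \<in> {(p, q) \<in> pairs n. ((p, p), (q, q)) \<in> r}"
    show "(j pq (1, 0), j pq (2, 0)) = pq" unfolding j by simp
    have pq': "fst pq \<in> {1..n}" "snd pq \<in> {1..n}" "((fst pq, fst pq), (snd pq, snd pq)) \<in> r" using pq by auto
    then have "j pq \<in> configs" by (intro PiE_I) (simp_all add: j_def)
    moreover have "(ed (j pq) (1, 0), ed (j pq) (2, 0)) \<in> r" unfolding ed_def nx j by (rule pq'(3))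
    ultimately show "j pq \<in> {x \<in> configs. (ed x (1, 0), ed x (2, 0)) \<in> r}" by blast
  qed simp
qed

lemma sum_over_configs_2:
  assumes ml: "m = 2" "l = 2"
  shows "(\<Sum>x\<in>{x \<in> configs. (\<forall>e\<in>E. x e \<noteq> x (nx e)) \<and> (ed x (1, 0), ed x (2, 0)) \<in> r}. g (ed x (1, 0)) (ed x (2, 0))) =
    (\<Sum>(P, Q)\<in>{(P, Q) \<in> pairs n \<times> pairs n. fst P \<noteq> snd P \<and> fst Q \<noteq> snd Q \<and> (P, Q) \<in> r}. g P Q :: complex)"
proof -
  have len2: "len c = 2" for c using ml unfolding len_def by simp
  have E: "E = {(1, 0), (1, 1), (2, 0), (2, 1)}" unfolding E_def circ_2[OF len2] by auto
  have nx: "nx (c, 0) = (c, 1)" "nx (c, Suc 0) = (c, 0)" for c using len2 by (auto simp: nx_def)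
  define j where "j PQ = (\<lambda>e\<in>E. (if snd e = 0 then fst else snd) (if fst e = 1 then fst PQ else snd PQ))"
    for PQ :: "(nat \<times> nat) \<times> (nat \<times> nat)"
  have j: "j PQ (1, 0) = fst (fst PQ)" "j PQ (1, 1) = snd (fst PQ)" "j PQ (2, 0) = fst (snd PQ)" "j PQ (2, 1) = snd (snd PQ)"
    for PQ by (simp_all add: j_def E)
  have edx: "ed x (c, 0) = (x (c, 0), x (c, 1))" for x c by (simp add: ed_def nx)
  show ?thesis
  proof (rule sum.reindex_bij_witness[of _ j "\<lambda>x. (ed x (1, 0), ed x (2, 0))"])
    fix x assume x: "x \<in> {x \<in> configs. (\<forall>e\<in>E. x e \<noteq> x (nx e)) \<and> (ed x (1, 0), ed x (2, 0)) \<in> r}"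
    then have xc: "x \<in> configs" by simp
    have "j (ed x (1, 0), ed x (2, 0)) e = x e" for e
    proof (cases "e \<in> E")
      case True
      then show ?thesis unfolding edx E by (auto simp: j_def E)
    next
      case False
      then show ?thesis using PiE_arb[OF xc False] by (simp add: j_def)
    qed
    then show "j (ed x (1, 0), ed x (2, 0)) = x" by (rule ext)
    have E1: "(1, 0) \<in> E" "(2, 0) \<in> E" unfolding E by simp_all
    have "\<forall>e\<in>E. x e \<noteq> x (nx e)" using x by blast
    then have "x (1, 0) \<noteq> x (1, 1)" "x (2, 0) \<noteq> x (2, 1)"
      using E1 nx(1) by metis+
    then have "fst (ed x (1, 0)) \<noteq> snd (ed x (1, 0))" "fst (ed x (2, 0)) \<noteq> snd (ed x (2, 0))"
      unfolding edx by simp_all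
    moreover have "(ed x (1, 0), ed x (2, 0)) \<in> r" using x by blast
    ultimately show "(ed x (1, 0), ed x (2, 0)) \<in> {(P, Q) \<in> pairs n \<times> pairs n. fst P \<noteq> snd P \<and> fst Q \<noteq> snd Q \<and> (P, Q) \<in> r}"
      using ed_mem[OF xc E1(1)] ed_mem[OF xc E1(2)] by blast
  next
    fix PQ assume PQ: "PQ \<in> {(P, Q) \<in> pairs n \<times> pairs n. fst P \<noteq> snd P \<and> fst Q \<noteq> snd Q \<and> (P, Q) \<in> r}"
    show b: "(ed (j PQ) (1, 0), ed (j PQ) (2, 0)) = PQ" unfolding edx j by simp
    have 1: "j PQ \<in> configs" using PQ by (intro PiE_I) (auto simp: j_def)
    have 2: "\<forall>e\<in>E. j PQ e \<noteq> j PQ (nx e)"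
    proof
      fix e assume "e \<in> E"
      then have "e = (1, 0) \<or> e = (1, 1) \<or> e = (2, 0) \<or> e = (2, 1)" unfolding E by blast
      then show "j PQ e \<noteq> j PQ (nx e)" using PQ j[of PQ] nx by auto
    qed
    have 3: "(ed (j PQ) (1, 0), ed (j PQ) (2, 0)) \<in> r" using PQ unfolding b by auto
    show "j PQ \<in> {x \<in> configs. (\<forall>e\<in>E. x e \<noteq> x (nx e)) \<and> (ed x (1, 0), ed x (2, 0)) \<in> r}"
      using 1 2 3 by blast
  qed simp
qed

text \<open>A single loop cannot be matched with itself, so only the empty matching remains, and the
  product of means vanishes since the entries are centered. The joint moment is nonzero only for
  entries of a common class.\<close>

lemma main_sum_1:
  assumes ml: "m = 1" "l = 1"
  shows "of_real (1 / sqrt (real n)) ^ (m + l) * (\<Sum>x\<in>{x \<in> configs. main_config r x}. \<Sum>S\<in>matchings. contrib x S) = V n M r a m"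
proof -
  have len1: "len c = 1" for c using ml unfolding len_def by simp
  have E: "E = {(1, 0), (2, 0)}" unfolding E_def circ_1[OF len1] by blast
  have nx: "nx e = e" if "e \<in> E" for e using that len1 by (auto simp: nx_def E)
  have "S = {}" if S: "S \<in> matchings" for S
  proof (rule ccontr)
    assume "S \<noteq> {}"
    then obtain e where e: "e \<in> S" by blast
    then have "e \<in> E" "nx e \<notin> S" using S unfolding matchings_def by blast+
    then show False using nx e by metis
  qed
  then have mat: "matchings = {{}}" using empty_matching(1) by blast
  have c0: "contrib x {} = (\<integral>\<omega>. a (x (1, 0), x (1, 0)) \<omega> * a (x (2, 0), x (2, 0)) \<omega> \<partial>M)" if x: "x \<in> configs" for x
  proof -
    have n1: "ed x e = (x e, x e)" if "e \<in> E" for e using nx[OF that] by (simp add: ed_def)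
    have e1: "(1, 0) \<in> E" "(2, 0) \<in> E" unfolding E by blast+
    have m0: "mom (circ 1) (ed x) = 0" unfolding circ_1[OF len1]
      by (rule mom_singleton[of "ed x"]) (rule ed_mem[OF x e1(1)])
    have "excess E x = mom E (ed x)" unfolding excess_def E_circ by (simp only: m0 mult_zero_left diff_zero)
    also have "mom E (ed x) = (\<integral>\<omega>. a (ed x (1, 0)) \<omega> * a (ed x (2, 0)) \<omega> \<partial>M)"
      unfolding mom_def E by simp
    finally show ?thesis unfolding contrib_empty n1[OF e1(1)] n1[OF e1(2)] .
  qed
  have "main_config r x" for x unfolding main_config_def using ml by (metis (full_types))
  then have "(\<Sum>x\<in>{x \<in> configs. main_config r x}. \<Sum>S\<in>matchings. contrib x S) = (\<Sum>x\<in>configs. contrib x {})"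
    unfolding mat by simp
  also have "\<dots> = (\<Sum>x\<in>{x \<in> configs. (ed x (1, 0), ed x (2, 0)) \<in> r}. contrib x {})"
  proof (rule sum.mono_neutral_right[OF finite_configs])
    show "\<forall>x\<in>configs - {x \<in> configs. (ed x (1, 0), ed x (2, 0)) \<in> r}. contrib x {} = 0"
    proof (rule ballI, rule ccontr)
      fix x assume x: "x \<in> configs - {x \<in> configs. (ed x (1, 0), ed x (2, 0)) \<in> r}" "contrib x {} \<noteq> 0"
      have xc: "x \<in> configs" using x(1) by (rule DiffD1)
      have nr: "(ed x (1, 0), ed x (2, 0)) \<notin> r"
        using DiffD2[OF x(1), unfolded mem_Collect_eq] xc by iprover
      have "contributing r x" by (rule contrib_nonzero[OF xc empty_matching(1) x(2)])
      then obtain e f where "e \<in> circ 1" "f \<in> circ 2" "(ed x e, ed x f) \<in> r"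
        unfolding contributing_def by blast
      then have "(ed x (1, 0), ed x (2, 0)) \<in> r" unfolding circ_1[OF len1] by simp
      then show False using nr by contradiction
    qed
  qed blast
  also have "\<dots> = (\<Sum>x\<in>{x \<in> configs. (ed x (1, 0), ed x (2, 0)) \<in> r}.
      \<integral>\<omega>. a (x (1, 0), x (1, 0)) \<omega> * a (x (2, 0), x (2, 0)) \<omega> \<partial>M)"
    by (rule sum.cong[OF refl]) (rule c0, simp)
  also have "\<dots> = (\<Sum>(p, q)\<in>{(p, q) \<in> pairs n. ((p, p), (q, q)) \<in> r}. \<integral>\<omega>. a (p, p) \<omega> * a (q, q) \<omega> \<partial>M)"
    by (rule sum_over_configs_1[OF ml])
  finally have sum: "(\<Sum>x\<in>{x \<in> configs. main_config r x}. \<Sum>S\<in>matchings. contrib x S) =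
    (\<Sum>(p, q)\<in>{(p, q) \<in> pairs n. ((p, p), (q, q)) \<in> r}. \<integral>\<omega>. a (p, p) \<omega> * a (q, q) \<omega> \<partial>M)" .
  have "of_real (1 / sqrt (real n)) ^ (m + l) = (1 / of_nat n :: complex)"
    using inverse_sqrt_power[of 1] unfolding ml by simp
  moreover have "V n M r a m = 1 / of_nat n * (\<Sum>(p, q)\<in>{(p, q) \<in> pairs n. ((p, p), (q, q)) \<in> r}. \<integral>\<omega>. a (p, p) \<omega> * a (q, q) \<omega> \<partial>M)"
    unfolding V_def using ml(1) by simp
  ultimately show ?thesis unfolding sum by simp
qed

text \<open>A matched pair fills a circle of length two, so no entries are left on it, and the
  covariance with a constant is zero.\<close>

lemma contrib_nonempty_2:
  assumes ml: "m = 2" "l = 2" and S: "S \<in> matchings" "S \<noteq> {}"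
  shows "contrib x S = 0"
proof -
  obtain e where e: "e \<in> S" using S(2) by blast
  then have eE: "e \<in> E" using S(1) unfolding matchings_def by blast
  let ?c = "fst e"
  have len2: "len c = 2" for c using ml unfolding len_def by simp
  have ec: "e \<in> circ ?c" using eE by (simp add: E_iff circ_iff)
  have "circ ?c = {e, nx e}"
    using circle_cycle(2)[OF ec] len2 by (simp add: numeral_2_eq_2 lessThan_Suc insert_commute)
  moreover have "e \<notin> free S" "nx e \<notin> free S" using e unfolding free_def by auto
  ultimately have z: "free S \<inter> circ ?c = {}" by simp
  have F: "free S = (free S \<inter> circ 1) \<union> (free S \<inter> circ 2)" using free_sub[of S] unfolding E_def by blast
  have "?c = 1 \<or> ?c = 2" using eE by (simp add: E_iff)
  then have "excess (free S) x = 0"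
  proof
    assume c1: "?c = 1"
    have "free S \<inter> circ 1 = {}" using z unfolding c1 .
    moreover from this have "free S \<inter> circ 2 = free S" using F by blast
    ultimately show ?thesis unfolding excess_def by simp
  next
    assume c2: "?c = 2"
    have "free S \<inter> circ 2 = {}" using z unfolding c2 .
    moreover from this have "free S \<inter> circ 1 = free S" using F by blast
    ultimately show ?thesis unfolding excess_def by simp
  qed
  then show ?thesis by (simp add: contrib_def)
qed

text \<open>The two entries along a walk of length two are complex conjugates, so each walk yields a
  squared modulus and \<open>excess\<close> becomes the real covariance in \<open>V\<close>.\<close>

lemma main_sum_2:
  assumes ml: "m = 2" "l = 2"
  shows "of_real (1 / sqrt (real n)) ^ (m + l) * (\<Sum>x\<in>{x \<in> configs. main_config r x}. \<Sum>S\<in>matchings. contrib x S) = V n M r a m"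
proof -
  have len2: "len c = 2" for c using ml unfolding len_def by simp
  have circ2: "circ c = {(c, 0), (c, 1)}" for c by (rule circ_2[OF len2])
  have E: "E = {(1, 0), (1, 1), (2, 0), (2, 1)}" unfolding E_def circ2 by auto
  have nx: "nx (c, 0) = (c, 1)" "nx (c, 1) = (c, 0)" for c using len2 by (auto simp: nx_def)
  have edx: "ed x (c, 0) = (x (c, 0), x (c, 1))" "ed x (c, 1) = (x (c, 1), x (c, 0))" for x c
    by (simp_all only: ed_def nx)
  have S0: "(\<Sum>S\<in>matchings. contrib x S) = contrib x {}" for x
  proof -
    have "(\<Sum>S\<in>matchings. contrib x S) = (\<Sum>S\<in>{{}}. contrib x S)"
      by (rule sum.mono_neutral_right[OF finite_matchings])
         (use empty_matching(1) contrib_nonempty_2[OF ml] in auto)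
    then show ?thesis by simp
  qed
  have "m = l" "m \<noteq> 1" using ml by linarith+
  then have "main_config r x \<longleftrightarrow> (\<forall>e\<in>E. x e \<noteq> x (nx e))" for x
    unfolding main_config_def using ml(1) by blast
  then have main: "{x \<in> configs. main_config r x} = {x \<in> configs. \<forall>e\<in>E. x e \<noteq> x (nx e)}"
    by blast
  have c0: "contrib x {} = of_real (cov2 M (\<lambda>\<omega>. (cmod (a (ed x (1, 0)) \<omega>))\<^sup>2) (\<lambda>\<omega>. (cmod (a (ed x (2, 0)) \<omega>))\<^sup>2))"
    if x: "x \<in> configs" for x
  proof -
    have pr: "(\<Prod>e\<in>circ c. a (ed x e) \<omega>) = complex_of_real ((cmod (a (ed x (c, 0)) \<omega>))\<^sup>2)"
      if "c \<in> {1, 2}" "\<omega> \<in> space M" for c \<omega>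
    proof -
      have cE: "(c, 1) \<in> E" using that(1) unfolding E by auto
      have "a (ed x (c, 1)) \<omega> = cnj (a (ed x (c, 0)) \<omega>)"
        using hermitian_a[OF _ that(2), of "x (c, 1)" "x (c, 0)"] ed_mem[OF x cE] unfolding edx by simp
      then show ?thesis unfolding circ2 by (simp add: complex_norm_square[symmetric])
    qed
    have c12: "1 \<in> {1, 2 :: nat}" "2 \<in> {1, 2 :: nat}" by simp_all
    have prE: "(\<Prod>e\<in>E. a (ed x e) \<omega>) = (\<Prod>e\<in>circ 1. a (ed x e) \<omega>) * (\<Prod>e\<in>circ 2. a (ed x e) \<omega>)" for \<omega>
      unfolding E_def by (rule prod.union_disjoint) (simp_all add: circ_disjoint)
    have mE: "mom E (ed x) = (\<integral>\<omega>. complex_of_real ((cmod (a (ed x (1, 0)) \<omega>))\<^sup>2 * (cmod (a (ed x (2, 0)) \<omega>))\<^sup>2) \<partial>M)"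
      unfolding mom_def prE by (rule Bochner_Integration.integral_cong[OF refl]) (simp only: pr[OF c12(1)] pr[OF c12(2)] of_real_mult)
    have mc: "mom (circ c) (ed x) = (\<integral>\<omega>. complex_of_real ((cmod (a (ed x (c, 0)) \<omega>))\<^sup>2) \<partial>M)" if "c \<in> {1, 2}" for c
      unfolding mom_def by (rule Bochner_Integration.integral_cong[OF refl], rule pr[OF that])
    show ?thesis unfolding contrib_empty excess_def E_circ cov2_def mE[unfolded integral_complex_of_real]
        mc[OF c12(1), unfolded integral_complex_of_real] mc[OF c12(2), unfolded integral_complex_of_real]
      by (simp only: of_real_diff of_real_mult)
  qed
  have "(\<Sum>x\<in>{x \<in> configs. main_config r x}. \<Sum>S\<in>matchings. contrib x S) =
      (\<Sum>x\<in>{x \<in> configs. \<forall>e\<in>E. x e \<noteq> x (nx e)}. contrib x {})"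
    unfolding S0 main ..
  also have "\<dots> = (\<Sum>x\<in>{x \<in> configs. (\<forall>e\<in>E. x e \<noteq> x (nx e)) \<and> (ed x (1, 0), ed x (2, 0)) \<in> r}. contrib x {})"
  proof (rule sum.mono_neutral_right)
    show "\<forall>x\<in>{x \<in> configs. \<forall>e\<in>E. x e \<noteq> x (nx e)} -
        {x \<in> configs. (\<forall>e\<in>E. x e \<noteq> x (nx e)) \<and> (ed x (1, 0), ed x (2, 0)) \<in> r}. contrib x {} = 0"
    proof (rule ballI, rule ccontr)
      fix x assume x: "x \<in> {x \<in> configs. \<forall>e\<in>E. x e \<noteq> x (nx e)} -
        {x \<in> configs. (\<forall>e\<in>E. x e \<noteq> x (nx e)) \<and> (ed x (1, 0), ed x (2, 0)) \<in> r}" "contrib x {} \<noteq> 0"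
      have xc: "x \<in> configs" using DiffD1[OF x(1)] by (simp only: mem_Collect_eq)
      have nr: "(ed x (1, 0), ed x (2, 0)) \<notin> r"
        using DiffD1[OF x(1), unfolded mem_Collect_eq] DiffD2[OF x(1), unfolded mem_Collect_eq] by iprover
      have "contributing r x" using contrib_nonzero[OF xc empty_matching(1) x(2)] .
      then have "\<exists>e\<in>circ 1. \<exists>f\<in>circ 2. (ed x e, ed x f) \<in> r"
        unfolding contributing_def by (rule conjunct2)
      then obtain e f where ef: "e \<in> circ 1" "f \<in> circ 2" "(ed x e, ed x f) \<in> r" by blast
      \<comment> \<open>Both edges of a circle lie in one class, so a relation between any edges of
        the two circles carries over to the edges at position \<open>0\<close>.\<close>
      have sw: "(ed x (c, 0), ed x (c, 1)) \<in> r" if "c \<in> {1, 2}" for c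
      proof -
        have cE: "(c, 0) \<in> E" using that unfolding E by auto
        have "x (c, 0) = x (nx (nx (c, 0)))" by (simp only: nx)
        from ed_swap_related[OF xc cE this] show ?thesis unfolding nx .
      qed
      have "(ed x (1, 0), ed x e) \<in> r"
        using ef(1) sw[of 1] ed_self[OF xc, of "(1, 0)"] unfolding circ2 by (auto simp: E)
      moreover have "(ed x f, ed x (2, 0)) \<in> r"
        using ef(2) r_sym[OF sw[of 2]] ed_self[OF xc, of "(2, 0)"] unfolding circ2 by (auto simp: E)
      ultimately show False using nr r_trans ef(3) by blast
    qed
  qed (use finite_configs in auto)
  also have "\<dots> = (\<Sum>x\<in>{x \<in> configs. (\<forall>e\<in>E. x e \<noteq> x (nx e)) \<and> (ed x (1, 0), ed x (2, 0)) \<in> r}.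
     complex_of_real (cov2 M (\<lambda>\<omega>. (cmod (a (ed x (1, 0)) \<omega>))\<^sup>2) (\<lambda>\<omega>. (cmod (a (ed x (2, 0)) \<omega>))\<^sup>2)))"
    by (rule sum.cong[OF refl]) (rule c0, simp)
  also have "\<dots> = (\<Sum>(P, Q)\<in>{(P, Q) \<in> pairs n \<times> pairs n. fst P \<noteq> snd P \<and> fst Q \<noteq> snd Q \<and> (P, Q) \<in> r}.
     complex_of_real (cov2 M (\<lambda>\<omega>. (cmod (a P \<omega>))\<^sup>2) (\<lambda>\<omega>. (cmod (a Q \<omega>))\<^sup>2)))"
    by (rule sum_over_configs_2[OF ml])
  finally have sum: "(\<Sum>x\<in>{x \<in> configs. main_config r x}. \<Sum>S\<in>matchings. contrib x S) =
    (\<Sum>(P, Q)\<in>{(P, Q) \<in> pairs n \<times> pairs n. fst P \<noteq> snd P \<and> fst Q \<noteq> snd Q \<and> (P, Q) \<in> r}.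
     complex_of_real (cov2 M (\<lambda>\<omega>. (cmod (a P \<omega>))\<^sup>2) (\<lambda>\<omega>. (cmod (a Q \<omega>))\<^sup>2)))" .
  have "of_real (1 / sqrt (real n)) ^ (m + l) = (1 / of_nat n ^ 2 :: complex)"
    using inverse_sqrt_power[of 2] unfolding ml by simp
  moreover have "V n M r a m = 1 / of_nat n ^ 2 * (\<Sum>(P, Q)\<in>{(P, Q) \<in> pairs n \<times> pairs n. fst P \<noteq> snd P \<and> fst Q \<noteq> snd Q \<and> (P, Q) \<in> r}.
     complex_of_real (cov2 M (\<lambda>\<omega>. (cmod (a P \<omega>))\<^sup>2) (\<lambda>\<omega>. (cmod (a Q \<omega>))\<^sup>2)))"
    unfolding V_def using ml(1) by simp
  ultimately show ?thesis unfolding sum by simp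
qed

end

section \<open>Dihedral pairs of walks\<close>

locale equal_circles = covariance_model M n r a s m l
  for M :: "'w measure" and n r a s m l +
  assumes ml: "m = l" and m3: "m \<ge> 3"
begin

lemma len_eq: "len c = m"
  unfolding len_def using ml by simp

text \<open>Translation between edges, numbered from \<open>0\<close>, and positions of a
  multi-index, numbered from \<open>1\<close>.\<close>

definition up :: "nat \<times> nat \<Rightarrow> nat \<times> nat" where
  "up e = (fst e, snd e + 1)"

definition down :: "nat \<times> nat \<Rightarrow> nat \<times> nat" where
  "down u = (fst u, snd u - 1)"

abbreviation index_set :: "(nat \<times> nat) set" where
  "index_set \<equiv> {1, 2} \<times> {1..m}"

lemma E_eq: "e \<in> E \<longleftrightarrow> fst e \<in> {1, 2} \<and> snd e < m"
  unfolding E_iff len_eq by blast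

lemma circ_eq: "e \<in> circ c \<longleftrightarrow> fst e = c \<and> snd e < m"
  unfolding circ_iff len_eq by blast

lemma index_set_iff: "u \<in> index_set \<longleftrightarrow> fst u \<in> {1, 2} \<and> 1 \<le> snd u \<and> snd u \<le> m"
  by (simp only: mem_Times_iff atLeastAtMost_iff)

lemma up_mem: "e \<in> E \<Longrightarrow> up e \<in> index_set"
  unfolding E_eq index_set_iff up_def by simp

lemma down_mem: "u \<in> index_set \<Longrightarrow> down u \<in> E"
  unfolding E_eq index_set_iff down_def fst_conv snd_conv by linarith

lemma down_up: "down (up e) = e"
  by (simp add: up_def down_def)

lemma up_down: "u \<in> index_set \<Longrightarrow> up (down u) = u"
  unfolding index_set_iff by (simp add: up_def down_def prod_eq_iff)

lemma fst_up: "fst (up e) = fst e" and fst_down: "fst (down u) = fst u"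
  by (simp_all add: up_def down_def)

lemma up_nx: "e \<in> E \<Longrightarrow> up (nx e) = (fst e, cyc_next m (snd (up e)))"
proof -
  assume e: "e \<in> E"
  have se: "snd e < m" using e unfolding E_eq by simp
  show ?thesis
  proof (cases "Suc (snd e) = m")
    case True
    then show ?thesis unfolding up_def nx_def len_eq by (simp add: cyc_next_def)
  next
    case False
    then have "Suc (snd e) < m" using se by linarith
    then show ?thesis unfolding up_def nx_def len_eq by (simp add: cyc_next_def)
  qed
qed

lemma up_inj: "up e = up f \<longleftrightarrow> e = f"
  using down_up by metis

lemma down_inj: "u \<in> index_set \<Longrightarrow> v \<in> index_set \<Longrightarrow> down u = down v \<longleftrightarrow> u = v"
  using up_down by metis

section \<open>Contributing dihedral configurations and partners\<close>

definition diagrams :: "(nat \<times> nat \<Rightarrow> nat) set" where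
  "diagrams = {x \<in> configs. contributing r x \<and> (\<forall>e\<in>E. x e \<noteq> x (nx e)) \<and> dihedral_config r x}"

text \<open>Well defined for \<open>e\<close> on the first circle of a diagram, where every class
  has exactly one edge on each circle.\<close>

definition partner :: "(nat \<times> nat \<Rightarrow> nat) \<Rightarrow> nat \<times> nat \<Rightarrow> nat \<times> nat" where
  "partner x e = (THE f. f \<in> circ 2 \<and> (ed x e, ed x f) \<in> r)"

lemma diagramsD:
  assumes x: "x \<in> diagrams"
  shows "x \<in> configs" "contributing r x" "e \<in> E \<Longrightarrow> x e \<noteq> x (nx e)"
    "e \<in> circ c \<Longrightarrow> f \<in> circ c \<Longrightarrow> c \<in> {1, 2} \<Longrightarrow> (ed x e, ed x f) \<in> r \<Longrightarrow> e = f"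
    "e \<in> circ 1 \<Longrightarrow> f \<in> circ 2 \<Longrightarrow> f' \<in> circ 2 \<Longrightarrow> (ed x e, ed x f) \<in> r \<Longrightarrow> (ed x (nx e), ed x f') \<in> r \<Longrightarrow>
       nx f = f' \<or> nx f' = f"
proof -
  show "x \<in> configs" "contributing r x" "e \<in> E \<Longrightarrow> x e \<noteq> x (nx e)"
    using x unfolding diagrams_def by blast+
  have dc: "dihedral_config r x" using x unfolding diagrams_def by blast
  then show "e \<in> circ 1 \<Longrightarrow> f \<in> circ 2 \<Longrightarrow> f' \<in> circ 2 \<Longrightarrow> (ed x e, ed x f) \<in> r \<Longrightarrow> (ed x (nx e), ed x f') \<in> r \<Longrightarrow>
       nx f = f' \<or> nx f' = f"
    unfolding dihedral_config_def by blast
  assume a: "e \<in> circ c" "f \<in> circ c" "c \<in> {1, 2}" "(ed x e, ed x f) \<in> r"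
  have E: "e \<in> E" "f \<in> E" and c: "fst e = c" using a unfolding E_eq circ_eq by auto
  have "f \<in> cls r x e" using a(4) E(2) by (simp add: cls_def)
  moreover have "f \<in> circ (fst e)" using a(2) c by simp
  moreover have "cls r x e \<inter> circ (fst e) = {e}" using dc E(1) unfolding dihedral_config_def by blast
  ultimately have "f \<in> {e}" by (metis IntI)
  then show "e = f" by simp
qed

text \<open>The class of \<open>e\<close> has a second element, which cannot lie on the circle of
  \<open>e\<close>. Two such elements on the other circle would be equivalent and hence
  equal.\<close>

lemma partner:
  assumes x: "x \<in> diagrams" and e: "e \<in> circ 1"
  shows "partner x e \<in> circ 2" "(ed x e, ed x (partner x e)) \<in> r"
    "f \<in> circ 2 \<Longrightarrow> (ed x e, ed x f) \<in> r \<Longrightarrow> f = partner x e"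
proof -
  have eE: "e \<in> E" using e unfolding E_def by blast
  have "card (cls r x e) \<ge> 2" using diagramsD(2)[OF x] eE unfolding contributing_def by blast
  then have "\<not> cls r x e \<subseteq> {e}" using card_mono[of "{e}" "cls r x e"] by auto
  then obtain f0 where f0: "f0 \<in> cls r x e" "f0 \<noteq> e" by blast
  then have fr: "(ed x e, ed x f0) \<in> r" "f0 \<in> E" by (simp_all add: cls_def)
  then have "f0 \<notin> circ 1" using diagramsD(4)[OF x e] f0(2) by blast
  then have f2: "f0 \<in> circ 2" using fr(2) unfolding E_def by blast
  have uniq: "g = f0" if "g \<in> circ 2" "(ed x e, ed x g) \<in> r" for g
  proof -
    have "(ed x f0, ed x g) \<in> r" by (rule r_trans[OF r_sym[OF fr(1)] that(2)])
    from diagramsD(4)[OF x f2 that(1) _ this] show ?thesis by simp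
  qed
  have p: "partner x e = f0" unfolding partner_def
  proof (rule the_equality)
    show "f0 \<in> circ 2 \<and> (ed x e, ed x f0) \<in> r" using f2 fr(1) by blast
    show "g = f0" if "g \<in> circ 2 \<and> (ed x e, ed x g) \<in> r" for g using uniq that by blast
  qed
  show "partner x e \<in> circ 2" "(ed x e, ed x (partner x e)) \<in> r" unfolding p by (rule f2, rule fr(1))
  show "f \<in> circ 2 \<Longrightarrow> (ed x e, ed x f) \<in> r \<Longrightarrow> f = partner x e" unfolding p by (rule uniq)
qed

lemma partner_inj: "x \<in> diagrams \<Longrightarrow> inj_on (partner x) (circ 1)"
proof (rule inj_onI)
  fix e f assume x: "x \<in> diagrams" and ef: "e \<in> circ 1" "f \<in> circ 1" "partner x e = partner x f"
  have "(ed x e, ed x f) \<in> r" using partner(2)[OF x ef(1)] r_sym[OF partner(2)[OF x ef(2)]] r_trans ef(3) by metis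
  then show "e = f" using diagramsD(4)[OF x ef(1,2)] by blast
qed

lemma partner_image: "x \<in> diagrams \<Longrightarrow> partner x ` circ 1 = circ 2"
proof -
  assume x: "x \<in> diagrams"
  have "card (partner x ` circ 1) = card (circ 2)"
    unfolding card_image[OF partner_inj[OF x]] card_circ len_eq ..
  then show ?thesis using partner(1)[OF x] by (intro card_subset_eq) auto
qed

text \<open>The classes of a diagram are the pairs of partners, so one pair at a time splits off
  from the moment.\<close>

lemma mom_partners:
  assumes x: "x \<in> diagrams" and A: "finite A" "A \<subseteq> circ 1"
  shows "mom (A \<union> partner x ` A) (ed x) = (\<Prod>e\<in>A. \<integral>\<omega>. a (ed x e) \<omega> * a (ed x (partner x e)) \<omega> \<partial>M)"
  using A
proof (induction A rule: finite_induct)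
  case (insert e A)
  let ?h = "partner x"
  have e: "e \<in> circ 1" and A: "A \<subseteq> circ 1" using insert.prems by auto
  have h2: "?h g \<in> circ 2" if "g \<in> circ 1" for g using partner(1)[OF x that] .
  have d12: "g \<noteq> f" if "g \<in> circ 1" "f \<in> circ 2" for g f using that unfolding circ_eq by auto
  have sub: "insert e A \<union> ?h ` insert e A \<subseteq> E" using e A h2 unfolding E_def by blast
  have rel: "(ed x g, ed x (?h g)) \<in> r" if "g \<in> circ 1" for g using partner(2)[OF x that] .
  have "mom (insert e A \<union> ?h ` insert e A) (ed x) = mom {e, ?h e} (ed x) * mom (A \<union> ?h ` A) (ed x)"
  proof (rule mom_split)
    show "finite (insert e A \<union> ?h ` insert e A)" using insert.hyps by simp
    show "ed x ` (insert e A \<union> ?h ` insert e A) \<subseteq> pairs n" by (rule ed_configs[OF diagramsD(1)[OF x] sub])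
    show "insert e A \<union> ?h ` insert e A = {e, ?h e} \<union> (A \<union> ?h ` A)" by blast
    have "?h e \<notin> ?h ` A"
    proof
      assume "?h e \<in> ?h ` A"
      then obtain g where g: "g \<in> A" "?h e = ?h g" by blast
      then have "g \<in> circ 1" using A by blast
      then have "e = g" using inj_onD[OF partner_inj[OF x] g(2) e] by blast
      then show False using g(1) insert.hyps by blast
    qed
    moreover have "e \<notin> ?h ` A" using d12[OF e] h2 A by blast
    moreover have "?h e \<notin> A" using d12[OF _ h2[OF e]] A by blast
    ultimately show "{e, ?h e} \<inter> (A \<union> ?h ` A) = {}" using insert.hyps by blast
    fix g f assume gf: "g \<in> {e, ?h e}" "f \<in> A \<union> ?h ` A"
    show "(ed x g, ed x f) \<notin> r"
    proof
      assume r: "(ed x g, ed x f) \<in> r"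
      have eg: "(ed x e, ed x g) \<in> r"
        using gf(1) rel[OF e] ed_self[OF diagramsD(1)[OF x], of e] e unfolding E_def by blast
      obtain f0 where f0: "f0 \<in> A" "f = f0 \<or> f = ?h f0" using gf(2) by blast
      then have f0c: "f0 \<in> circ 1" using A by blast
      have "(ed x f, ed x f0) \<in> r"
        using f0(2) r_sym[OF rel[OF f0c]] ed_self[OF diagramsD(1)[OF x], of f0] f0c unfolding E_def by blast
      then have "(ed x e, ed x f0) \<in> r" using r_trans[OF r_trans[OF eg r]] by blast
      then have "e = f0" using diagramsD(4)[OF x e f0c] by blast
      then show False using f0(1) insert.hyps by blast
    qed
  qed
  moreover have "mom {e, ?h e} (ed x) = (\<integral>\<omega>. a (ed x e) \<omega> * a (ed x (?h e)) \<omega> \<partial>M)"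
    unfolding mom_def using d12[OF e h2[OF e]] by simp
  ultimately show ?case using insert.IH[OF A] insert.hyps by simp
qed simp

lemma mom_diagram:
  assumes x: "x \<in> diagrams"
  shows "mom E (ed x) = (\<Prod>e\<in>circ 1. \<integral>\<omega>. a (ed x e) \<omega> * a (ed x (partner x e)) \<omega> \<partial>M)"
  using mom_partners[OF x finite_circ order_refl] unfolding partner_image[OF x] E_def .

text \<open>No two edges on a circle of a diagram are equivalent. So a matched pair, which would
  have to backtrack, makes the coefficient vanish, and the product of means is zero because every
  edge is isolated on its circle.\<close>

lemma main_sum_diagrams:
  "(\<Sum>x\<in>{x \<in> configs. main_config r x}. \<Sum>S\<in>matchings. contrib x S) = (\<Sum>x\<in>diagrams. mom E (ed x))"
proof -
  have mne: "m \<noteq> 1" "m \<noteq> 2" using m3 by linarith+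
  have main: "main_config r x \<longleftrightarrow> (\<forall>e\<in>E. x e \<noteq> x (nx e)) \<and> dihedral_config r x" for x
    unfolding main_config_def using ml mne by blast
  have fin: "finite {x \<in> configs. main_config r x}" using finite_configs by simp
  have sub: "diagrams \<subseteq> {x \<in> configs. main_config r x}" unfolding main diagrams_def by blast
  have "(\<Sum>x\<in>{x \<in> configs. main_config r x}. \<Sum>S\<in>matchings. contrib x S) =
      (\<Sum>x\<in>diagrams. \<Sum>S\<in>matchings. contrib x S)"
  proof (rule sum.mono_neutral_right[OF fin sub], rule ballI, rule sum.neutral, rule ballI, rule ccontr)
    fix x S assume x: "x \<in> {x \<in> configs. main_config r x} - diagrams" and S: "S \<in> matchings" "contrib x S \<noteq> 0"
    have xc: "x \<in> configs" "main_config r x" using DiffD1[OF x] unfolding mem_Collect_eq by iprover+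
    have "contributing r x" by (rule contrib_nonzero[OF xc(1) S])
    then have "x \<in> diagrams" unfolding diagrams_def mem_Collect_eq
      using xc(1) xc(2)[unfolded main] by iprover
    then show False by (rule DiffD2[OF x])
  qed
  also have "\<dots> = (\<Sum>x\<in>diagrams. mom E (ed x))"
  proof (rule sum.cong[OF refl])
    fix x assume x: "x \<in> diagrams"
    have "contrib x S = 0" if S: "S \<in> matchings" "S \<noteq> {}" for S
    proof -
      obtain e where e: "e \<in> S" using S(2) by blast
      have SE: "S \<subseteq> E" using S(1) unfolding matchings_def by blast
      have eE: "e \<in> E" using e SE by blast
      have ec: "e \<in> circ (fst e)" "nx e \<in> circ (fst e)" "fst e \<in> {1, 2}"
        using eE nx_circ[of e "fst e"] unfolding E_eq circ_eq by auto
      have "nx e \<noteq> e" by (rule nx_ne[OF ec(1)]) (use len_eq m3 in simp)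
      then have "x e \<noteq> x (nx (nx e))"
        using ed_swap_related[OF diagramsD(1)[OF x] eE, THEN diagramsD(4)[OF x ec]] by metis
      then have "(x e = x (nx (nx e))) = False" by blast
      then have "- of_real (s\<^sup>2) * of_bool (x e = x (nx (nx e))) = (0 :: complex)"
        by (simp only: of_bool_eq mult_zero_right)
      then have "\<exists>e\<in>S. - of_real (s\<^sup>2) * of_bool (x e = x (nx (nx e))) = (0 :: complex)"
        using e by (rule bexI)
      then have "coef x S = 0" unfolding coef_def by (rule prod_zero[OF finite_subset[OF SE finite_E]])
      then show ?thesis by (simp add: contrib_def)
    qed
    then have "(\<Sum>S\<in>matchings. contrib x S) = (\<Sum>S\<in>{{}}. contrib x S)"
      by (intro sum.mono_neutral_right[OF finite_matchings]) (use empty_matching(1) in auto)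
    also have "\<dots> = excess E x" by (simp add: contrib_empty)
    also have "\<dots> = mom E (ed x)"
    proof -
      have e: "(1, 0) \<in> circ 1" unfolding circ_eq using m3 by simp
      have E1: "circ 1 \<subseteq> E" unfolding E_def by blast
      have "mom (circ 1) (ed x) = 0"
        by (rule mom_isolated[OF finite_circ ed_configs[OF diagramsD(1)[OF x] E1] e])
           (use diagramsD(4)[OF x e] in blast)
      then show ?thesis unfolding excess_def E_circ by simp
    qed
    finally show "(\<Sum>S\<in>matchings. contrib x S) = mom E (ed x)" .
  qed
  finally show ?thesis .
qed

section \<open>Diagrams as compatible multi-indices\<close>

definition to_index :: "(nat \<times> nat \<Rightarrow> nat) \<Rightarrow> nat \<times> nat \<Rightarrow> nat \<times> nat" where
  "to_index x = (\<lambda>u\<in>index_set. ed x (down u))"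

text \<open>The identity outside \<open>{1..m}\<close> is what \<open>permutes\<close>
  demands.\<close>

definition to_perm :: "(nat \<times> nat \<Rightarrow> nat) \<Rightarrow> nat \<Rightarrow> nat" where
  "to_perm x k = (if k \<in> {1..m} then snd (up (partner x (down (1, k)))) else k)"

definition of_index :: "(nat \<times> nat \<Rightarrow> nat \<times> nat) \<Rightarrow> nat \<times> nat \<Rightarrow> nat" where
  "of_index P = (\<lambda>e\<in>E. fst (P (up e)))"

lemma down_1: "k \<in> {1..m} \<Longrightarrow> down (1, k) \<in> circ 1"
  unfolding circ_eq down_def by auto

lemma to_perm_up:
  assumes x: "x \<in> diagrams" and k: "k \<in> {1..m}"
  shows "(2, to_perm x k) = up (partner x (down (1, k)))"
proof -
  have "fst (partner x (down (1, k))) = 2" using partner(1)[OF x down_1[OF k]] unfolding circ_eq by simp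
  then show ?thesis using k unfolding to_perm_def by (simp add: prod_eq_iff fst_up)
qed

lemma cyc_neighbors_up:
  assumes "e \<in> circ c" "f \<in> circ c" "c \<in> {1, 2}"
  shows "cyc_neighbors m (snd (up e)) (snd (up f)) \<longleftrightarrow> nx e = f \<or> nx f = e"
proof -
  have E: "e \<in> E" "f \<in> E" "fst e = c" "fst f = c" using assms unfolding E_eq circ_eq by auto
  have "nx e = f \<longleftrightarrow> snd (up f) = cyc_next m (snd (up e))"
    using up_nx[OF E(1)] up_inj[of "nx e" f] E(3,4) by (metis fst_up prod.collapse snd_conv)
  moreover have "nx f = e \<longleftrightarrow> snd (up e) = cyc_next m (snd (up f))"
    using up_nx[OF E(2)] up_inj[of "nx f" e] E(3,4) by (metis fst_up prod.collapse snd_conv)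
  ultimately show ?thesis unfolding cyc_neighbors_def by blast
qed

text \<open>Injectivity is that of \<open>partner\<close>; neighbours go to neighbours by the second
  condition in \<open>dihedral_config\<close>.\<close>

lemma to_perm_dihedral:
  assumes x: "x \<in> diagrams" shows "to_perm x \<in> dihedral m"
proof -
  have mem: "to_perm x k \<in> {1..m}" if k: "k \<in> {1..m}" for k
  proof -
    have "partner x (down (1, k)) \<in> E" using partner(1)[OF x down_1[OF k]] unfolding E_def by blast
    from up_mem[OF this] show ?thesis unfolding to_perm_up[OF x k, symmetric] by simp
  qed
  have inj: "inj_on (to_perm x) {1..m}"
  proof (rule inj_onI)
    fix k k' assume k: "k \<in> {1..m}" "k' \<in> {1..m}" "to_perm x k = to_perm x k'"
    have "up (partner x (down (1, k))) = up (partner x (down (1, k')))"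
      using to_perm_up[OF x k(1)] to_perm_up[OF x k(2)] k(3) by metis
    then have "partner x (down (1, k)) = partner x (down (1, k'))" unfolding up_inj .
    then have "down (1, k) = down (1, k')" by (rule inj_onD[OF partner_inj[OF x] _ down_1[OF k(1)] down_1[OF k(2)]])
    then have "(1 :: nat, k) = (1, k')" using k(1,2) by (subst (asm) down_inj) auto
    then show "k = k'" by simp
  qed
  have "to_perm x ` {1..m} \<subseteq> {1..m}" using mem by blast
  then have "to_perm x ` {1..m} = {1..m}"
    by (rule card_subset_eq[OF finite_atLeastAtMost _ card_image[OF inj]])
  then have bij: "bij_betw (to_perm x) {1..m} {1..m}" by (rule bij_betw_imageI[OF inj])
  have perm: "to_perm x permutes {1..m}"
  proof (rule bij_imp_permutes[OF bij])
    show "to_perm x k = k" if "k \<notin> {1..m}" for k unfolding to_perm_def by (rule if_not_P[OF that])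
  qed
  have "cyc_neighbors m (to_perm x k) (to_perm x k')"
    if k: "k \<in> {1..m}" "k' \<in> {1..m}" "cyc_neighbors m k k'" for k k'
  proof -
    let ?e = "down (1, k)" and ?e' = "down (1, k')"
    have e: "?e \<in> circ 1" "?e' \<in> circ 1" using down_1 k by blast+
    have I: "(1, k) \<in> index_set" "(1, k') \<in> index_set" using k by auto
    have "cyc_neighbors m (snd (up ?e)) (snd (up ?e'))" unfolding up_down[OF I(1)] up_down[OF I(2)] using k(3) by simp
    then have nb: "nx ?e = ?e' \<or> nx ?e' = ?e" using cyc_neighbors_up[OF e insertI1] by blast
    let ?f = "partner x ?e" and ?f' = "partner x ?e'"
    note p = partner(1,2)[OF x e(1)] partner(1,2)[OF x e(2)]
    have "nx ?f = ?f' \<or> nx ?f' = ?f"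
      using nb
    proof
      assume "nx ?e = ?e'"
      then have "(ed x (nx ?e), ed x ?f') \<in> r" using p(4) by simp
      from diagramsD(5)[OF x e(1) p(1) p(3) p(2) this] show ?thesis .
    next
      assume "nx ?e' = ?e"
      then have "(ed x (nx ?e'), ed x ?f) \<in> r" using p(2) by simp
      from diagramsD(5)[OF x e(2) p(3) p(1) p(4) this] show ?thesis by blast
    qed
    then have "cyc_neighbors m (snd (up ?f)) (snd (up ?f'))"
      using cyc_neighbors_up[OF p(1) p(3) insertI2[OF singletonI]] by blast
    then show ?thesis unfolding to_perm_up[OF x k(1), symmetric] to_perm_up[OF x k(2), symmetric] by simp
  qed
  then show ?thesis using perm unfolding dihedral_def by blast
qed

text \<open>Compatibility demands equivalence exactly within blocks: in a diagram, edges of one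
  circle are equivalent only if equal, and edges of different circles only if they are
  partners.\<close>

lemma to_index_S_OD:
  assumes x: "x \<in> diagrams" shows "to_index x \<in> S_OD n m r (pi_hat m (to_perm x))"
proof -
  have xc: "x \<in> configs" by (rule diagramsD(1)[OF x])
  have T: "to_index x u = ed x (down u)" if "u \<in> index_set" for u using that by (simp add: to_index_def)
  have cons: "to_index x \<in> consistent_indices n m"
  proof -
    have "to_index x \<in> index_set \<rightarrow>\<^sub>E pairs n"
      unfolding to_index_def by (rule restrict_PiE_iff[THEN iffD2]) (use ed_mem[OF xc down_mem] in blast)
    moreover have "snd (to_index x (i, k)) = fst (to_index x (i, cyc_next m k))"
      if i: "i \<in> {1, 2}" and k: "k \<in> {1..m}" for i k
    proof -
      have I: "(i, k) \<in> index_set" using i k by blast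
      have "up (nx (down (i, k))) = (i, cyc_next m k)"
        unfolding up_nx[OF down_mem[OF I]] up_down[OF I] fst_down by simp
      moreover from this have I': "(i, cyc_next m k) \<in> index_set"
        using up_mem[OF nx_in_E[OF down_mem[OF I]]] by simp
      ultimately have "nx (down (i, k)) = down (i, cyc_next m k)" using down_up by metis
      then show ?thesis unfolding T[OF I] T[OF I'] ed_def by simp
    qed
    ultimately show ?thesis unfolding consistent_indices_def by blast
  qed
  have comp: "compatible m r (pi_hat m (to_perm x)) (to_index x)"
    unfolding compatible_def
  proof (intro ballI iffI)
    fix u v assume uv: "u \<in> index_set" "v \<in> index_set" and r0: "(to_index x u, to_index x v) \<in> r"
    have r: "(ed x (down u), ed x (down v)) \<in> r" using r0 unfolding T[OF uv(1)] T[OF uv(2)] .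
    have own: "u = v" if "fst u = fst v"
    proof -
      have "down u \<in> circ (fst u)" "down v \<in> circ (fst u)" "fst u \<in> {1, 2}"
        using that down_mem[OF uv(1)] down_mem[OF uv(2)] unfolding E_eq circ_eq fst_down by (simp_all only:)
      from diagramsD(4)[OF x this r] show ?thesis using down_inj[OF uv] by blast
    qed
    have cross: "\<exists>k\<in>{1..m}. u = (1, k) \<and> v = (2, to_perm x k)"
      if uv: "u \<in> index_set" "v \<in> index_set" "fst u = 1" "fst v = 2" "(ed x (down u), ed x (down v)) \<in> r" for u v
    proof -
      have k: "snd u \<in> {1..m}" "u = (1, snd u)" using uv unfolding index_set_iff by (auto simp: prod_eq_iff)
      have "down v \<in> circ 2" using uv down_mem[of v] unfolding E_eq circ_eq fst_down by blast
      moreover have "down u \<in> circ 1" using uv down_mem[of u] unfolding E_eq circ_eq fst_down by blast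
      ultimately have "down v = partner x (down u)" using partner(3)[OF x] uv(5) by blast
      then have "v = up (partner x (down u))" using up_down[OF uv(2)] by metis
      then have "v = (2, to_perm x (snd u))" using to_perm_up[OF x k(1)] k(2) by metis
      then show ?thesis using k by blast
    qed
    have "\<exists>k\<in>{1..m}. u \<in> {(1, k), (2, to_perm x k)} \<and> v \<in> {(1, k), (2, to_perm x k)}"
    proof (cases "fst u = 1")
      case u1: True
      show ?thesis
      proof (cases "fst v = 1")
        case True
        then have "u = v" using own u1 by simp
        moreover have "snd u \<in> {1..m}" "u = (1, snd u)" using uv u1 unfolding index_set_iff by (auto simp: prod_eq_iff)
        ultimately show ?thesis by blast
      next
        case False
        then have "fst v = 2" using uv(2) unfolding index_set_iff by blast
        then show ?thesis using cross[OF uv u1 _ r] by blast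
      qed
    next
      case False
      then have u2: "fst u = 2" using uv(1) unfolding index_set_iff by blast
      show ?thesis
      proof (cases "fst v = 1")
        case True
        then show ?thesis using cross[OF uv(2,1) True u2 r_sym[OF r]] by blast
      next
        case False
        then have v2: "fst v = 2" using uv(2) unfolding index_set_iff by blast
        then have uveq: "u = v" using own u2 by simp
        have "down u \<in> circ 2" using uv u2 down_mem[of u] unfolding E_eq circ_eq fst_down by blast
        then obtain e where e: "e \<in> circ 1" "down u = partner x e" using partner_image[OF x] by blast
        have eI: "up e \<in> index_set" using e(1) up_mem unfolding E_def by blast
        have k: "snd (up e) \<in> {1..m}" "up e = (1, snd (up e))"
          using eI e(1) unfolding index_set_iff circ_eq by (auto simp: prod_eq_iff fst_up)
        have "(2, to_perm x (snd (up e))) = up (partner x (down (up e)))" using to_perm_up[OF x k(1)] k(2) by metis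
        also have "\<dots> = u" unfolding down_up e(2)[symmetric] by (rule up_down[OF uv(1)])
        finally show ?thesis using k(1) uveq by blast
      qed
    qed
    then obtain k where k: "k \<in> {1..m}" "u \<in> {(1, k), (2, to_perm x k)} \<and> v \<in> {(1, k), (2, to_perm x k)}"
      by (rule bexE)
    show "\<exists>B\<in>pi_hat m (to_perm x). u \<in> B \<and> v \<in> B"
      unfolding pi_hat_def by (rule bexI, rule k(2), rule imageI, rule k(1))
  next
    fix u v assume uv: "u \<in> index_set" "v \<in> index_set" and B: "\<exists>B\<in>pi_hat m (to_perm x). u \<in> B \<and> v \<in> B"
    obtain k where k: "k \<in> {1..m}" "u \<in> {(1, k), (2, to_perm x k)}" "v \<in> {(1, k), (2, to_perm x k)}"
      using B unfolding pi_hat_def by (elim bexE imageE conjE) simp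
    let ?e = "down (1, k)"
    have e: "?e \<in> circ 1" by (rule down_1[OF k(1)])
    have dp: "down (2, to_perm x k) = partner x ?e" unfolding to_perm_up[OF x k(1)] down_up ..
    have eE: "?e \<in> E" using e unfolding E_def by blast
    have "(ed x ?e, ed x (down w)) \<in> r" if w: "w \<in> {(1, k), (2, to_perm x k)}" for w
      using w
    proof (rule insertE)
      assume 1: "w = (1, k)"
      show ?thesis unfolding 1 by (rule ed_self[OF xc eE])
    next
      assume "w \<in> {(2, to_perm x k)}"
      then have 2: "w = (2, to_perm x k)" by (rule singletonD)
      show ?thesis unfolding 2 dp by (rule partner(2)[OF x e])
    qed
    note uv_r = this[OF k(2)] this[OF k(3)]
    show "(to_index x u, to_index x v) \<in> r"
      unfolding T[OF uv(1)] T[OF uv(2)] by (rule r_trans[OF r_sym[OF uv_r(1)] uv_r(2)])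
  qed
  have "fst (to_index x u) \<noteq> snd (to_index x u)" if u: "u \<in> index_set" for u
    unfolding T[OF u] ed_def fst_conv snd_conv by (rule diagramsD(3)[OF x down_mem[OF u]])
  then show ?thesis using cons comp unfolding S_OD_def by blast
qed

lemma of_to_index:
  assumes x: "x \<in> diagrams" shows "of_index (to_index x) = x"
proof
  fix e
  show "of_index (to_index x) e = x e"
  proof (cases "e \<in> E")
    case True
    then show ?thesis using up_mem[OF True] unfolding of_index_def to_index_def
      by (simp only: restrict_apply' if_True down_up ed_def fst_conv)
  next
    case False
    then show ?thesis using PiE_arb[OF diagramsD(1)[OF x] False] unfolding of_index_def by simp
  qed
qed

lemma ed_of_index:
  assumes P: "P \<in> consistent_indices n m" and e: "e \<in> E"
  shows "ed (of_index P) e = P (up e)"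
proof -
  have I: "up e \<in> index_set" by (rule up_mem[OF e])
  then have ik: "fst (up e) \<in> {1, 2}" "snd (up e) \<in> {1..m}" by (simp_all only: mem_Times_iff)
  have "snd (P (fst (up e), snd (up e))) = fst (P (fst (up e), cyc_next m (snd (up e))))"
    using P ik unfolding consistent_indices_def by blast
  then have "snd (P (up e)) = fst (P (up (nx e)))" unfolding up_nx[OF e] fst_up by (simp add: up_def)
  then show ?thesis unfolding ed_def of_index_def using e nx_in_E[OF e] by (simp add: prod_eq_iff)
qed

text \<open>The blocks of \<open>g\<close> become classes with one edge on each circle, and the
  dihedral property of \<open>g\<close> supplies the condition on neighbours.\<close>

lemma of_index_diagrams:
  assumes g: "g \<in> dihedral m" and P: "P \<in> S_OD n m r (pi_hat m g)"
  shows "of_index P \<in> diagrams"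
    and "k \<in> {1..m} \<Longrightarrow> (ed (of_index P) (down (1, k)), ed (of_index P) (down (2, g k))) \<in> r"
proof -
  let ?x = "of_index P"
  have Pc: "P \<in> consistent_indices n m" and comp: "compatible m r (pi_hat m g) P"
    and od: "\<And>u. u \<in> index_set \<Longrightarrow> fst (P u) \<noteq> snd (P u)"
    using P unfolding S_OD_def by blast+
  have Pm: "P \<in> index_set \<rightarrow>\<^sub>E pairs n" using Pc unfolding consistent_indices_def by blast
  have gp: "g permutes {1..m}" and gn: "\<And>k k'. k \<in> {1..m} \<Longrightarrow> k' \<in> {1..m} \<Longrightarrow> cyc_neighbors m k k' \<Longrightarrow> cyc_neighbors m (g k) (g k')"
    using g unfolding dihedral_def by blast+
  have gm: "g k \<in> {1..m}" if "k \<in> {1..m}" for k using permutes_in_image[OF gp] that by blast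
  have gi: "g k = g k' \<longleftrightarrow> k = k'" for k k' using permutes_inj[OF gp] by (auto dest: injD)
  note edP = ed_of_index[OF Pc]
  have rel: "(ed ?x e, ed ?x f) \<in> r \<longleftrightarrow> (\<exists>k\<in>{1..m}. up e \<in> {(1, k), (2, g k)} \<and> up f \<in> {(1, k), (2, g k)})"
    if "e \<in> E" "f \<in> E" for e f
    unfolding edP[OF that(1)] edP[OF that(2)]
    using comp up_mem[OF that(1)] up_mem[OF that(2)] unfolding compatible_def pi_hat_def by (simp only: bex_simps) blast
  have xc: "?x \<in> configs"
  proof (rule PiE_I)
    fix e assume e: "e \<in> E"
    have "P (up e) \<in> pairs n" using Pm up_mem[OF e] by (rule PiE_mem)
    then show "?x e \<in> {1..n}" using e unfolding of_index_def by (simp add: mem_Times_iff)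
  qed (simp add: of_index_def)
  have I1: "(1, k) \<in> index_set" "(2, g k) \<in> index_set" if "k \<in> {1..m}" for k using that gm[OF that] by blast+
  show sp: "(ed ?x (down (1, k)), ed ?x (down (2, g k))) \<in> r" if k: "k \<in> {1..m}" for k
    unfolding rel[OF down_mem[OF I1(1)[OF k]] down_mem[OF I1(2)[OF k]]] up_down[OF I1(1)[OF k]] up_down[OF I1(2)[OF k]]
    using k by blast
  have own: "e = f" if ef: "e \<in> circ c" "f \<in> circ c" "c \<in> {1, 2}" "(ed ?x e, ed ?x f) \<in> r" for c e f
  proof -
    have E: "e \<in> E" "f \<in> E" "fst e = c" "fst f = c" using ef unfolding E_eq circ_eq by auto
    obtain k where k: "up e \<in> {(1, k), (2, g k)}" "up f \<in> {(1, k), (2, g k)}"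
      using rel[OF E(1,2), THEN iffD1, OF ef(4)] by (elim bexE conjE) simp
    have "fst (up e) = fst (up f)" using E fst_up by metis
    then have "up e = up f" using k unfolding insert_iff empty_iff by (elim disjE FalseE) simp_all
    then show ?thesis unfolding up_inj .
  qed
  have noloop: "?x e \<noteq> ?x (nx e)" if e: "e \<in> E" for e
    using od[OF up_mem[OF e]] unfolding edP[OF e, symmetric] ed_def by simp
  have cls_own: "cls r ?x e \<inter> circ (fst e) = {e}" if e: "e \<in> E" for e
  proof -
    have c: "e \<in> circ (fst e)" "fst e \<in> {1, 2}" using e unfolding E_eq circ_eq by auto
    have "f = e" if "f \<in> cls r ?x e" "f \<in> circ (fst e)" for f
      using own[OF c(1) that(2) c(2)] that(1) unfolding cls_def by blast
    moreover have "e \<in> cls r ?x e" using ed_self[OF xc e] e unfolding cls_def by blast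
    ultimately show ?thesis using c(1) by blast
  qed
  have other: "\<exists>k\<in>{1..m}. e = down (1, k) \<or> e = down (2, g k)" if e: "e \<in> E" for e
  proof -
    have "(ed ?x e, ed ?x e) \<in> r" by (rule ed_self[OF xc e])
    from rel[OF e e, THEN iffD1, OF this]
    obtain k where "k \<in> {1..m}" "up e = (1, k) \<or> up e = (2, g k)" by (elim bexE conjE) simp
    then show ?thesis using down_up by metis
  qed
  have two: "card (cls r ?x e) \<ge> 2" if e: "e \<in> E" for e
  proof -
    obtain k where k: "k \<in> {1..m}" "e = down (1, k) \<or> e = down (2, g k)" using other[OF e] by blast
    let ?p = "down (1, k)" and ?q = "down (2, g k)"
    have pq: "?p \<in> E" "?q \<in> E" "?p \<noteq> ?q"
      using down_mem[OF I1(1)[OF k(1)]] down_mem[OF I1(2)[OF k(1)]] by (auto simp: down_def)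
    have "(ed ?x e, ed ?x ?p) \<in> r" "(ed ?x e, ed ?x ?q) \<in> r"
      using k(2) sp[OF k(1)] r_sym[OF sp[OF k(1)]] ed_self[OF xc pq(1)] ed_self[OF xc pq(2)] by auto
    then have "{?p, ?q} \<subseteq> cls r ?x e" using pq unfolding cls_def by blast
    then have "card {?p, ?q} \<le> card (cls r ?x e)" by (intro card_mono) (auto simp: cls_def)
    then show ?thesis using pq(3) by simp
  qed
  have one: "1 \<in> {1..m}" using m3 by simp
  have c2: "down (2, g k) \<in> circ 2" if "k \<in> {1..m}" for k
    using gm[OF that] unfolding circ_eq down_def by auto
  have contr: "contributing r ?x"
    unfolding contributing_def using two sp[OF one] down_1[OF one] c2[OF one] by blast
  have nb: "nx f = f' \<or> nx f' = f"
    if ef: "e \<in> circ 1" "f \<in> circ 2" "f' \<in> circ 2" "(ed ?x e, ed ?x f) \<in> r" "(ed ?x (nx e), ed ?x f') \<in> r" for e f f'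
  proof -
    have ne: "nx e \<in> circ 1" by (rule nx_circ[OF ef(1)])
    have E: "e \<in> E" "f \<in> E" "f' \<in> E" "nx e \<in> E" using ef(1-3) ne unfolding E_def by blast+
    have fs: "fst (up e) = 1" "fst (up f) = 2" "fst (up f') = 2" "fst (up (nx e)) = 1"
      using ef(1-3) ne unfolding circ_eq fst_up by blast+
    obtain k where k: "k \<in> {1..m}" "up e = (1, k)" "up f = (2, g k)"
      using rel[OF E(1,2), THEN iffD1, OF ef(4)] fs(1,2) unfolding insert_iff empty_iff
      by (elim bexE conjE disjE FalseE) simp_all
    obtain k' where k': "k' \<in> {1..m}" "up (nx e) = (1, k')" "up f' = (2, g k')"
      using rel[OF E(4,3), THEN iffD1, OF ef(5)] fs(3,4) unfolding insert_iff empty_iff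
      by (elim bexE conjE disjE FalseE) simp_all
    have "cyc_neighbors m (snd (up e)) (snd (up (nx e)))"
      using cyc_neighbors_up[OF ef(1) ne insertI1] by blast
    then have "cyc_neighbors m (g k) (g k')" using gn[OF k(1) k'(1)] unfolding k(2) k'(2) by simp
    then have "cyc_neighbors m (snd (up f)) (snd (up f'))" unfolding k(3) k'(3) by simp
    then show ?thesis using cyc_neighbors_up[OF ef(2,3) insertI2[OF singletonI]] by blast
  qed
  have "dihedral_config r ?x" unfolding dihedral_config_def using cls_own nb by blast
  then show "?x \<in> diagrams" unfolding diagrams_def using xc contr noloop by blast
qed

lemma to_of_index:
  assumes g: "g \<in> dihedral m" and P: "P \<in> S_OD n m r (pi_hat m g)"
  shows "to_index (of_index P) = P" "to_perm (of_index P) = g"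
proof -
  let ?x = "of_index P"
  have Pc: "P \<in> consistent_indices n m" using P unfolding S_OD_def by blast
  have Pm: "P \<in> index_set \<rightarrow>\<^sub>E pairs n" using Pc unfolding consistent_indices_def by blast
  note x = of_index_diagrams(1)[OF g P]
  show "to_index ?x = P"
  proof
    fix u
    show "to_index ?x u = P u"
    proof (cases "u \<in> index_set")
      case True
      then show ?thesis unfolding to_index_def using ed_of_index[OF Pc down_mem[OF True]] up_down[OF True]
        by (simp only: restrict_apply' if_True)
    next
      case False
      then show ?thesis using PiE_arb[OF Pm False] unfolding to_index_def by (simp only: restrict_apply if_False)
    qed
  qed
  have gp: "g permutes {1..m}" using g unfolding dihedral_def by blast
  show "to_perm ?x = g"
  proof
    fix k
    show "to_perm ?x k = g k"
    proof (cases "k \<in> {1..m}")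
      case True
      have gk: "g k \<in> {1..m}" using permutes_in_image[OF gp] True by blast
      have I: "(2, g k) \<in> index_set" using gk by blast
      have "down (2, g k) \<in> circ 2" using gk unfolding circ_eq down_def by auto
      then have "down (2, g k) = partner ?x (down (1, k))"
        by (rule partner(3)[OF x down_1[OF True] _ of_index_diagrams(2)[OF g P True]])
      then have "(2 :: nat, to_perm ?x k) = (2, g k)" using to_perm_up[OF x True] up_down[OF I] by metis
      then show ?thesis by simp
    next
      case False
      then show ?thesis unfolding permutes_not_in[OF gp False] to_perm_def by (rule if_not_P)
    qed
  qed
qed

text \<open>The walks determine \<open>g\<close> through their partners, so no diagram is counted
  for two permutations and the double sum in \<open>V\<close> is a sum over diagrams.\<close>

lemma main_sum_3:
  "of_real (1 / sqrt (real n)) ^ (m + l) * (\<Sum>x\<in>{x \<in> configs. main_config r x}. \<Sum>S\<in>matchings. contrib x S) = V n M r a m"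
proof -
  let ?G = "\<lambda>g P. \<Prod>k\<in>{1..m}. \<integral>\<omega>. a (P (1, k)) \<omega> * a (P (2, g k)) \<omega> \<partial>M"
  have finD: "finite (dihedral m)"
    by (rule finite_subset[of _ "{p. p permutes {1..m}}"]) (auto simp: dihedral_def finite_permutations)
  have finS: "finite (S_OD n m r \<pi>)" for \<pi>
    by (rule finite_subset[of _ "index_set \<rightarrow>\<^sub>E pairs n"])
       (auto simp: S_OD_def consistent_indices_def intro!: finite_PiE)
  have eq: "?G (to_perm x) (to_index x) = mom E (ed x)" if x: "x \<in> diagrams" for x
  proof -
    have img: "circ 1 = (\<lambda>k. down (1, k)) ` {1..m}"
    proof (intro equalityI subsetI)
      fix e assume e: "e \<in> circ 1"
      have eI: "up e \<in> index_set" using e up_mem unfolding E_def by blast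
      have "up e = (1, snd (up e))" using e unfolding circ_eq by (auto simp: prod_eq_iff fst_up)
      then have "e = down (1, snd (up e))" using down_up by metis
      moreover have "snd (up e) \<in> {1..m}" using eI by (simp only: mem_Times_iff)
      ultimately show "e \<in> (\<lambda>k. down (1, k)) ` {1..m}" by blast
    qed (use down_1 in blast)
    have inj: "inj_on (\<lambda>k. down (1, k)) {1..m}"
      by (rule inj_onI) (subst (asm) down_inj, auto)
    have "mom E (ed x) = (\<Prod>k\<in>{1..m}. \<integral>\<omega>. a (ed x (down (1, k))) \<omega> * a (ed x (partner x (down (1, k)))) \<omega> \<partial>M)"
      unfolding mom_diagram[OF x] img prod.reindex[OF inj] o_def ..
    also have "\<dots> = ?G (to_perm x) (to_index x)"
    proof (rule prod.cong[OF refl])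
      fix k assume k: "k \<in> {1..m}"
      have I: "(1, k) \<in> index_set" using k by blast
      have "partner x (down (1, k)) \<in> E" using partner(1)[OF x down_1[OF k]] unfolding E_def by blast
      from up_mem[OF this] have I2: "(2, to_perm x k) \<in> index_set" unfolding to_perm_up[OF x k, symmetric] .
      have "to_index x (1, k) = ed x (down (1, k))" using I unfolding to_index_def by (simp only: restrict_apply' if_True)
      moreover have "to_index x (2, to_perm x k) = ed x (partner x (down (1, k)))"
        using I2 unfolding to_index_def by (simp only: restrict_apply' if_True to_perm_up[OF x k] down_up)
      ultimately show "(\<integral>\<omega>. a (ed x (down (1, k))) \<omega> * a (ed x (partner x (down (1, k)))) \<omega> \<partial>M) =
         (\<integral>\<omega>. a (to_index x (1, k)) \<omega> * a (to_index x (2, to_perm x k)) \<omega> \<partial>M)" by (simp only:)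
    qed
    finally show ?thesis by (rule sym)
  qed
  have "(\<Sum>x\<in>diagrams. mom E (ed x)) = (\<Sum>(g, P)\<in>Sigma (dihedral m) (\<lambda>g. S_OD n m r (pi_hat m g)). ?G g P)"
  proof (rule sum.reindex_bij_witness[of _ "\<lambda>(g, P). of_index P" "\<lambda>x. (to_perm x, to_index x)"], goal_cases)
    case (1 x)
    then show ?case using of_to_index by simp
  next
    case (2 x)
    then show ?case using to_perm_dihedral to_index_S_OD by blast
  next
    case (3 gP)
    then show ?case using to_of_index by (auto simp: split_def)
  next
    case (4 gP)
    then show ?case using of_index_diagrams(1) by (auto simp: split_def)
  next
    case (5 x)
    then show ?case using eq by simp
  qed
  also have "\<dots> = (\<Sum>g\<in>dihedral m. \<Sum>P\<in>S_OD n m r (pi_hat m g). ?G g P)"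
    by (rule sum.Sigma[symmetric]) (use finD finS in auto)
  finally have sum: "(\<Sum>x\<in>diagrams. mom E (ed x)) = (\<Sum>g\<in>dihedral m. \<Sum>P\<in>S_OD n m r (pi_hat m g). ?G g P)" .
  have c: "of_real (1 / sqrt (real n)) ^ (m + l) = (1 / of_nat n ^ m :: complex)"
    using inverse_sqrt_power[of m] unfolding ml[symmetric] .
  have mne: "m \<noteq> 1" "m \<noteq> 2" using m3 by linarith+
  show ?thesis unfolding main_sum_diagrams sum c V_def if_not_P[OF mne(1)] if_not_P[OF mne(2)] ..
qed

end

section \<open>The limit\<close>

text \<open>The triples not counted by \<open>alpha0_hat\<close> have all three entries
  equal.\<close>

lemma card_bad_triples_le:
  "card (bad_triples n r) \<le> alpha0_hat n r + n"
proof -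
  let ?A = "{(p, q, p'). p \<in> {1..n} \<and> q \<in> {1..n} \<and> p' \<in> {1..n} \<and> ((p, q), (q, p')) \<in> r \<and> p \<noteq> p'}"
  have fin: "finite ?A" by (rule finite_subset[of _ "{1..n} \<times> {1..n} \<times> {1..n}"]) auto
  have "card (bad_triples n r) \<le> card (?A \<union> (\<lambda>p. (p, p, p)) ` {1..n})"
    by (rule card_mono) (use fin in \<open>auto simp: bad_triples_def\<close>)
  also have "\<dots> \<le> card ?A + card ((\<lambda>p. (p, p, p)) ` {1..n})" by (rule card_Un_le)
  also have "card ((\<lambda>p. (p, p, p)) ` {1..n}) \<le> n"
    using card_image_le[of "{1..n}" "\<lambda>p. (p, p, p)"] by simp
  finally show ?thesis by (simp add: alpha0_hat_def)
qed

context covariance_model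
begin

lemma main_sum_neq:
  assumes "m \<noteq> l"
  shows "(\<Sum>x\<in>{x \<in> configs. main_config r x}. \<Sum>S\<in>matchings. contrib x S) = 0"
proof -
  have "{x \<in> configs. main_config r x} = {}" using assms unfolding main_config_def by blast
  then show ?thesis by (simp only: sum.empty)
qed

lemma main_sum:
  "of_real (1 / sqrt (real n)) ^ (m + l) *
     (\<Sum>x\<in>{x \<in> configs. main_config r x}. \<Sum>S\<in>matchings. contrib x S) =
   (if m = l then V n M r a m else 0)"
proof (cases "m = l")
  case True
  consider "m = 1" | "m = 2" | "m \<ge> 3" using m_pos by linarith
  then have "of_real (1 / sqrt (real n)) ^ (m + l) *
     (\<Sum>x\<in>{x \<in> configs. main_config r x}. \<Sum>S\<in>matchings. contrib x S) = V n M r a m"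
  proof cases
    case 1
    then have "l = 1" using True by metis
    with 1 show ?thesis by (rule main_sum_1)
  next
    case 2
    then have "l = 2" using True by metis
    with 2 show ?thesis by (rule main_sum_2)
  next
    case 3
    interpret equal_circles M n r a s m l
      by (unfold_locales) (rule True, rule 3)
    show ?thesis by (rule main_sum_3)
  qed
  then show ?thesis unfolding if_P[OF True] .
next
  case False
  show ?thesis unfolding main_sum_neq[OF False] if_not_P[OF False] by (rule mult_zero_right)
qed

end

text \<open>The constant is chosen before the probability space, the relation, the entries and
  \<open>n\<close>, so that the bound can be used along the whole sequence.\<close>

lemma covariance_error_bound:
  fixes s B C \<delta> :: real
  assumes "m \<ge> 1" "l \<ge> 1" "s > 0" "B \<ge> 0" "C \<ge> 1" "0 < \<delta>" "\<delta> \<le> 1 / 2"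
  shows "\<exists>K\<ge>0. \<forall>(M :: 'w measure) n r a. entry_model M n r a s \<longrightarrow>
      (\<forall>k\<le>m + l. \<forall>P\<in>pairs n. (\<integral>\<omega>. cmod (a P \<omega>) ^ k \<partial>M) \<le> B) \<longrightarrow>
      real (card (bad_triples n r)) \<le> C * real n powr (2 - \<delta>) \<longrightarrow>
      cmod (cov2 M (trace_cheb n a s m) (trace_cheb n a s l) - (if m = l then V n M r a m else 0))
        \<le> K * real n powr (- \<delta>) * real (alpha2 n r) ^ (m + l)"
proof -
  interpret two_circles m l by unfold_locales (use assms(1,2) in auto)
  define L where "L = max 1 (s\<^sup>2) ^ (m + l) * ((1 + real (m + l) * B) + (1 + real (m + l) * B) * (1 + real (m + l) * B))"
  define A where "A = real (card (E \<rightarrow>\<^sub>E Pow E)) * real (m + l) * C"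
  define K where "K = A * real (card (Pow E)) * L"
  have L0: "L \<ge> 0" unfolding L_def using \<open>B \<ge> 0\<close> by (intro mult_nonneg_nonneg add_nonneg_nonneg zero_le_power) auto
  have A0: "A \<ge> 0" unfolding A_def using \<open>C \<ge> 1\<close> by (intro mult_nonneg_nonneg) auto
  show ?thesis
  proof (intro exI[of _ K] conjI allI impI)
    show "K \<ge> 0" unfolding K_def using A0 L0 by (intro mult_nonneg_nonneg) auto
  next
    fix M :: "'w measure" and n r a
    assume em: "entry_model M n r a s"
      and B: "\<forall>k\<le>m + l. \<forall>P\<in>pairs n. (\<integral>\<omega>. cmod (a P \<omega>) ^ k \<partial>M) \<le> B"
      and T: "real (card (bad_triples n r)) \<le> C * real n powr (2 - \<delta>)"
    interpret entry_model M n r a s by (rule em)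
    interpret covariance_model M n r a s m l by unfold_locales
    have n: "real n > 0" using n_pos by simp
    have cm: "real (card matchings) \<le> real (card (Pow E))"
      by (rule of_nat_mono, rule card_mono) (use finite_E in \<open>auto simp: matchings_def\<close>)
    have "sqrt (real n) ^ (m + l) = real n powr (real (m + l) / 2)"
      using n by (simp add: powr_half_sqrt[symmetric] powr_realpow[symmetric] powr_powr)
    then have scale: "(1 / sqrt (real n)) ^ (m + l) = real n powr (- (real (m + l) / 2))"
      by (simp only: power_one_over powr_minus_divide)
    have rest: "real (card (rest_configs n r)) \<le>
        A * (real n powr (real (m + l) / 2 - \<delta>) * real (alpha2 n r) ^ (m + l))"
      using card_rest_configs[OF n_pos equiv_r r_transpose assms(5) T assms(6,7)]
      unfolding A_def by (simp only: mult_ac)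
    have "cmod (cov2 M (trace_cheb n a s m) (trace_cheb n a s l) - (if m = l then V n M r a m else 0))
        \<le> (1 / sqrt (real n)) ^ (m + l) * (real (card (rest_configs n r)) * (real (card matchings) * L))"
      unfolding main_sum[symmetric] L_def
      by (rule cov2_error[OF assms(3) _ assms(4)]) (rule B[rule_format])
    also have "\<dots> \<le> real n powr (- (real (m + l) / 2)) *
        ((A * (real n powr (real (m + l) / 2 - \<delta>) * real (alpha2 n r) ^ (m + l))) * (real (card (Pow E)) * L))"
      unfolding scale using rest cm L0 A0
      by (intro mult_left_mono mult_mono mult_right_mono mult_nonneg_nonneg) auto
    also have "\<dots> = K * (real n powr (- (real (m + l) / 2)) * real n powr (real (m + l) / 2 - \<delta>)) *
        real (alpha2 n r) ^ (m + l)"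
      unfolding K_def by (simp only: mult_ac)
    also have "real n powr (- (real (m + l) / 2)) * real n powr (real (m + l) / 2 - \<delta>) = real n powr (- \<delta>)"
      by (simp add: powr_add[symmetric])
    finally show "cmod (cov2 M (trace_cheb n a s m) (trace_cheb n a s l) - (if m = l then V n M r a m else 0))
        \<le> K * real n powr (- \<delta>) * real (alpha2 n r) ^ (m + l)" .
  qed
qed

theorem theorem3:
  fixes M :: "nat \<Rightarrow> 'w measure"
    and r :: "nat \<Rightarrow> ((nat \<times> nat) \<times> (nat \<times> nat)) set"
    and a :: "nat \<Rightarrow> nat \<times> nat \<Rightarrow> 'w \<Rightarrow> complex"
    and s :: real
    and m l :: nat
  assumes prob: "\<And>n. n \<ge> 1 \<Longrightarrow> prob_space (M n)"
    and equiv: "\<And>n. n \<ge> 1 \<Longrightarrow> equiv (pairs n) (r n)"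
    and transpose: "\<And>n p q. n \<ge> 1 \<Longrightarrow> (p, q) \<in> pairs n \<Longrightarrow> ((p, q), (q, p)) \<in> r n"
    and measurable: "\<And>n P. n \<ge> 1 \<Longrightarrow> P \<in> pairs n \<Longrightarrow> a n P \<in> borel_measurable (M n)"
    and hermitian: "\<And>n p q \<omega>. n \<ge> 1 \<Longrightarrow> (p, q) \<in> pairs n \<Longrightarrow> \<omega> \<in> space (M n) \<Longrightarrow>
          a n (p, q) \<omega> = cnj (a n (q, p) \<omega>)"
    and indep: "\<And>n. n \<ge> 1 \<Longrightarrow> indep_classes n (M n) (r n) (a n)"
    and centered: "\<And>n P. n \<ge> 1 \<Longrightarrow> P \<in> pairs n \<Longrightarrow> (\<integral>\<omega>. a n P \<omega> \<partial>M n) = 0"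
    and moments: "\<And>k::nat. \<exists>C. \<forall>n\<ge>1. \<forall>P\<in>pairs n.
          integrable (M n) (\<lambda>\<omega>. cmod (a n P \<omega>) ^ k) \<and>
          (\<integral>\<omega>. cmod (a n P \<omega>) ^ k \<partial>M n) \<le> C"
    and s_pos: "s > 0"
    and variance: "\<And>n p q. n \<ge> 1 \<Longrightarrow> (p, q) \<in> pairs n \<Longrightarrow> p \<noteq> q \<Longrightarrow>
          (\<integral>\<omega>. (cmod (a n (p, q) \<omega>))\<^sup>2 \<partial>M n) = s\<^sup>2"
    and C1: "\<And>\<epsilon>::real. \<epsilon> > 0 \<Longrightarrow> (\<lambda>n. real (alpha2 n (r n))) \<in> O(\<lambda>n. real n powr \<epsilon>)"
    and C2: "\<exists>\<delta>>0. (\<lambda>n. real (alpha0_hat n (r n))) \<in> O(\<lambda>n. real n powr (2 - \<delta>))"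
    and m: "m \<ge> 1"
    and l: "l \<ge> 1"
  shows "(\<lambda>n. cov2 (M n) (trace_cheb n (a n) s m) (trace_cheb n (a n) s l)
            - (if m = l then V n (M n) (r n) (a n) m else 0)) \<longlonglongrightarrow> 0"
proof -
  obtain \<delta>0 where \<delta>0: "\<delta>0 > 0" "(\<lambda>n. real (alpha0_hat n (r n))) \<in> O(\<lambda>n. real n powr (2 - \<delta>0))"
    using C2 by blast
  \<comment> \<open>One half is the deficit that the counting can afford to spend.\<close>
  define \<delta> where "\<delta> = min \<delta>0 (1 / 2)"
  have \<delta>: "0 < \<delta>" "\<delta> \<le> 1 / 2" "\<delta> \<le> \<delta>0" using \<delta>0(1) by (auto simp: \<delta>_def)
  obtain D where D: "D > 0" "\<forall>\<^sub>F n in sequentially. norm (real (alpha0_hat n (r n))) \<le> D * norm (real n powr (2 - \<delta>0))"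
    using \<delta>0(2) by (rule landau_o.bigE)
  \<comment> \<open>With this exponent the power \<open>m + l\<close> of \<open>alpha2\<close> costs
    at most the power \<open>\<delta> / 2\<close> of \<open>n\<close>, up to a constant, which is
    half of the gain.\<close>
  define \<epsilon> where "\<epsilon> = \<delta> / (2 * real (m + l))"
  have \<epsilon>: "\<epsilon> > 0" unfolding \<epsilon>_def using \<delta>(1) m by simp
  obtain A where A: "A > 0" "\<forall>\<^sub>F n in sequentially. norm (real (alpha2 n (r n))) \<le> A * norm (real n powr \<epsilon>)"
    using C1[OF \<epsilon>] by (rule landau_o.bigE)
  obtain c where c: "\<And>k n P. n \<ge> 1 \<Longrightarrow> P \<in> pairs n \<Longrightarrow> integrable (M n) (\<lambda>\<omega>. cmod (a n P \<omega>) ^ k)"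
      "\<And>k n P. n \<ge> 1 \<Longrightarrow> P \<in> pairs n \<Longrightarrow> (\<integral>\<omega>. cmod (a n P \<omega>) ^ k \<partial>M n) \<le> c k"
    using moments by metis
  define B where "B = (\<Sum>k\<le>m + l. \<bar>c k\<bar>)"
  have cB: "c k \<le> B" if "k \<le> m + l" for k
  proof -
    have "\<bar>c k\<bar> \<le> B" unfolding B_def by (rule member_le_sum) (use that in auto)
    then show ?thesis by linarith
  qed
  have B0: "B \<ge> 0" unfolding B_def by (intro sum_nonneg) auto
  \<comment> \<open>The additional \<open>1\<close> covers the at most \<open>n\<close> triples with
    equal entries and makes the constant at least one.\<close>
  have D1: "D + 1 \<ge> 1" using D(1) by simp
  obtain K where K: "K \<ge> 0"
    "\<forall>(M :: 'w measure) n r a. entry_model M n r a s \<longrightarrow>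
      (\<forall>k\<le>m + l. \<forall>P\<in>pairs n. (\<integral>\<omega>. cmod (a P \<omega>) ^ k \<partial>M) \<le> B) \<longrightarrow>
      real (card (bad_triples n r)) \<le> (D + 1) * real n powr (2 - \<delta>) \<longrightarrow>
      cmod (cov2 M (trace_cheb n a s m) (trace_cheb n a s l) - (if m = l then V n M r a m else 0))
        \<le> K * real n powr (- \<delta>) * real (alpha2 n r) ^ (m + l)"
    using covariance_error_bound[OF m l s_pos B0 D1 \<delta>(1,2), where 'w = 'w] by (elim exE conjE) (rule that)
  have model: "entry_model (M n) n (r n) (a n) s" if n: "n \<ge> 1" for n
    by (intro entry_model.intro entry_model_axioms.intro prob n equiv transpose measurable hermitian
        indep centered c(1) variance)
  have "\<forall>\<^sub>F n in sequentially. cmod (cov2 (M n) (trace_cheb n (a n) s m) (trace_cheb n (a n) s l)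
      - (if m = l then V n (M n) (r n) (a n) m else 0)) \<le> K * A ^ (m + l) * real n powr (- (\<delta> / 2))"
    using D(2) A(2) eventually_ge_at_top[of 1]
  proof eventually_elim
    case (elim n)
    have n1: "real n \<ge> 1" using elim(3) by simp
    have "real (card (bad_triples n (r n))) \<le> real (alpha0_hat n (r n)) + real n"
      using card_bad_triples_le[of n "r n"] by (metis of_nat_add of_nat_mono)
    also have "\<dots> \<le> D * real n powr (2 - \<delta>) + real n powr (2 - \<delta>)"
    proof (rule add_mono)
      have "real (alpha0_hat n (r n)) \<le> D * real n powr (2 - \<delta>0)" using elim(1) by simp
      also have "\<dots> \<le> D * real n powr (2 - \<delta>)"
        using D(1) \<delta>(3) n1 by (intro mult_left_mono powr_mono) auto
      finally show "real (alpha0_hat n (r n)) \<le> D * real n powr (2 - \<delta>)" .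
      have "real n = real n powr 1" using n1 by simp
      also have "\<dots> \<le> real n powr (2 - \<delta>)" using \<delta>(2) n1 by (intro powr_mono) auto
      finally show "real n \<le> real n powr (2 - \<delta>)" .
    qed
    also have "\<dots> = (D + 1) * real n powr (2 - \<delta>)" by (simp add: algebra_simps)
    finally have T: "real (card (bad_triples n (r n))) \<le> (D + 1) * real n powr (2 - \<delta>)" .
    have "cmod (cov2 (M n) (trace_cheb n (a n) s m) (trace_cheb n (a n) s l)
        - (if m = l then V n (M n) (r n) (a n) m else 0))
        \<le> K * real n powr (- \<delta>) * real (alpha2 n (r n)) ^ (m + l)"
      by (rule K(2)[rule_format, OF model[OF elim(3)] _ T]) (rule order_trans[OF c(2)[OF elim(3)] cB])
    also have "\<dots> \<le> K * real n powr (- \<delta>) * (A * real n powr \<epsilon>) ^ (m + l)"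
      using elim(2) K(1) by (intro mult_left_mono power_mono mult_nonneg_nonneg) auto
    also have "(A * real n powr \<epsilon>) ^ (m + l) = A ^ (m + l) * real n powr (\<delta> / 2)"
    proof -
      have "(real n powr \<epsilon>) ^ (m + l) = real n powr (\<epsilon> * real (m + l))"
        using n1 by (simp add: powr_realpow[symmetric] powr_powr)
      also have "\<epsilon> * real (m + l) = \<delta> / 2" unfolding \<epsilon>_def using m by (simp add: field_simps)
      finally show ?thesis by (simp only: power_mult_distrib)
    qed
    also have "K * real n powr (- \<delta>) * (A ^ (m + l) * real n powr (\<delta> / 2)) =
        K * A ^ (m + l) * (real n powr (- \<delta>) * real n powr (\<delta> / 2))"
      by (simp only: mult_ac)
    also have "real n powr (- \<delta>) * real n powr (\<delta> / 2) = real n powr (- (\<delta> / 2))"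
      by (simp add: powr_add[symmetric])
    finally show ?case .
  qed
  moreover have "(\<lambda>n. K * A ^ (m + l) * real n powr (- (\<delta> / 2))) \<longlonglongrightarrow> 0"
    by (intro tendsto_mult_right_zero tendsto_neg_powr filterlim_real_sequentially) (use \<delta>(1) in simp)
  ultimately show ?thesis
    by (rule Lim_null_comparison)
qed

end
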